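(* Let $f\in\mathcal{C}^{2}(\mathbb{R}^{d};\mathbb{R})$ satisfy $\alpha I_{d}\preceq \nabla^{2}f(x)\preceq \beta I_{d}$ for all $x\in\mathbb{R}^d$, for some constants $0<\alpha\le\beta$, and let $x^{\ast}=\operatorname{argmin}_{x\in\mathbb{R}^{d}}f(x)$. Let $\eta\in(0,1/\beta)$, let $m\ge 0$ and $n\ge 1$ be integers, and let $X_0$ be a random vector in $\mathbb{R}^d$ whose distribution satisfies a log-Sobolev inequality with constant $\kappa_0\ge 0$. Define the unadjusted Langevin algorithm (ULA) iterates $$X_{i}=X_{i-1}-\eta\nabla f(X_{i-1})+\sqrt{2\eta}Z_{i},\qquad i=1,\ldots,m+n,$$ where $Z_1,Z_2,\ldots$ are i.i.d. $\mathcal{N}_{d}(0,I_{d})$ and independent of $X_0$, and the sample covariance matrix $$\hat{\Sigma}_{n}=\frac{1}{n}\sum_{i=m+1}^{m+n}X_{i}X_{i}^{\top}-\bar{X}_{n}\bar{X}_{n}^{\top},\qquad \bar{X}_{n}=\frac{1}{n}\sum_{i=m+1}^{m+n}X_{i}.$$ Suppose $$m\ge 0\vee\left(\frac{\log(\kappa_{0}/\eta)}{\log(1/(1-\alpha\eta))}-1\right)\vee \left(\frac{\log\big(4(\mathbb{E}[|X_{0}-x^{\ast}|^{2}]+d/\alpha)/(\eta n)\big)}{\log(1/(1-\alpha\eta))}-1\right)$$ (with the convention $\log 0=-\infty$). Then for any $\delta>0$, with probability at least $1-4\delta$, $$\left\|\hat{\Sigma}_{n}-\mathbb{E}\left[\hat{\Sigma}_{n}\right]\right\|\le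 \frac{16}{\alpha}\left(8\sqrt{\frac{9d+4\log\delta^{-1}}{\alpha\eta n}}\vee \left(\frac{9 d+4\log\delta^{-1}}{\alpha\eta n}\right)\right).$$
   Context: $\|\cdot\|$ denotes the operator (spectral) norm of a matrix and $|\cdot|$ the Euclidean norm. A probability distribution $\nu$ on $\mathbb{R}^{k}$ satisfies a log-Sobolev inequality with constant $C\ge0$ if for every smooth $g:\mathbb{R}^{k}\to\mathbb{R}$ (with $\int g^2|\log g|\,d\nu<\infty$), $\int g^{2}\log g^{2}\,d\nu-\left(\int g^{2}d\nu\right)\log\left(\int g^{2}d\nu\right)\le 2C\int|\nabla g|^{2}d\nu$. In particular a point mass satisfies it with constant $0$. $a\vee b=\max\{a,b\}$. *)

theory Defs
  imports "HOL-Probability.Probability"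
begin

coinductive smooth_fun :: "(real^'d \<Rightarrow> real) \<Rightarrow> bool" where
  "(\<forall>x. g differentiable (at x)) \<Longrightarrow>
   (\<forall>i. smooth_fun (\<lambda>x. frechet_derivative g (at x) (axis i 1))) \<Longrightarrow> smooth_fun g"

definition grad :: "(real^'d \<Rightarrow> real) \<Rightarrow> real^'d \<Rightarrow> real^'d" where
  "grad g x = (\<chi> i. frechet_derivative g (at x) (axis i 1))"

definition log_sobolev :: "(real^'d) measure \<Rightarrow> real \<Rightarrow> bool" where
  "log_sobolev \<nu> C \<longleftrightarrow>
     (\<forall>g. smooth_fun g
          \<and> integrable \<nu> (\<lambda>x. (g x)^2 * \<bar>ln \<bar>g x\<bar>\<bar>)
          \<and> integrable \<nu> (\<lambda>x. (norm (grad g x))^2)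
       \<longrightarrow> (\<integral>x. (g x)^2 * ln ((g x)^2) \<partial>\<nu>)
             - (\<integral>x. (g x)^2 \<partial>\<nu>) * ln (\<integral>x. (g x)^2 \<partial>\<nu>)
           \<le> 2 * C * (\<integral>x. (norm (grad g x))^2 \<partial>\<nu>))"

definition std_gauss_density :: "real^'d \<Rightarrow> real" where
  "std_gauss_density x = (2 * pi) powr (- real CARD('d) / 2) * exp (- ((norm x)\<^sup>2) / 2)"

primrec ula :: "(real^'d \<Rightarrow> real^'d) \<Rightarrow> real \<Rightarrow> ('a \<Rightarrow> real^'d) \<Rightarrow> (nat \<Rightarrow> 'a \<Rightarrow> real^'d)
                 \<Rightarrow> nat \<Rightarrow> 'a \<Rightarrow> real^'d" where
  "ula gf \<eta> X0 Z 0 \<omega> = X0 \<omega>"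
| "ula gf \<eta> X0 Z (Suc i) \<omega> =
     ula gf \<eta> X0 Z i \<omega> - \<eta> *\<^sub>R gf (ula gf \<eta> X0 Z i \<omega>) + sqrt (2 * \<eta>) *\<^sub>R Z (Suc i) \<omega>"

definition outer :: "real^'d \<Rightarrow> real^'d \<Rightarrow> real^'d^'d" where
  "outer x y = (\<chi> j k. x $ j * y $ k)"

definition sample_cov :: "(nat \<Rightarrow> real^'d) \<Rightarrow> nat \<Rightarrow> nat \<Rightarrow> real^'d^'d" where
  "sample_cov X m n =
     (let Xbar = (1 / real n) *\<^sub>R (\<Sum>i\<in>{m+1..m+n}. X i)
      in (1 / real n) *\<^sub>R (\<Sum>i\<in>{m+1..m+n}. outer (X i) (X i)) - outer Xbar Xbar)"

end

theory Submission
  imports Defs "HOL-Computational_Algebra.Polynomial"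
begin

text \<open>
  The operator norm of a symmetric matrix is at most twice the maximum of its quadratic form over a
  1/4-net of the sphere with at most \<open>9 ^ d\<close> points, so it suffices to control
  \<open>u \<bullet> (\<Sigma> *v u) = F^2\<close> for fixed unit \<open>u\<close>, where \<open>F\<close> is the empirical standard deviation of the
  \<open>u \<bullet> X i\<close>.  The map \<open>x - \<eta> \<nabla>f x\<close> contracts by \<open>1 - \<alpha> \<eta>\<close>, hence for a deterministic starting point
  \<open>F\<close> is a Lipschitz function of the joint noise vector with constant of order \<open>1 / (\<alpha> sqrt (\<eta> n))\<close>,
  free of the dimension.  Maurey's form of Gaussian concentration, a consequence of the one-dimensional
  Prekopa--Leindler inequality that tensorizes, then makes \<open>F\<close> sub-Gaussian.

  The starting point is replaced by its mean \<open>a\<close>.  This changes \<open>F\<close> by at most a multiple of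
  \<open>(1 - \<alpha> \<eta>) ^ (m + 1) * norm (X0 - a)\<close>, and \<open>norm (X0 - a)\<close> is controlled through the net because Herbst's
  argument turns the log-Sobolev inequality into sub-Gaussian tails of linear functionals.  As the bound
  already contains the dimension, no joint log-Sobolev inequality for the path is required.
\<close>

section \<open>One-dimensional Prekopa--Leindler inequality\<close>

text \<open>The quantity to control is F^2, not F, and F^2 fluctuates like 2 g (F - g), where g is
  the mean of F for the deterministic start. So a bound on g itself is needed; it is 3 / sqrt
  \<alpha> and produces the square-root term of the theorem. No stationary law is built for this:
  the means of the projections at two times are compared by restarting the chain and driving a
  second copy from the original starting point by the same shifted noise.

  The constants come from one budget, q = 9 d + 4 log (1 / \<delta>). Each net point carries three
  bad events (two sides for the noise, one for the starting point), with thresholds chosen so that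
  each has probability at most exp (- q / 4). Because 9 \<le> exp (9/4), a union over 9^d points
  leaves \<delta> per kind of event. The same 9 d dominates the second moment of F - g, which is
  what allows the square to be centred at its own expectation. The burn-in conditions enter through
  \<rho>^(m+1) with \<rho> = 1 - \<alpha> \<eta>: it occurs squared, and one factor is spent on the
  size of the initial law.\<close>

lemma emeasure_le_below_point:
  fixes A :: "real set"
  assumes A: "A \<in> sets borel" "A \<noteq> {}" "bdd_above A" and e: "0 < e"
  obtains a where "a \<in> A" "emeasure lborel A \<le> emeasure lborel (A \<inter> {..a}) + ennreal e"
proof -
  obtain a where a: "a \<in> A" "Sup A - e < a"
    using less_cSup_iff[OF A(2,3), of "Sup A - e"] e by auto
  \<comment> \<open>The supremum need not be attained; beyond a point within \<open>e\<close> of it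
    only a piece of an interval of length \<open>e\<close> is lost.\<close>
  have "A \<subseteq> (A \<inter> {..a}) \<union> {a..a+e}"
    using cSup_upper[OF _ A(3)] a by force
  then have "emeasure lborel A \<le> emeasure lborel ((A \<inter> {..a}) \<union> {a..a+e})"
    using A by (intro emeasure_mono) auto
  also have "\<dots> \<le> emeasure lborel (A \<inter> {..a}) + emeasure lborel {a..a+e}"
    using A by (intro emeasure_subadditive) auto
  also have "emeasure lborel {a..a+e} = ennreal e"
    using e by simp
  finally show ?thesis using a that by blast
qed

lemma emeasure_lborel_uminus_image:
  fixes A :: "real set"
  assumes "A \<in> sets borel"
  shows "emeasure lborel (uminus -` A) = emeasure lborel A"
proof -
  have "emeasure lborel A = emeasure (distr lborel borel uminus) A"
    by (simp add: lborel_distr_uminus)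
  also have "\<dots> = emeasure lborel (uminus -` A)"
    using assms by (subst emeasure_distr) auto
  finally show ?thesis by simp
qed

text \<open>The preimage is the image of \<open>A\<close> under
  \<open>x \<mapsto> (x + b) / 2\<close>; written as a preimage it is visibly Borel.\<close>

lemma emeasure_lborel_half_shift:
  fixes A :: "real set"
  assumes A: "A \<in> sets borel"
  shows "emeasure lborel A = 2 * emeasure lborel ((\<lambda>x. 2 * x - b) -` A)"
proof -
  have "(lborel :: real measure) = density (distr lborel borel (\<lambda>x. - b + 2 * x)) (\<lambda>_. ennreal \<bar>2\<bar>)"
    by (rule lborel_real_affine) simp
  then have "emeasure lborel A = emeasure (density (distr lborel borel (\<lambda>x. - b + 2 * x)) (\<lambda>_. ennreal \<bar>2\<bar>)) A"
    by simp
  also have "\<dots> = 2 * emeasure (distr lborel borel (\<lambda>x. - b + 2 * x)) A"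
    using A by (subst emeasure_density_const) auto
  also have "\<dots> = 2 * emeasure lborel ((\<lambda>x. - b + 2 * x) -` A)"
    using A by (subst emeasure_distr) auto
  finally show ?thesis by (simp add: algebra_simps)
qed

text \<open>If \<open>a\<close> were the maximum of \<open>A\<close> and \<open>b\<close> the
  minimum of \<open>B\<close>, the midpoints of \<open>A\<close> with \<open>b\<close> and of
  \<open>B\<close> with \<open>a\<close> would give two half-size copies inside \<open>C\<close>
  meeting in at most one point. Near-extremal points cost \<open>e\<close>. A Borel superset
  \<open>C\<close> replaces the set of midpoints, which need not be Borel.\<close>

lemma brunn_minkowski_real_bdd:
  fixes A B C :: "real set"
  assumes A: "A \<in> sets borel" "A \<noteq> {}" "bdd_above A"
    and B: "B \<in> sets borel" "B \<noteq> {}" "bdd_below B"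
    and C: "C \<in> sets borel" "\<And>x y. x \<in> A \<Longrightarrow> y \<in> B \<Longrightarrow> (x + y) / 2 \<in> C"
  shows "emeasure lborel A + emeasure lborel B \<le> 2 * emeasure lborel C"
proof (rule ennreal_le_epsilon)
  fix e :: real assume e: "0 < e"
  obtain a where a: "a \<in> A" "emeasure lborel A \<le> emeasure lborel (A \<inter> {..a}) + ennreal (e/2)"
    using emeasure_le_below_point[OF A, of "e/2"] e by auto
  have B': "uminus -` B \<in> sets borel" using B(1) by (rule measurable_sets_borel[rotated]) simp
  have ne: "uminus -` B \<noteq> {}" using B(2) by (metis ex_in_conv minus_minus vimageI2)
  have "bdd_above (uminus -` B)"
  proof -
    obtain l where "\<And>x. x \<in> B \<Longrightarrow> l \<le> x" using B(3) by (auto simp: bdd_below_def)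
    then have "x \<le> - l" if "x \<in> uminus -` B" for x using that by fastforce
    then show ?thesis by (auto simp: bdd_above_def)
  qed
  from emeasure_le_below_point[OF B' ne this, of "e/2"] obtain c where
    c: "c \<in> uminus -` B" "emeasure lborel (uminus -` B) \<le> emeasure lborel (uminus -` B \<inter> {..c}) + ennreal (e/2)"
    using e by auto
  define b where "b = - c"
  have b: "b \<in> B" using c by (simp add: b_def)
  have "uminus -` B \<inter> {..c} = uminus -` (B \<inter> {b..})" by (auto simp: b_def)
  then have "emeasure lborel (uminus -` B \<inter> {..c}) = emeasure lborel (B \<inter> {b..})"
    using B(1) by (simp add: emeasure_lborel_uminus_image del: vimage_Int)
  with c(2) have b2: "emeasure lborel B \<le> emeasure lborel (B \<inter> {b..}) + ennreal (e/2)"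
    using B(1) by (simp add: emeasure_lborel_uminus_image)
  let ?A = "(\<lambda>x. 2 * x - b) -` (A \<inter> {..a})" and ?B = "(\<lambda>x. 2 * x - a) -` (B \<inter> {b..})"
  have mA: "?A \<in> sets borel" using A(1)
    by (intro measurable_sets_borel[of _ borel]) auto
  have mB: "?B \<in> sets borel" using B(1)
    by (intro measurable_sets_borel[of _ borel]) auto
  have sub: "?A \<subseteq> C" "?B \<subseteq> C"
    using C(2)[OF _ b] C(2)[OF a(1)] by fastforce+
  have "?A \<inter> ?B \<subseteq> {(a + b) / 2}" by auto
  then have "emeasure lborel (?A \<inter> ?B) \<le> emeasure lborel {(a + b) / 2}"
    by (rule emeasure_mono) simp
  then have 0: "?A \<inter> ?B \<in> null_sets lborel"
    using mA mB by (auto simp: null_sets_def)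
  have "emeasure lborel ?A + emeasure lborel ?B = emeasure lborel (?A \<union> ?B)"
    using emeasure_Un_Int[of ?A lborel ?B] mA mB 0 by (simp add: null_sets_def)
  also have "\<dots> \<le> emeasure lborel C"
    using sub C(1) by (intro emeasure_mono) auto
  finally have "2 * (emeasure lborel ?A + emeasure lborel ?B) \<le> 2 * emeasure lborel C"
    by (rule mult_left_mono) simp
  then have 1: "emeasure lborel (A \<inter> {..a}) + emeasure lborel (B \<inter> {b..}) \<le> 2 * emeasure lborel C"
    using A(1) B(1) emeasure_lborel_half_shift[of "A \<inter> {..a}" b] emeasure_lborel_half_shift[of "B \<inter> {b..}" a]
    by (simp add: distrib_left)
  have "emeasure lborel A + emeasure lborel B \<le>
     (emeasure lborel (A \<inter> {..a}) + ennreal (e/2)) + (emeasure lborel (B \<inter> {b..}) + ennreal (e/2))"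
    by (intro add_mono a b2)
  also have "\<dots> = (emeasure lborel (A \<inter> {..a}) + emeasure lborel (B \<inter> {b..})) + (ennreal (e/2) + ennreal (e/2))"
    by (simp add: ac_simps)
  also have "ennreal (e/2) + ennreal (e/2) = ennreal e"
    using e by (subst ennreal_plus[symmetric]) auto
  also have "(emeasure lborel (A \<inter> {..a}) + emeasure lborel (B \<inter> {b..})) + ennreal e \<le> 2 * emeasure lborel C + ennreal e"
    by (intro add_mono 1) simp
  finally show "emeasure lborel A + emeasure lborel B \<le> 2 * emeasure lborel C + ennreal e" .
qed

lemma brunn_minkowski_real:
  fixes A B C :: "real set"
  assumes A: "A \<in> sets borel" "A \<noteq> {}"
    and B: "B \<in> sets borel" "B \<noteq> {}"
    and C: "C \<in> sets borel" "\<And>x y. x \<in> A \<Longrightarrow> y \<in> B \<Longrightarrow> (x + y) / 2 \<in> C"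
  shows "emeasure lborel A + emeasure lborel B \<le> 2 * emeasure lborel C"
proof -
  obtain a b where a: "a \<in> A" and b: "b \<in> B" using A(2) B(2) by auto
  define A' where "A' k = A \<inter> {..a + real k}" for k
  define B' where "B' k = B \<inter> {b - real k..}" for k
  have "(\<lambda>k. emeasure lborel (A' k)) \<longlonglongrightarrow> emeasure lborel (\<Union>k. A' k)"
    using A(1) by (intro Lim_emeasure_incseq) (auto simp: A'_def incseq_def)
  moreover have "(\<Union>k. A' k) = A"
    by (auto simp: A'_def) (metis add.commute diff_le_eq real_arch_simple)
  moreover have "(\<lambda>k. emeasure lborel (B' k)) \<longlonglongrightarrow> emeasure lborel (\<Union>k. B' k)"
    using B(1) by (intro Lim_emeasure_incseq) (auto simp: B'_def incseq_def)
  moreover have "(\<Union>k. B' k) = B"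
    by (auto simp: B'_def) (metis add.commute diff_le_eq real_arch_simple)
  ultimately have "(\<lambda>k. emeasure lborel (A' k) + emeasure lborel (B' k)) \<longlonglongrightarrow> emeasure lborel A + emeasure lborel B"
    by (intro tendsto_add) auto
  moreover have "emeasure lborel (A' k) + emeasure lborel (B' k) \<le> 2 * emeasure lborel C" for k
  proof (rule brunn_minkowski_real_bdd[OF _ _ _ _ _ _ C(1)])
    show "bdd_above (A' k)" "bdd_below (B' k)" by (auto simp: A'_def B'_def)
    show "A' k \<noteq> {}" "B' k \<noteq> {}" using a b by (auto simp: A'_def B'_def)
  qed (use A B C in \<open>auto simp: A'_def B'_def\<close>)
  ultimately show ?thesis
    by (intro LIMSEQ_le_const2) auto
qed

text \<open>Layer-cake formula with levels measured in units of \<open>U\<close> and cut to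
  \<open>0 < t < 1\<close>; the exchange is Tonelli's theorem.\<close>

lemma nn_integral_level_sets:
  fixes h :: "real \<Rightarrow> real"
  assumes [measurable]: "h \<in> borel_measurable borel"
    and U: "0 < U"
  shows "(\<integral>\<^sup>+t. indicator {0<..<1} t * emeasure lborel {x. t * U < h x} \<partial>lborel)
           = (\<integral>\<^sup>+x. emeasure lborel {t. 0 < t \<and> t < 1 \<and> t * U < h x} \<partial>lborel)"
proof -
  have "(\<integral>\<^sup>+t. indicator {0<..<1} t * emeasure lborel {x. t * U < h x} \<partial>lborel)
      = (\<integral>\<^sup>+t. \<integral>\<^sup>+x. indicator {0<..<1} t * indicator {x. t * U < h x} x \<partial>lborel \<partial>lborel)"
  proof (rule nn_integral_cong)
    fix t :: real
    have "{x. t * U < h x} \<in> sets lborel" by measurable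
    then show "indicator {0<..<1} t * emeasure lborel {x. t * U < h x}
      = (\<integral>\<^sup>+x. indicator {0<..<1} t * indicator {x. t * U < h x} x \<partial>lborel)"
      by (simp add: nn_integral_cmult)
  qed
  also have "\<dots> = (\<integral>\<^sup>+x. \<integral>\<^sup>+t. indicator {0<..<1} t * indicator {x. t * U < h x} x \<partial>lborel \<partial>lborel)"
    by (intro lborel_pair.Fubini') measurable
  also have "\<dots> = (\<integral>\<^sup>+x. emeasure lborel {t. 0 < t \<and> t < 1 \<and> t * U < h x} \<partial>lborel)"
  proof (rule nn_integral_cong)
    fix x :: real
    have "(\<integral>\<^sup>+t. indicator {0<..<1} t * indicator {x. t * U < h x} x \<partial>lborel)
      = (\<integral>\<^sup>+t. indicator {t. 0 < t \<and> t < 1 \<and> t * U < h x} t \<partial>lborel)"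
      by (intro nn_integral_cong) (auto simp: indicator_def)
    also have "\<dots> = emeasure lborel {t. 0 < t \<and> t < 1 \<and> t * U < h x}"
      by (intro nn_integral_indicator) measurable
    finally show "(\<integral>\<^sup>+t. indicator {0<..<1} t * indicator {x. t * U < h x} x \<partial>lborel)
      = emeasure lborel {t. 0 < t \<and> t < 1 \<and> t * U < h x}" .
  qed
  finally show ?thesis .
qed

lemma nn_integral_level_sets_eq:
  fixes h :: "real \<Rightarrow> real"
  assumes [measurable]: "h \<in> borel_measurable borel"
    and U: "0 < U" and h: "\<And>x. 0 \<le> h x" "\<And>x. h x \<le> U"
  shows "(\<integral>\<^sup>+t. indicator {0<..<1} t * emeasure lborel {x. t * U < h x} \<partial>lborel)
           = (\<integral>\<^sup>+x. ennreal (h x / U) \<partial>lborel)"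
  unfolding nn_integral_level_sets[OF assms(1,2)]
proof (rule nn_integral_cong)
  fix x
  have "{t. 0 < t \<and> t < 1 \<and> t * U < h x} = {0<..<h x / U}"
  proof (rule set_eqI)
    fix t
    have "h x / U \<le> 1" using h(2)[of x] U by (simp add: divide_le_eq)
    then have "t * U < h x \<Longrightarrow> t < 1" using U less_le_trans[of t "h x / U" 1] by (simp add: less_divide_eq)
    then show "t \<in> {t. 0 < t \<and> t < 1 \<and> t * U < h x} \<longleftrightarrow> t \<in> {0<..<h x / U}"
      using U by (auto simp: less_divide_eq)
  qed
  then show "emeasure lborel {t. 0 < t \<and> t < 1 \<and> t * U < h x} = ennreal (h x / U)"
    using h(1)[of x] U by simp
qed

text \<open>Version for the midpoint function, whose supremum is not controlled: levels beyond
  \<open>U\<close> are lost, which leaves an upper bound.\<close>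

lemma nn_integral_level_sets_le:
  fixes h :: "real \<Rightarrow> real"
  assumes [measurable]: "h \<in> borel_measurable borel"
    and U: "0 < U" and h: "\<And>x. 0 \<le> h x"
  shows "(\<integral>\<^sup>+t. indicator {0<..<1} t * emeasure lborel {x. t * U < h x} \<partial>lborel)
           \<le> (\<integral>\<^sup>+x. ennreal (h x / U) \<partial>lborel)"
  unfolding nn_integral_level_sets[OF assms(1,2)]
proof (rule nn_integral_mono)
  fix x
  have "{t. 0 < t \<and> t < 1 \<and> t * U < h x} \<subseteq> {0<..<h x / U}"
    using U by (auto simp: less_divide_eq)
  then have "emeasure lborel {t. 0 < t \<and> t < 1 \<and> t * U < h x} \<le> emeasure lborel {0<..<h x / U}"
    by (intro emeasure_mono) auto
  then show "emeasure lborel {t. 0 < t \<and> t < 1 \<and> t * U < h x} \<le> ennreal (h x / U)"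
    using h(1)[of x] U by simp
qed

text \<open>Dividing \<open>u\<close> and \<open>v\<close> by their suprema makes every level set
  with \<open>t < 1\<close> nonempty, as the one-dimensional Brunn--Minkowski inequality requires.
  Integrating over levels gives an additive inequality for the normalized integrals, and the
  arithmetic-geometric mean inequality makes it multiplicative.\<close>

lemma prekopa_leindler_real_bounded:
  fixes u v w :: "real \<Rightarrow> real"
  assumes [measurable]: "u \<in> borel_measurable borel" "v \<in> borel_measurable borel" "w \<in> borel_measurable borel"
    and nonneg: "\<And>x. 0 \<le> u x" "\<And>x. 0 \<le> v x" "\<And>x. 0 \<le> w x"
    and bdd: "bdd_above (range u)" "bdd_above (range v)"
    and int: "integrable lborel u" "integrable lborel v" "integrable lborel w"
    and le: "\<And>x y. u x * v y \<le> (w ((x + y) / 2))^2"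
  shows "(\<integral>x. u x \<partial>lborel) * (\<integral>x. v x \<partial>lborel) \<le> (\<integral>x. w x \<partial>lborel)^2"
proof -
  define U V where "U = (SUP x. u x)" and "V = (SUP x. v x)"
  have uU: "u x \<le> U" and vV: "v x \<le> V" for x
    using bdd by (auto simp: U_def V_def intro: cSUP_upper)
  have U0: "0 \<le> U" "0 \<le> V" using uU[of 0] vV[of 0] nonneg(1,2)[of 0] by linarith+
  show ?thesis
  proof (cases "U = 0 \<or> V = 0")
    case True
    then have "(\<forall>x. u x = 0) \<or> (\<forall>x. v x = 0)" using uU vV nonneg by (metis order_antisym)
    then show ?thesis by auto
  next
    case False
    then have UV: "0 < U" "0 < V" using U0 by auto
    \<comment> \<open>The geometric mean of the suprema: levels \<open>t * U\<close> and
      \<open>t * V\<close> then multiply to the square of the level \<open>t * W\<close>.\<close>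
    define W where "W = sqrt (U * V)"
    have W: "0 < W" "W * W = U * V" using UV by (auto simp: W_def)
    let ?I = "\<lambda>h c. (\<integral>\<^sup>+t. indicator {0<..<1} t * emeasure lborel {x. t * c < h x} \<partial>lborel)"
    have meas: "(\<lambda>t. indicator {0<..<1} t * emeasure lborel {x. t * c < h x}) \<in> borel_measurable lborel"
      if [measurable]: "h \<in> borel_measurable borel" for c :: real and h :: "real \<Rightarrow> real"
    proof -
      have "{p \<in> space (borel \<Otimes>\<^sub>M borel). fst p * c < h (snd p)} \<in> sets (borel \<Otimes>\<^sub>M borel)"
        by measurable
      then have "{p. fst p * c < h (snd p)} \<in> sets (borel \<Otimes>\<^sub>M lborel)"
        by (simp add: space_pair_measure cong: sets_pair_measure_cong)
      then have "(\<lambda>t. emeasure lborel (Pair t -` {p. fst p * c < h (snd p)})) \<in> borel_measurable borel"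
        by (rule lborel.measurable_emeasure_Pair)
      then have [measurable]: "(\<lambda>t. emeasure lborel {x. t * c < h x}) \<in> borel_measurable lborel"
        by (simp add: vimage_def)
      show ?thesis by measurable
    qed
    have key: "emeasure lborel {x. t * U < u x} + emeasure lborel {x. t * V < v x} \<le> 2 * emeasure lborel {x. t * W < w x}"
      if t: "0 < t" "t < 1" for t
    proof (rule brunn_minkowski_real)
      show "{x. t * U < u x} \<in> sets borel" "{x. t * V < v x} \<in> sets borel" "{x. t * W < w x} \<in> sets borel"
        by measurable
      have "t * U < U" "t * V < V" using t UV by auto
      then show "{x. t * U < u x} \<noteq> {}" "{x. t * V < v x} \<noteq> {}"
        using less_cSUP_iff[OF _ bdd(1), of "t * U"] less_cSUP_iff[OF _ bdd(2), of "t * V"]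
        by (auto simp: U_def V_def)
      fix x y assume "x \<in> {x. t * U < u x}" "y \<in> {x. t * V < v x}"
      then have xy: "t * U < u x" "t * V < v y" by auto
      have "0 < t * U" "0 < t * V" using t UV by auto
      with xy have "(t * U) * (t * V) < u x * v y"
        by (intro mult_strict_mono) linarith+
      also have "\<dots> \<le> (w ((x + y) / 2))^2" by (rule le)
      also have "(t * U) * (t * V) = t * t * (W * W)"
        by (simp add: W(2))
      finally have "(t * W)^2 < (w ((x + y) / 2))^2"
        by (simp add: power2_eq_square ac_simps)
      then show "(x + y) / 2 \<in> {x. t * W < w x}"
        using nonneg(3) by (simp add: power2_less_imp_less)
    qed
    have "?I u U + ?I v V = (\<integral>\<^sup>+t. indicator {0<..<1} t * emeasure lborel {x. t * U < u x}
        + indicator {0<..<1} t * emeasure lborel {x. t * V < v x} \<partial>lborel)"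
      by (intro nn_integral_add[symmetric] meas) measurable
    also have "\<dots> \<le> (\<integral>\<^sup>+t. 2 * (indicator {0<..<1} t * emeasure lborel {x. t * W < w x}) \<partial>lborel)"
      using key by (intro nn_integral_mono) (auto simp: indicator_def)
    also have "\<dots> = 2 * ?I w W"
      by (intro nn_integral_cmult meas) measurable
    also have "\<dots> \<le> 2 * (\<integral>\<^sup>+x. ennreal (w x / W) \<partial>lborel)"
      by (intro mult_left_mono nn_integral_level_sets_le W nonneg) auto
    finally have "(\<integral>\<^sup>+x. ennreal (u x / U) \<partial>lborel) + (\<integral>\<^sup>+x. ennreal (v x / V) \<partial>lborel) \<le> 2 * (\<integral>\<^sup>+x. ennreal (w x / W) \<partial>lborel)"
      using UV nonneg uU vV by (simp add: nn_integral_level_sets_eq)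
    moreover have "(\<integral>\<^sup>+x. ennreal (h x / c) \<partial>lborel) = ennreal ((\<integral>x. h x \<partial>lborel) / c)"
      if "integrable lborel h" "\<And>x. 0 \<le> h x" "0 < c" for h :: "real \<Rightarrow> real" and c
      using that by (subst nn_integral_eq_integral) auto
    ultimately have "ennreal ((\<integral>x. u x \<partial>lborel) / U) + ennreal ((\<integral>x. v x \<partial>lborel) / V) \<le> 2 * ennreal ((\<integral>x. w x \<partial>lborel) / W)"
      using int nonneg UV W by simp
    also have "2 * ennreal ((\<integral>x. w x \<partial>lborel) / W) = ennreal (2 * ((\<integral>x. w x \<partial>lborel) / W))"
      using nonneg W by (subst ennreal_mult) (auto intro!: integral_nonneg divide_nonneg_pos)
    finally have "ennreal ((\<integral>x. u x \<partial>lborel) / U + (\<integral>x. v x \<partial>lborel) / V) \<le> ennreal (2 * ((\<integral>x. w x \<partial>lborel) / W))"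
      using nonneg UV by (subst ennreal_plus) (auto intro!: integral_nonneg divide_nonneg_pos)
    then have "(\<integral>x. u x \<partial>lborel) / U + (\<integral>x. v x \<partial>lborel) / V \<le> 2 * ((\<integral>x. w x \<partial>lborel) / W)"
      using nonneg W by (subst (asm) ennreal_le_iff) (auto intro!: integral_nonneg divide_nonneg_pos mult_nonneg_nonneg)
    moreover define a b c where "a = (\<integral>x. u x \<partial>lborel) / U" and "b = (\<integral>x. v x \<partial>lborel) / V" and "c = (\<integral>x. w x \<partial>lborel) / W"
    ultimately have abc: "a + b \<le> 2 * c" by simp
    have nn: "0 \<le> a" "0 \<le> b" "0 \<le> c"
      using UV W nonneg by (auto simp: a_def b_def c_def intro!: integral_nonneg divide_nonneg_pos)
    \<comment> \<open>Arithmetic-geometric mean inequality; multiplying by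
      \<open>U * V = W * W\<close> then undoes the normalization.\<close>
    have "4 * (a * b) \<le> (a + b)^2"
      using sum_squares_bound[of a b] by (simp add: power2_sum)
    also have "\<dots> \<le> (2 * c)^2" using abc nn by (intro power_mono) auto
    finally have "a * b \<le> c^2" by (simp add: power_mult_distrib)
    then have "(a * b) * (U * V) \<le> c^2 * (W * W)" using UV W by (simp add: mult_right_mono)
    then show ?thesis using UV W by (simp add: a_def b_def c_def power_divide power2_eq_square)
  qed
qed

section \<open>Exponential duality with quadratic cost\<close>

text \<open>
  Maurey's property for the cost \<open>c\<close>, with \<open>u = exp g\<close> and \<open>v = exp (- f)\<close>; quantifying over pairs
  instead of the infimal convolution of \<open>f\<close> avoids its measurability.
\<close>

definition exp_cost_duality :: "'a measure \<Rightarrow> ('a \<Rightarrow> 'a \<Rightarrow> real) \<Rightarrow> bool" where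
  "exp_cost_duality M c \<longleftrightarrow>
     (\<forall>u\<in>borel_measurable M. \<forall>v\<in>borel_measurable M.
        (\<forall>x\<in>space M. \<forall>y\<in>space M. u x * v y \<le> ennreal (exp (c x y)))
        \<longrightarrow> (\<integral>\<^sup>+x. u x \<partial>M) * (\<integral>\<^sup>+x. v x \<partial>M) \<le> 1)"

lemma exp_cost_dualityD:
  assumes "exp_cost_duality M c" "u \<in> borel_measurable M" "v \<in> borel_measurable M"
    and "\<And>x y. x \<in> space M \<Longrightarrow> y \<in> space M \<Longrightarrow> u x * v y \<le> ennreal (exp (c x y))"
  shows "(\<integral>\<^sup>+x. u x \<partial>M) * (\<integral>\<^sup>+x. v x \<partial>M) \<le> 1"
  using assms unfolding exp_cost_duality_def by blast

abbreviation std_normal :: "real measure" where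
  "std_normal \<equiv> density lborel (\<lambda>x. ennreal (std_normal_density x))"

text \<open>Prekopa--Leindler for the density times \<open>u\<close>, the density times
  \<open>v\<close>, and the density itself. By the parallelogram identity the factor
  \<open>exp ((x - y)^2 / 4)\<close> is exactly what turns the product of the densities at
  \<open>x\<close> and \<open>y\<close> into the squared density at the midpoint.\<close>

lemma exp_cost_duality_std_normal:
  "exp_cost_duality std_normal (\<lambda>x y. (x - y)^2 / 4)"
  unfolding exp_cost_duality_def
proof (intro ballI impI)
  fix u v :: "real \<Rightarrow> ennreal"
  assume "u \<in> borel_measurable std_normal" "v \<in> borel_measurable std_normal"
    and "\<forall>x\<in>space std_normal. \<forall>y\<in>space std_normal. u x * v y \<le> ennreal (exp ((x - y)^2 / 4))"
  then have [measurable]: "u \<in> borel_measurable borel" "v \<in> borel_measurable borel"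
    and uv: "\<And>x y. u x * v y \<le> ennreal (exp ((x - y)^2 / 4))"
    by auto
  \<comment> \<open>Truncation at level \<open>k\<close> supplies the bounded integrable functions
    needed below; it only decreases \<open>u\<close> and \<open>v\<close>, so the pairwise bound
    survives.\<close>
  define tr where "tr h k x = enn2real (min (h x) (of_nat k))" for h :: "real \<Rightarrow> ennreal" and k x
  have tr_meas[measurable]: "tr h k \<in> borel_measurable borel" if [measurable]: "h \<in> borel_measurable borel" for h k
    unfolding tr_def by measurable
  have tr_eq: "ennreal (tr h k x) = min (h x) (of_nat k)" for h k x
    unfolding tr_def by (intro ennreal_enn2real) (auto simp: min_less_iff_disj of_nat_less_top)
  have tr_nn: "0 \<le> tr h k x" for h k x by (simp add: tr_def)
  have tr_le: "tr h k x \<le> real k" for h k x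
    unfolding tr_def by (rule enn2real_leI) (auto simp: ennreal_of_nat_eq_real_of_nat)
  let ?g = std_normal_density
  have bounded: "(\<integral>\<^sup>+x. min (u x) (of_nat k) \<partial>std_normal) * (\<integral>\<^sup>+x. min (v x) (of_nat k) \<partial>std_normal) \<le> 1" for k
  proof -
    let ?u = "\<lambda>x. ?g x * tr u k x" and ?v = "\<lambda>x. ?g x * tr v k x"
    have g1: "?g x \<le> 1" for x
    proof -
      have "1 \<le> 2 * pi" using pi_gt3 by simp
      then have "1 / sqrt (2 * pi) \<le> 1" by (simp add: divide_le_eq)
      moreover have "exp (- x\<^sup>2 / 2) \<le> 1" by simp
      ultimately show ?thesis unfolding std_normal_density_def
        by (intro mult_le_one) auto
    qed
    have gnn: "0 \<le> ?g x" for x by simp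
    have int_g: "integrable lborel ?g" "(\<integral>x. ?g x \<partial>lborel) = 1"
      by (auto intro: integrable_normal_density simp: integral_normal_density)
    have int: "integrable lborel (\<lambda>x. ?g x * tr h k x)" if [measurable]: "h \<in> borel_measurable borel" for h
      using tr_le[of h k] tr_nn[of h k]
      by (intro Bochner_Integration.integrable_bound[OF integrable_mult_right[OF int_g(1), of "real k"]])
         (auto simp: abs_mult mult.commute[of _ "real k"] mult.commute[of "?g _"] intro!: mult_right_mono AE_I2)
    have bdd: "bdd_above (range (\<lambda>x. ?g x * tr h k x))" for h
    proof (rule bdd_aboveI2)
      fix x show "?g x * tr h k x \<le> 1 * real k"
        by (intro mult_mono g1 tr_le tr_nn) auto
    qed
    have "(\<integral>x. ?u x \<partial>lborel) * (\<integral>x. ?v x \<partial>lborel) \<le> (\<integral>x. ?g x \<partial>lborel)^2"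
    proof (rule prekopa_leindler_real_bounded)
      fix x y
      have "ennreal (tr u k x * tr v k y) \<le> u x * v y"
        by (auto simp: ennreal_mult tr_nn tr_eq intro!: mult_mono)
      also have "\<dots> \<le> ennreal (exp ((x - y)^2 / 4))" by (rule uv)
      finally have le: "tr u k x * tr v k y \<le> exp ((x - y)^2 / 4)"
        by (simp)
      have "?u x * ?v y = (?g x * ?g y) * (tr u k x * tr v k y)" by simp
      also have "\<dots> \<le> (?g x * ?g y) * exp ((x - y)^2 / 4)"
        using le by (intro mult_left_mono) auto
      also have "\<dots> = (?g ((x + y) / 2))^2"
      proof -
        have "exp (- x\<^sup>2 / 2) * exp (- y\<^sup>2 / 2) * exp ((x - y)\<^sup>2 / 4) = (exp (- ((x + y)/2)\<^sup>2 / 2))\<^sup>2"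
          unfolding exp_add[symmetric] exp_double[symmetric]
          by (simp add: power2_eq_square field_simps)
        then show ?thesis unfolding std_normal_density_def power2_eq_square by (simp add: field_simps)
      qed
      finally show "?u x * ?v y \<le> (?g ((x + y) / 2))^2" .
    qed (auto intro!: bdd int int_g tr_nn mult_nonneg_nonneg)
    then have le1: "(\<integral>x. ?u x \<partial>lborel) * (\<integral>x. ?v x \<partial>lborel) \<le> 1" by (simp add: int_g)
    have eq: "(\<integral>\<^sup>+x. min (h x) (of_nat k) \<partial>std_normal) = ennreal (\<integral>x. ?g x * tr h k x \<partial>lborel)"
      if [measurable]: "h \<in> borel_measurable borel" for h
    proof -
      have "(\<integral>\<^sup>+x. min (h x) (of_nat k) \<partial>std_normal) = (\<integral>\<^sup>+x. ennreal (?g x * tr h k x) \<partial>lborel)"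
        by (subst nn_integral_density) (auto simp: ennreal_mult tr_nn tr_eq)
      also have "\<dots> = ennreal (\<integral>x. ?g x * tr h k x \<partial>lborel)"
        by (rule nn_integral_eq_integral) (auto intro: int simp: tr_nn)
      finally show ?thesis .
    qed
    show ?thesis
      using le1 by (simp add: eq ennreal_mult'[symmetric] integral_nonneg tr_nn)
  qed
  have sup: "(\<lambda>k. \<integral>\<^sup>+x. min (h x) (of_nat k) \<partial>std_normal) \<longlonglongrightarrow> (\<integral>\<^sup>+x. h x \<partial>std_normal)"
    if [measurable]: "h \<in> borel_measurable borel" for h
  proof (rule nn_integral_LIMSEQ)
    show "mono (\<lambda>k x. min (h x) (of_nat k))"
      unfolding mono_def le_fun_def by (intro allI impI min.mono order_refl of_nat_mono)
    fix x
    show "(\<lambda>k. min (h x) (of_nat k)) \<longlonglongrightarrow> h x"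
    proof (cases "h x = \<top>")
      case True
      then show ?thesis by (simp add: of_nat_tendsto_top_ennreal)
    next
      case False
      then obtain r where r: "h x = ennreal r" "0 \<le> r" by (cases "h x") auto
      obtain K :: nat where K: "r \<le> real K" using real_arch_simple by blast
      have "min (h x) (of_nat k) = h x" if "K \<le> k" for k
        using that K r by (auto simp: min_def ennreal_of_nat_eq_real_of_nat)
      then show ?thesis
        by (intro tendsto_eventually) (auto simp: eventually_sequentially)
    qed
  qed auto
  show "(\<integral>\<^sup>+x. u x \<partial>std_normal) * (\<integral>\<^sup>+x. v x \<partial>std_normal) \<le> 1"
  \<comment> \<open>Multiplication of extended reals is discontinuous at zero times infinity, so a
    vanishing factor is treated apart from the limit.\<close>
  proof (cases "(\<integral>\<^sup>+x. u x \<partial>std_normal) = 0 \<or> (\<integral>\<^sup>+x. v x \<partial>std_normal) = 0")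
    case False
    have "(\<lambda>k. (\<integral>\<^sup>+x. min (u x) (of_nat k) \<partial>std_normal) * (\<integral>\<^sup>+x. min (v x) (of_nat k) \<partial>std_normal))
      \<longlonglongrightarrow> (\<integral>\<^sup>+x. u x \<partial>std_normal) * (\<integral>\<^sup>+x. v x \<partial>std_normal)"
      using False by (intro tendsto_mult_ennreal sup) auto
    then show ?thesis
      using bounded by (intro LIMSEQ_le_const2) auto
  qed auto
qed

lemma exp_cost_duality_PiM:
  fixes M :: "'i \<Rightarrow> 'a measure"
  assumes "product_sigma_finite M" and "finite I"
    and "\<And>i. i \<in> I \<Longrightarrow> exp_cost_duality (M i) (c i)"
  shows "exp_cost_duality (PiM I M) (\<lambda>x y. \<Sum>i\<in>I. c i (x i) (y i))"
  using assms(2,3)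
proof (induction I rule: finite_induct)
  case empty
  interpret product_sigma_finite M by fact
  show ?case unfolding exp_cost_duality_def by (auto simp: nn_integral_empty space_PiM)
next
  case (insert i I)
  interpret product_sigma_finite M by fact
  interpret I: finite_product_sigma_finite M I by standard fact
  let ?P = "PiM I M" and ?P' = "PiM (insert i I) M"
  have IH: "exp_cost_duality ?P (\<lambda>x y. \<Sum>i\<in>I. c i (x i) (y i))" and ci: "exp_cost_duality (M i) (c i)"
    using insert by auto
  show ?case unfolding exp_cost_duality_def
  proof (intro ballI impI)
    fix u v :: "('i \<Rightarrow> 'a) \<Rightarrow> ennreal"
    assume [measurable]: "u \<in> borel_measurable ?P'" "v \<in> borel_measurable ?P'"
      and uv: "\<forall>x\<in>space ?P'. \<forall>y\<in>space ?P'. u x * v y \<le> ennreal (exp (\<Sum>i\<in>insert i I. c i (x i) (y i)))"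
    have "(\<integral>\<^sup>+x. (\<integral>\<^sup>+a. u (x(i := a)) \<partial>M i) \<partial>?P) * (\<integral>\<^sup>+y. (\<integral>\<^sup>+b. v (y(i := b)) \<partial>M i) \<partial>?P) \<le> 1"
    proof (rule exp_cost_dualityD[OF IH])
      fix x y assume x: "x \<in> space ?P" and y: "y \<in> space ?P"
      define e where "e = (\<Sum>j\<in>I. c j (x j) (y j))"
      have [measurable]: "(\<lambda>a. u (x(i := a))) \<in> borel_measurable (M i)" "(\<lambda>b. v (y(i := b))) \<in> borel_measurable (M i)"
        using x y insert.hyps by (auto intro!: measurable_compose[OF measurable_component_update])
      have "(\<integral>\<^sup>+a. ennreal (exp (- e)) * u (x(i := a)) \<partial>M i) * (\<integral>\<^sup>+b. v (y(i := b)) \<partial>M i) \<le> 1"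
      proof (rule exp_cost_dualityD[OF ci])
        fix a b assume a: "a \<in> space (M i)" and b: "b \<in> space (M i)"
        have "x(i := a) \<in> space ?P'" "y(i := b) \<in> space ?P'"
          using x y a b by (auto simp: space_PiM PiE_def extensional_def)
        then have "u (x(i := a)) * v (y(i := b)) \<le> ennreal (exp (\<Sum>j\<in>insert i I. c j ((x(i := a)) j) ((y(i := b)) j)))"
          using uv by blast
        also have "(\<Sum>j\<in>insert i I. c j ((x(i := a)) j) ((y(i := b)) j)) = c i a b + e"
          using insert.hyps unfolding e_def by (auto intro!: sum.cong)
        finally have "ennreal (exp (- e)) * (u (x(i := a)) * v (y(i := b))) \<le> ennreal (exp (- e)) * ennreal (exp (c i a b + e))"
          by (rule mult_left_mono) simp
        also have "\<dots> = ennreal (exp (c i a b))"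
          by (simp add: ennreal_mult[symmetric] exp_add[symmetric])
        finally show "ennreal (exp (- e)) * u (x(i := a)) * v (y(i := b)) \<le> ennreal (exp (c i a b))"
          by (simp add: mult.assoc)
      qed measurable
      then have "ennreal (exp (- e)) * ((\<integral>\<^sup>+a. u (x(i := a)) \<partial>M i) * (\<integral>\<^sup>+b. v (y(i := b)) \<partial>M i)) \<le> 1"
        by (simp add: nn_integral_cmult mult.assoc)
      then have "ennreal (exp e) * (ennreal (exp (- e)) * ((\<integral>\<^sup>+a. u (x(i := a)) \<partial>M i) * (\<integral>\<^sup>+b. v (y(i := b)) \<partial>M i))) \<le> ennreal (exp e) * 1"
        by (rule mult_left_mono) simp
      then show "(\<integral>\<^sup>+a. u (x(i := a)) \<partial>M i) * (\<integral>\<^sup>+b. v (y(i := b)) \<partial>M i) \<le> ennreal (exp (\<Sum>j\<in>I. c j (x j) (y j)))"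
        by (simp add: mult.assoc[symmetric] ennreal_mult[symmetric] exp_add[symmetric] e_def)
    qed measurable
    then show "(\<integral>\<^sup>+x. u x \<partial>?P') * (\<integral>\<^sup>+y. v y \<partial>?P') \<le> 1"
      using insert.hyps by (simp add: product_nn_integral_insert)
  qed
qed

lemma exp_cost_duality_distr:
  assumes M: "exp_cost_duality M c" and [measurable]: "T \<in> measurable M N"
    and c: "\<And>x y. x \<in> space M \<Longrightarrow> y \<in> space M \<Longrightarrow> c' (T x) (T y) \<le> c x y"
  shows "exp_cost_duality (distr M N T) c'"
  unfolding exp_cost_duality_def
proof (intro ballI impI)
  fix u v :: "'b \<Rightarrow> ennreal"
  assume "u \<in> borel_measurable (distr M N T)" "v \<in> borel_measurable (distr M N T)"
    and uv: "\<forall>x\<in>space (distr M N T). \<forall>y\<in>space (distr M N T). u x * v y \<le> ennreal (exp (c' x y))"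
  then have [measurable]: "u \<in> borel_measurable N" "v \<in> borel_measurable N" by auto
  have "(\<integral>\<^sup>+x. u (T x) \<partial>M) * (\<integral>\<^sup>+x. v (T x) \<partial>M) \<le> 1"
  proof (rule exp_cost_dualityD[OF M])
    fix x y assume xy: "x \<in> space M" "y \<in> space M"
    then have "T x \<in> space N" "T y \<in> space N" by (auto intro: measurable_space)
    then have "u (T x) * v (T y) \<le> ennreal (exp (c' (T x) (T y)))" using uv by auto
    also have "\<dots> \<le> ennreal (exp (c x y))" using c[OF xy] by (intro ennreal_leI) simp
    finally show "u (T x) * v (T y) \<le> ennreal (exp (c x y))" .
  qed measurable
  then show "(\<integral>\<^sup>+x. u x \<partial>distr M N T) * (\<integral>\<^sup>+x. v x \<partial>distr M N T) \<le> 1"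
    by (simp add: nn_integral_distr)
qed

section \<open>The standard Gaussian vector as a product measure\<close>

lemma density_PiM:
  assumes "product_sigma_finite M" "finite I"
    and [measurable]: "\<And>i. i \<in> I \<Longrightarrow> f i \<in> borel_measurable (M i)"
    and sf: "product_sigma_finite (\<lambda>i. density (M i) (f i))"
  shows "PiM I (\<lambda>i. density (M i) (f i)) = density (PiM I M) (\<lambda>x. \<Prod>i\<in>I. f i (x i))"
proof -
  interpret product_sigma_finite M by fact
  interpret D: product_sigma_finite "\<lambda>i. density (M i) (f i)" by fact
  have s: "sets (PiM I (\<lambda>i. density (M i) (f i))) = sets (PiM I M)"
    by (intro sets_PiM_cong) auto
  have [measurable]: "(\<lambda>x. \<Prod>i\<in>I. f i (x i)) \<in> borel_measurable (PiM I M)"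
    by (intro borel_measurable_prod_ennreal measurable_compose[OF measurable_component_singleton]) auto
  show ?thesis
  proof (rule D.PiM_eqI[symmetric])
    fix A assume "\<And>i. i \<in> I \<Longrightarrow> A i \<in> sets (density (M i) (f i))"
    then have A[measurable]: "\<And>i. i \<in> I \<Longrightarrow> A i \<in> sets (M i)" by auto
    have "emeasure (density (PiM I M) (\<lambda>x. \<Prod>i\<in>I. f i (x i))) (Pi\<^sub>E I A)
      = (\<integral>\<^sup>+x. (\<Prod>i\<in>I. f i (x i)) * indicator (Pi\<^sub>E I A) x \<partial>PiM I M)"
      using A assms(2) by (intro emeasure_density sets_PiM_I_finite) auto
    also have "\<dots> = (\<integral>\<^sup>+x. (\<Prod>i\<in>I. f i (x i) * indicator (A i) (x i)) \<partial>PiM I M)"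
    proof (rule nn_integral_cong)
      fix x assume "x \<in> space (PiM I M)"
      then have "x \<in> extensional I" by (auto simp: space_PiM PiE_def)
      then have "(indicator (Pi\<^sub>E I A) x :: ennreal) = (\<Prod>i\<in>I. indicator (A i) (x i))"
        using assms(2) by (auto simp: indicator_def PiE_def Pi_def prod_zero_iff)
      then show "(\<Prod>i\<in>I. f i (x i)) * indicator (Pi\<^sub>E I A) x = (\<Prod>i\<in>I. f i (x i) * indicator (A i) (x i))"
        by (simp add: prod.distrib)
    qed
    also have "\<dots> = (\<Prod>i\<in>I. \<integral>\<^sup>+x. f i x * indicator (A i) x \<partial>M i)"
      using assms(2) by (intro product_nn_integral_prod) auto
    also have "\<dots> = (\<Prod>i\<in>I. emeasure (density (M i) (f i)) (A i))"
      using A by (intro prod.cong refl emeasure_density[symmetric]) auto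
    finally show "emeasure (density (PiM I M) (\<lambda>x. \<Prod>i\<in>I. f i (x i))) (Pi\<^sub>E I A)
      = (\<Prod>i\<in>I. emeasure (density (M i) (f i)) (A i))" .
  qed (use assms s in auto)
qed

definition std_gauss :: "(real^'d) measure" where
  "std_gauss = density lborel (\<lambda>x. ennreal (std_gauss_density x))"

lemma borel_measurable_std_gauss_density[measurable]: "std_gauss_density \<in> borel_measurable borel"
  unfolding std_gauss_density_def[abs_def] by measurable

lemma sets_std_gauss[measurable_cong, simp]: "sets std_gauss = sets borel"
  by (simp add: std_gauss_def)

lemma space_std_gauss[simp]: "space std_gauss = UNIV"
  by (simp add: std_gauss_def)

lemma product_sigma_finite_std_normal: "product_sigma_finite (\<lambda>_. std_normal)"
  by (intro product_sigma_finite.intro prob_space_imp_sigma_finite prob_space_normal_density) simp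

lemma norm_sq_eq_sum_Basis: "(norm x)^2 = (\<Sum>b\<in>Basis. (x \<bullet> b)^2)" for x :: "'a::euclidean_space"
  by (subst power2_norm_eq_inner, subst euclidean_inner) (simp add: power2_eq_square)

lemma std_gauss_eq_distr_PiM:
  "(std_gauss :: (real^'d) measure) = distr (PiM Basis (\<lambda>_. std_normal)) borel (\<lambda>f. \<Sum>b\<in>Basis. f b *\<^sub>R b)"
proof -
  let ?T = "\<lambda>f :: (real^'d) \<Rightarrow> real. \<Sum>b\<in>Basis. f b *\<^sub>R b"
  interpret product_sigma_finite "\<lambda>_. lborel :: real measure" ..
  have T: "?T \<in> borel_measurable (PiM Basis (\<lambda>_. lborel))" by measurable
  have "(lborel :: (real^'d) measure) = distr (PiM Basis (\<lambda>_. lborel)) borel ?T"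
    by (rule lborel_eq)
  then have "std_gauss = density (distr (PiM Basis (\<lambda>_. lborel)) borel ?T) (\<lambda>x :: real^'d. ennreal (std_gauss_density x))"
    by (simp add: std_gauss_def)
  also have "\<dots> = distr (density (PiM Basis (\<lambda>_. lborel)) (\<lambda>f. ennreal (std_gauss_density (?T f)))) borel ?T"
    by (rule density_distr) (use T in measurable)
  also have "density (PiM Basis (\<lambda>_. lborel)) (\<lambda>f. ennreal (std_gauss_density (?T f)))
    = density (PiM Basis (\<lambda>_. lborel)) (\<lambda>f. \<Prod>b\<in>(Basis :: (real^'d) set). ennreal (std_normal_density (f b)))"
  proof (rule density_cong)
    show "AE f in PiM Basis (\<lambda>_. lborel). ennreal (std_gauss_density (?T f)) = (\<Prod>b\<in>(Basis :: (real^'d) set). ennreal (std_normal_density (f b)))"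
    proof (rule AE_I2)
      fix f :: "real^'d \<Rightarrow> real"
      have "(norm (?T f))^2 = (\<Sum>b\<in>Basis. (?T f \<bullet> b)^2)"
        by (rule norm_sq_eq_sum_Basis)
      also have "\<dots> = (\<Sum>b\<in>Basis. (f b)^2)" by simp
      finally have n: "(norm (?T f))^2 = (\<Sum>b\<in>Basis. (f b)^2)" .
      have "(\<Prod>b\<in>(Basis :: (real^'d) set). std_normal_density (f b))
         = (1 / sqrt (2 * pi)) ^ CARD('d) * exp (\<Sum>b\<in>(Basis :: (real^'d) set). - (f b)\<^sup>2 / 2)"
        unfolding std_normal_density_def by (simp add: prod_dividef exp_sum power_divide)
      also have "(1 / sqrt (2 * pi)) ^ CARD('d) = (2 * pi) powr (- real CARD('d) / 2)"
      proof -
        have "1 / sqrt (2 * pi) = (2 * pi) powr (- 1/2)"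
          by (simp add: powr_minus_divide powr_half_sqrt)
        then have "(1 / sqrt (2 * pi)) ^ CARD('d) = ((2 * pi) powr (- 1/2)) powr real CARD('d)"
          using powr_realpow[of "(2 * pi) powr (- 1/2)" "CARD('d)"] by simp
        then show ?thesis by (simp add: powr_powr)
      qed
      also have "(\<Sum>b\<in>(Basis :: (real^'d) set). - (f b)\<^sup>2 / 2) = - ((norm (?T f))\<^sup>2) / 2"
        unfolding n by (simp add: sum_negf sum_divide_distrib)
      finally have "std_gauss_density (?T f) = (\<Prod>b\<in>(Basis :: (real^'d) set). std_normal_density (f b))"
        by (simp add: std_gauss_density_def)
      then show "ennreal (std_gauss_density (?T f)) = (\<Prod>b\<in>(Basis :: (real^'d) set). ennreal (std_normal_density (f b)))"
        by (simp add: prod_ennreal)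
    qed
  qed (use T in measurable)
  also have "\<dots> = PiM Basis (\<lambda>_. std_normal)"
    by (intro density_PiM[symmetric] product_sigma_finite_std_normal) (auto intro: product_sigma_finite_axioms)
  finally show ?thesis .
qed

lemma prob_space_std_gauss: "prob_space (std_gauss :: (real^'d) measure)"
proof -
  interpret prob_space "PiM (Basis :: (real^'d) set) (\<lambda>_. std_normal)"
    by (intro prob_space_PiM prob_space_normal_density) simp
  show ?thesis unfolding std_gauss_eq_distr_PiM by (intro prob_space_distr) measurable
qed

lemma exp_cost_duality_std_gauss:
  "exp_cost_duality (std_gauss :: (real^'d) measure) (\<lambda>x y. (norm (x - y))^2 / 4)"
  unfolding std_gauss_eq_distr_PiM
proof (rule exp_cost_duality_distr)
  show "exp_cost_duality (PiM (Basis :: (real^'d) set) (\<lambda>_. std_normal)) (\<lambda>x y. \<Sum>b\<in>Basis. (x b - y b)^2 / 4)"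
    by (intro exp_cost_duality_PiM product_sigma_finite_std_normal exp_cost_duality_std_normal finite_Basis)
  fix x y :: "real^'d \<Rightarrow> real"
  let ?T = "\<lambda>f :: (real^'d) \<Rightarrow> real. \<Sum>b\<in>Basis. f b *\<^sub>R b"
  have "(norm (?T x - ?T y))^2 = (\<Sum>b\<in>Basis. ((?T x - ?T y) \<bullet> b)^2)"
    by (rule norm_sq_eq_sum_Basis)
  also have "\<dots> = (\<Sum>b\<in>Basis. (x b - y b)^2)" by (simp add: inner_diff_left)
  finally show "(norm (?T x - ?T y))^2 / 4 \<le> (\<Sum>b\<in>Basis. (x b - y b)^2 / 4)"
    by (simp add: sum_divide_distrib)
qed measurable

section \<open>Sub-Gaussian variables\<close>

text \<open>\<open>C\<close> is a variance proxy. Since \<open>l\<close> has either sign, letting it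
  tend to 0 forces mean zero, hence the explicit centring in later uses. Integrability is demanded
  because a Bochner integral that does not exist is 0 and would satisfy the bound.\<close>

definition subgaussian :: "'a measure \<Rightarrow> ('a \<Rightarrow> real) \<Rightarrow> real \<Rightarrow> bool" where
  "subgaussian M Y C \<longleftrightarrow>
     (\<forall>l. integrable M (\<lambda>x. exp (l * Y x)) \<and> (\<integral>x. exp (l * Y x) \<partial>M) \<le> exp (C * l^2 / 2))"

lemma subgaussianD:
  assumes "subgaussian M Y C"
  shows "integrable M (\<lambda>x. exp (l * Y x))" "(\<integral>x. exp (l * Y x) \<partial>M) \<le> exp (C * l^2 / 2)"
  using assms by (auto simp: subgaussian_def)

lemma subgaussian_mono:
  assumes "subgaussian M Y C" "C \<le> C'"
  shows "subgaussian M Y C'"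
proof -
  have "exp (C * l^2 / 2) \<le> exp (C' * l^2 / 2)" for l
    using assms(2) by (simp add: mult_right_mono)
  with assms(1) show ?thesis unfolding subgaussian_def by (meson order_trans)
qed

lemma subgaussian_shift_iff:
  "subgaussian M (\<lambda>x. Y x - m) C \<longleftrightarrow>
     (\<forall>l. integrable M (\<lambda>x. exp (l * Y x)) \<and> (\<integral>x. exp (l * Y x) \<partial>M) \<le> exp (l * m + C * l^2 / 2))"
proof -
  have eq: "exp (l * (Y x - m)) = exp (- (l * m)) * exp (l * Y x)" for l x
    by (simp add: exp_add[symmetric] right_diff_distrib)
  have "exp (- (l * m)) * c \<le> exp (C * l^2 / 2) \<longleftrightarrow> c \<le> exp (l * m + C * l^2 / 2)" for l c
    by (simp only: exp_add exp_minus) (simp add: pos_divide_le_eq inverse_eq_divide mult.commute)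
  then show ?thesis
    unfolding subgaussian_def eq integral_mult_right_zero integrable_mult_left_iff by simp
qed

lemma exp_mult_le_of_abs_le:
  fixes y l B :: real
  assumes "\<bar>y\<bar> \<le> B"
  shows "exp (l * y) \<le> exp (\<bar>l\<bar> * B)"
proof -
  have "l * y \<le> \<bar>l\<bar> * \<bar>y\<bar>" by (metis abs_ge_self abs_mult)
  also have "\<dots> \<le> \<bar>l\<bar> * B" using assms by (rule mult_left_mono) simp
  finally show ?thesis by simp
qed

lemma exp_integrable_imp_measurable:
  assumes "integrable M (\<lambda>x. exp (Y x :: real))"
  shows "Y \<in> borel_measurable M"
proof -
  have "(\<lambda>x. ln (exp (Y x))) \<in> borel_measurable M"
    using assms by (intro borel_measurable_ln) (rule borel_measurable_integrable)
  then show ?thesis by simp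
qed

lemma subgaussian_measurable:
  assumes "subgaussian M Y C" shows "Y \<in> borel_measurable M"
  using subgaussianD(1)[OF assms, of 1] by (intro exp_integrable_imp_measurable) simp

lemma integrable_pointwise_bound:
  fixes f :: "'a \<Rightarrow> 'b::{banach, second_countable_topology}"
  assumes "integrable M g" "f \<in> borel_measurable M" "\<And>x. norm (f x) \<le> g x"
  shows "integrable M f"
  by (rule Bochner_Integration.integrable_bound[OF assms(1,2)])
    (use order_trans[OF assms(3) abs_ge_self] in simp)

text \<open>The terms of order 0 and 2 of the series of cosh, all of whose terms are
  nonnegative.\<close>

lemma power2_le_exp_add_exp: "x^2 + 2 \<le> exp x + exp (- x)" for x :: real
proof -
  let ?f = "\<lambda>n. if even n then x ^ n /\<^sub>R fact n else 0"
  have "sum ?f {..<3} \<le> suminf ?f"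
    by (rule sum_le_suminf[OF sums_summable[OF cosh_converges]]) (auto simp: zero_le_even_power)
  also have "suminf ?f = (exp x + exp (- x)) / 2"
    using sums_unique[OF cosh_converges[of x]] by (simp add: cosh_field_def)
  finally show ?thesis by (simp add: eval_nat_numeral)
qed

context prob_space
begin

lemma exp_integrable_imp_integrable_power2:
  assumes "\<And>l. integrable M (\<lambda>x. exp (l * Y x :: real))"
  shows "integrable M (\<lambda>x. (Y x)^2)"
proof (rule integrable_pointwise_bound)
  show "integrable M (\<lambda>x. exp (1 * Y x) + exp (- 1 * Y x))"
    by (intro Bochner_Integration.integrable_add assms)
  have [measurable]: "Y \<in> borel_measurable M"
    using assms[of 1] by (intro exp_integrable_imp_measurable) simp
  show "(\<lambda>x. (Y x)^2) \<in> borel_measurable M" by measurable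
  show "norm ((Y x)^2) \<le> exp (1 * Y x) + exp (- 1 * Y x)" for x
    using power2_le_exp_add_exp[of "Y x"] by simp
qed

lemma subgaussian_integrable_power2: "subgaussian M Y C \<Longrightarrow> integrable M (\<lambda>x. (Y x)^2)"
  by (rule exp_integrable_imp_integrable_power2[OF subgaussianD(1)])

text \<open>The previous inequality at \<open>l * Y\<close>, compared with the moment bound as
  \<open>l\<close> tends to 0; the limit keeps the constant \<open>C\<close> itself.\<close>

lemma subgaussian_second_moment:
  assumes Y: "subgaussian M Y C" and C: "0 < C"
  shows "expectation (\<lambda>x. (Y x)^2) \<le> C"
proof (rule field_le_epsilon)
  fix e :: real assume e: "0 < e"
  \<comment> \<open>\<open>h\<close> stands for \<open>C * l^2 / 2\<close>; the final bound
    \<open>C * (1 + h)\<close> exceeds \<open>C\<close> by at most \<open>e\<close>.\<close>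
  define h where "h = min 1 (e / C)"
  have h: "0 < h" "h \<le> 1" "C * h \<le> e" using e C by (auto simp: h_def min_def field_simps)
  define l where "l = sqrt (2 * h / C)"
  have l2: "l^2 = 2 * h / C" using h C by (simp add: l_def)
  have i: "integrable M (\<lambda>x. exp (l * Y x))" "integrable M (\<lambda>x. exp (- l * Y x))"
    by (rule subgaussianD(1)[OF Y])+
  have "l^2 * expectation (\<lambda>x. (Y x)^2) + 2 = expectation (\<lambda>x. (l * Y x)^2 + 2)"
    using subgaussian_integrable_power2[OF Y] by (simp add: power_mult_distrib prob_space)
  also have "\<dots> \<le> expectation (\<lambda>x. exp (l * Y x) + exp (- l * Y x))"
  proof (rule integral_mono)
    show "integrable M (\<lambda>x. (l * Y x)^2 + 2)"
      using subgaussian_integrable_power2[OF Y] by (simp add: power_mult_distrib)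
    show "(l * Y x)^2 + 2 \<le> exp (l * Y x) + exp (- l * Y x)" for x
      using power2_le_exp_add_exp[of "l * Y x"] by simp
  qed (rule Bochner_Integration.integrable_add[OF i])
  also have "\<dots> \<le> exp (C * l^2 / 2) + exp (C * (- l)^2 / 2)"
    using subgaussianD(2)[OF Y, of l] subgaussianD(2)[OF Y, of "- l"] i by simp
  also have "\<dots> = 2 * exp h" using C by (simp add: l2)
  also have "exp h \<le> 1 + h + h^2" using h by (intro exp_bound) auto
  finally have "l^2 * expectation (\<lambda>x. (Y x)^2) \<le> 2 * h * (1 + h)"
    by (simp add: algebra_simps power2_eq_square)
  then have "(2 * h) * expectation (\<lambda>x. (Y x)^2) \<le> (2 * h) * (C * (1 + h))"
    using C by (simp add: l2 field_simps)
  then have "expectation (\<lambda>x. (Y x)^2) \<le> C * (1 + h)"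
    using h by (simp only: mult_le_cancel_left_pos)
  then show "expectation (\<lambda>x. (Y x)^2) \<le> C + e" using h by (simp add: algebra_simps)
qed

lemma subgaussian_tail:
  assumes Y: "subgaussian M Y C" and C: "0 < C" and s: "0 \<le> s"
  shows "prob {x \<in> space M. s \<le> Y x} \<le> exp (- s\<^sup>2 / (2 * C))"
proof (cases "s = 0")
  case False
  then have s: "0 < s" using s by simp
  have [measurable]: "Y \<in> borel_measurable M" by (rule subgaussian_measurable[OF Y])
  have "prob {x \<in> space M. s \<le> Y x} = prob {x \<in> space M. exp (s / C * s) \<le> exp (s / C * Y x)}"
    using s C by (intro arg_cong[where f=prob]) (auto simp: divide_simps)
  also have "\<dots> \<le> expectation (\<lambda>x. exp (s / C * Y x)) / exp (s / C * s)"
    using subgaussianD(1)[OF Y, of "s / C"] by (intro integral_Markov_inequality_measure[where A="{}"]) auto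
  also have "\<dots> \<le> exp (C * (s / C)^2 / 2) / exp (s / C * s)"
    by (intro divide_right_mono subgaussianD(2)[OF Y]) auto
  also have "\<dots> = exp (- s\<^sup>2 / (2 * C))"
    using C by (simp add: exp_diff[symmetric] power2_eq_square field_simps)
  finally show ?thesis .
qed simp

text \<open>Duality with \<open>u = exp (l * F - l^2 * L)\<close> and
  \<open>v = exp (- l * F)\<close>: Young's inequality makes the pair admissible, which bounds the
  product of the moment generating functions at \<open>l\<close> and \<open>- l\<close>. Jensen's
  inequality removes the second factor. For the cost \<open>(norm (x - y))^2 / 4\<close>,
  \<open>L\<close> is the squared Lipschitz constant.\<close>

lemma subgaussian_lipschitz:
  assumes dual: "exp_cost_duality M c" and F[measurable]: "F \<in> borel_measurable M" and L: "0 \<le> L"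
    and lip: "\<And>x y. x \<in> space M \<Longrightarrow> y \<in> space M \<Longrightarrow> (F x - F y)^2 \<le> 4 * L * c x y"
    and c: "\<And>x y. x \<in> space M \<Longrightarrow> y \<in> space M \<Longrightarrow> 0 \<le> c x y"
  shows "integrable M F" "subgaussian M (\<lambda>x. F x - expectation F) (2 * L)"
proof -
  have prod: "(\<integral>\<^sup>+x. ennreal (exp (l * F x)) \<partial>M) * (\<integral>\<^sup>+x. ennreal (exp (- l * F x)) \<partial>M) \<le> ennreal (exp (l^2 * L))" for l
  proof -
    have "(\<integral>\<^sup>+x. ennreal (exp (- l\<^sup>2 * L) * exp (l * F x)) \<partial>M) * (\<integral>\<^sup>+x. ennreal (exp (- l * F x)) \<partial>M) \<le> 1"
    proof (rule exp_cost_dualityD[OF dual])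
      fix x y assume xy: "x \<in> space M" "y \<in> space M"
      have "l * (F x - F y) \<le> l^2 * L + c x y"
      proof (cases "L = 0")
        case True
        then show ?thesis using lip[OF xy] c[OF xy] by simp
      next
        case False
        then have L: "0 < L" using L by simp
        have "l * (F x - F y) - l^2 * L \<le> (F x - F y)^2 / (4 * L)"
        proof -
          have "0 \<le> (F x - F y - 2 * L * l)^2" by simp
          then have "4 * L * (l * (F x - F y) - l^2 * L) \<le> (F x - F y)^2"
            by (simp add: power2_eq_square algebra_simps)
          then show ?thesis using L by (simp add: pos_le_divide_eq mult.commute)
        qed
        also have "\<dots> \<le> c x y" using lip[OF xy] L by (simp add: pos_divide_le_eq mult.commute mult.left_commute)
        finally show ?thesis by simp
      qed
      then have "exp (- l\<^sup>2 * L) * exp (l * F x) * exp (- l * F y) \<le> exp (c x y)"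
        by (simp add: exp_add[symmetric] algebra_simps)
      then show "ennreal (exp (- l\<^sup>2 * L) * exp (l * F x)) * ennreal (exp (- l * F y)) \<le> ennreal (exp (c x y))"
        by (simp add: ennreal_mult[symmetric] ennreal_leI)
    qed measurable
    then have "ennreal (exp (- l\<^sup>2 * L)) * ((\<integral>\<^sup>+x. ennreal (exp (l * F x)) \<partial>M) * (\<integral>\<^sup>+x. ennreal (exp (- l * F x)) \<partial>M)) \<le> 1"
      by (simp add: ennreal_mult nn_integral_cmult mult.assoc)
    then have "ennreal (exp (l\<^sup>2 * L)) * (ennreal (exp (- l\<^sup>2 * L)) * ((\<integral>\<^sup>+x. ennreal (exp (l * F x)) \<partial>M) * (\<integral>\<^sup>+x. ennreal (exp (- l * F x)) \<partial>M)))
       \<le> ennreal (exp (l^2 * L)) * 1"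
      by (rule mult_left_mono) simp
    then show ?thesis
      by (simp add: mult.assoc[symmetric] ennreal_mult[symmetric] exp_add[symmetric])
  qed
  \<comment> \<open>The product is finite and the factor at \<open>- l\<close> is positive, so the
    factor at \<open>l\<close> cannot be infinite.\<close>
  have int_exp: "integrable M (\<lambda>x. exp (l * F x))" for l
  proof -
    have "(\<integral>\<^sup>+x. ennreal (exp (- l * F x)) \<partial>M) \<noteq> 0"
    proof
      assume "(\<integral>\<^sup>+x. ennreal (exp (- l * F x)) \<partial>M) = 0"
      then have "AE x in M. ennreal (exp (- l * F x)) = 0"
        by (subst (asm) nn_integral_0_iff_AE) auto
      then have "AE x in M. False" by (simp add: exp_gt_zero not_le)
      then show False by simp
    qed
    then have "(\<integral>\<^sup>+x. ennreal (exp (l * F x)) \<partial>M) \<noteq> \<top>"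
      using prod[of l] by (auto simp: ennreal_top_mult ennreal_mult_eq_top_iff top_unique)
    then show ?thesis
      by (intro integrableI_nonneg) (auto simp: less_top)
  qed
  show int: "integrable M F"
    by (rule square_integrable_imp_integrable[OF F exp_integrable_imp_integrable_power2[OF int_exp]])
  show "subgaussian M (\<lambda>x. F x - expectation F) (2 * L)"
    unfolding subgaussian_shift_iff
  proof (intro allI conjI)
    fix l
    let ?m = "expectation F"
    show "integrable M (\<lambda>x. exp (l * F x))" by (rule int_exp)
    have "exp (- l * ?m) = expectation (\<lambda>x. exp (- l * ?m) * (1 + (- l * (F x - ?m))))"
      using int by (simp add: prob_space)
    \<comment> \<open>Jensen's inequality through the tangent line of the exponential at the
      mean.\<close>
    also have "\<dots> \<le> expectation (\<lambda>x. exp (- l * F x))"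
    proof (rule integral_mono)
      fix x
      have "exp (- l * ?m) * (1 + (- l * (F x - ?m))) \<le> exp (- l * ?m) * exp (- l * (F x - ?m))"
        by (intro mult_left_mono exp_ge_add_one_self) simp
      then show "exp (- l * ?m) * (1 + (- l * (F x - ?m))) \<le> exp (- l * F x)"
        by (simp add: exp_add[symmetric] right_diff_distrib)
    qed (use int int_exp[of "- l"] in auto)
    finally have "expectation (\<lambda>x. exp (l * F x)) * exp (- l * ?m)
      \<le> expectation (\<lambda>x. exp (l * F x)) * expectation (\<lambda>x. exp (- l * F x))"
      by (intro mult_left_mono integral_nonneg) auto
    also have "\<dots> \<le> exp (l^2 * L)"
      using prod[of l] int_exp[of l] int_exp[of "- l"]
      by (simp add: nn_integral_eq_integral ennreal_mult[symmetric] integral_nonneg)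
    finally show "expectation (\<lambda>x. exp (l * F x)) \<le> exp (l * ?m + 2 * L * l^2 / 2)"
      by (simp add: exp_add exp_minus divide_simps mult.commute)
  qed
qed

end

section \<open>Herbst's argument\<close>

lemma grad_eqI:
  assumes "(g has_derivative (\<lambda>h. w \<bullet> h)) (at x)"
  shows "grad g x = w"
proof -
  have "frechet_derivative g (at x) = (\<lambda>h. w \<bullet> h)"
    using frechet_derivative_at[OF assms] by simp
  then show ?thesis by (simp add: grad_def vec_eq_iff inner_axis)
qed

text \<open>Keeping the numerator as an explicit polynomial shows the derivative to be of the same
  shape with \<open>j\<close> raised by one; this is the invariant for the coinductive notion of
  smoothness.\<close>

lemma has_real_derivative_poly_arctan:
  fixes p :: "real poly"
  shows "((\<lambda>s. poly p s / (1 + s^2) ^ j * exp (c * arctan s)) has_real_derivative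
     poly (pderiv p * [:1, 0, 1:] - [:0, 2 * real j:] * p + smult c p) s / (1 + s^2) ^ Suc j * exp (c * arctan s)) (at s)"
proof -
  have nz: "1 + s^2 \<noteq> 0" using zero_le_power2[of s] by linarith
  have d1: "((\<lambda>s. inverse ((1 + s^2) ^ j)) has_real_derivative - (2 * real j * s) / (1 + s^2) ^ Suc j) (at s)"
  proof (cases j)
    case (Suc k)
    define W where "W = 1 + s^2"
    have "((\<lambda>s. 1 + s^2) has_real_derivative 2 * s) (at s)"
      by (auto intro!: derivative_eq_intros)
    from DERIV_inverse'[OF DERIV_power_Suc[OF this, of k]]
    have "((\<lambda>s. inverse ((1 + s^2) ^ Suc k)) has_real_derivative
       - (inverse (W ^ Suc k) * (real (Suc k) * ((2 * s) * W ^ k)) * inverse (W ^ Suc k))) (at s)"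
      using nz by (simp add: W_def)
    moreover have "- (inverse (W ^ Suc k) * (real (Suc k) * ((2 * s) * W ^ k)) * inverse (W ^ Suc k))
      = - (2 * real (Suc k) * s) / W ^ Suc (Suc k)"
      using nz unfolding W_def[symmetric] by (simp add: divide_simps)
    ultimately show ?thesis by (simp only: Suc W_def)
  qed simp
  have "((\<lambda>s. poly p s * inverse ((1 + s^2) ^ j) * exp (c * arctan s)) has_real_derivative
     (poly (pderiv p) s * inverse ((1 + s^2) ^ j) + (- (2 * real j * s) / (1 + s^2) ^ Suc j) * poly p s) * exp (c * arctan s)
     + (exp (c * arctan s) * (c * inverse (1 + s^2))) * (poly p s * inverse ((1 + s^2) ^ j))) (at s)"
    by (intro DERIV_mult poly_DERIV d1 DERIV_fun_exp DERIV_cmult DERIV_arctan)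
  moreover have "(poly (pderiv p) s * inverse ((1 + s^2) ^ j) + (- (2 * real j * s) / (1 + s^2) ^ Suc j) * poly p s) * exp (c * arctan s)
     + (exp (c * arctan s) * (c * inverse (1 + s^2))) * (poly p s * inverse ((1 + s^2) ^ j))
    = poly (pderiv p * [:1, 0, 1:] - [:0, 2 * real j:] * p + smult c p) s / (1 + s^2) ^ Suc j * exp (c * arctan s)"
    using nz by (simp add: divide_simps) (simp add: algebra_simps power2_eq_square)
  ultimately show ?thesis by (simp add: divide_inverse)
qed

lemma has_derivative_ridge:
  fixes v :: "real^'d"
  assumes "(h has_real_derivative D) (at (v \<bullet> x))"
  shows "((\<lambda>x. h (v \<bullet> x)) has_derivative (\<lambda>y. (D *\<^sub>R v) \<bullet> y)) (at x)"
proof -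
  have "(h has_derivative (*) D) (at (v \<bullet> x))"
    using assms by (simp add: has_field_derivative_def)
  moreover have "((\<lambda>x. v \<bullet> x) has_derivative (\<lambda>y. v \<bullet> y)) (at x)"
    by (intro derivative_intros)
  ultimately have "(h \<circ> (\<lambda>x. v \<bullet> x) has_derivative (*) D \<circ> (\<lambda>y. v \<bullet> y)) (at x)"
    by (intro diff_chain_at)
  then show ?thesis by (simp add: o_def)
qed

text \<open>
  Truncating a linear functional by \<open>arctan\<close> keeps the test functions of the log-Sobolev inequality
  bounded and smooth: this family is closed under partial derivatives.
\<close>

lemma smooth_fun_poly_arctan:
  fixes v :: "real^'d"
  shows "smooth_fun (\<lambda>x. poly p (v \<bullet> x) / (1 + (v \<bullet> x)^2) ^ j * exp (c * arctan (v \<bullet> x)))"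
proof (coinduction arbitrary: p j)
  case smooth_fun
  let ?g = "\<lambda>x. poly p (v \<bullet> x) / (1 + (v \<bullet> x)^2) ^ j * exp (c * arctan (v \<bullet> x))"
  let ?q = "pderiv p * [:1, 0, 1:] - [:0, 2 * real j:] * p + smult c p"
  let ?D = "\<lambda>x. poly ?q (v \<bullet> x) / (1 + (v \<bullet> x)^2) ^ Suc j * exp (c * arctan (v \<bullet> x))"
  have d: "(?g has_derivative (\<lambda>y. (?D x *\<^sub>R v) \<bullet> y)) (at x)" for x
    by (rule has_derivative_ridge[OF has_real_derivative_poly_arctan])
  have "frechet_derivative ?g (at x) (axis i 1) = poly (smult (v $ i) ?q) (v \<bullet> x) / (1 + (v \<bullet> x)^2) ^ Suc j * exp (c * arctan (v \<bullet> x))" for x i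
    using frechet_derivative_at[OF d[of x], symmetric] by (simp add: inner_axis)
  then have "(\<lambda>x. frechet_derivative ?g (at x) (axis i 1)) = (\<lambda>x. poly (smult (v $ i) ?q) (v \<bullet> x) / (1 + (v \<bullet> x)^2) ^ Suc j * exp (c * arctan (v \<bullet> x)))" for i
    by blast
  moreover have "?g differentiable (at x)" for x
    using d differentiable_def by blast
  ultimately show ?case by blast
qed

lemma abs_exp_diff_le: "\<bar>exp a - exp b\<bar> \<le> \<bar>a - b\<bar> * (exp a + exp b)" for a b :: real
proof -
  have *: "exp a - exp b \<le> (a - b) * exp a" for a b :: real
  proof -
    have "exp a * (1 + (b - a)) \<le> exp a * exp (b - a)"
      by (intro mult_left_mono exp_ge_add_one_self) simp
    also have "\<dots> = exp b" by (simp add: exp_add[symmetric])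
    finally show ?thesis by (simp add: algebra_simps)
  qed
  have "(a - b) * exp a \<le> \<bar>a - b\<bar> * (exp a + exp b)" "(b - a) * exp b \<le> \<bar>a - b\<bar> * (exp a + exp b)"
    by (intro mult_mono; simp)+
  then show ?thesis using *[of a b] *[of b a] by linarith
qed

context prob_space
begin

text \<open>Differentiation under the integral by dominated convergence along sequences; a
  convergent sequence of increments is bounded, so one constant \<open>E\<close> dominates all the
  exponentials.\<close>

lemma mgf_has_real_derivative:
  assumes [measurable]: "\<psi> \<in> borel_measurable M" and B: "\<And>x. x \<in> space M \<Longrightarrow> \<bar>\<psi> x\<bar> \<le> B"
  shows "((\<lambda>l. expectation (\<lambda>x. exp (l * \<psi> x))) has_real_derivative expectation (\<lambda>x. \<psi> x * exp (l * \<psi> x))) (at l)"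
proof -
  have exp_le: "exp (a * \<psi> x) \<le> exp (\<bar>a\<bar> * B)" if "x \<in> space M" for a x
    by (rule exp_mult_le_of_abs_le[OF B[OF that]])
  have int: "integrable M (\<lambda>x. exp (a * \<psi> x))" for a
    using exp_le by (intro integrable_const_bound[where B="exp (\<bar>a\<bar> * B)"]) auto
  show ?thesis
    unfolding DERIV_def tendsto_at_iff_sequentially
  proof (intro allI impI)
    fix X :: "nat \<Rightarrow> real" assume X: "\<forall>i. X i \<in> UNIV - {0}" "X \<longlonglongrightarrow> 0"
    then have X0: "X i \<noteq> 0" for i by auto
    obtain K where K: "\<And>i. \<bar>X i\<bar> \<le> K"
      using convergent_imp_Bseq[of X] X(2) by (auto simp: convergent_def Bseq_def)
    have B0: "0 \<le> B" using B not_empty by (meson abs_ge_zero all_not_in_conv order_trans)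
    define E where "E = exp ((\<bar>l\<bar> + K) * B)"
    have eq: "((\<lambda>h. (expectation (\<lambda>x. exp ((l + h) * \<psi> x)) - expectation (\<lambda>x. exp (l * \<psi> x))) / h) \<circ> X)
      = (\<lambda>i. expectation (\<lambda>x. (exp ((l + X i) * \<psi> x) - exp (l * \<psi> x)) / X i))"
      by (simp add: fun_eq_iff int)
    show "((\<lambda>h. (expectation (\<lambda>x. exp ((l + h) * \<psi> x)) - expectation (\<lambda>x. exp (l * \<psi> x))) / h) \<circ> X)
      \<longlonglongrightarrow> expectation (\<lambda>x. \<psi> x * exp (l * \<psi> x))"
      unfolding eq
    proof (rule integral_dominated_convergence[where w="\<lambda>_. B * (E + E)"])
      show "AE x in M. (\<lambda>i. (exp ((l + X i) * \<psi> x) - exp (l * \<psi> x)) / X i) \<longlonglongrightarrow> \<psi> x * exp (l * \<psi> x)"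
      proof (rule AE_I2)
        fix x
        have "((\<lambda>a. exp (a * \<psi> x)) has_real_derivative \<psi> x * exp (l * \<psi> x)) (at l)"
          by (auto intro!: derivative_eq_intros)
        then show "(\<lambda>i. (exp ((l + X i) * \<psi> x) - exp (l * \<psi> x)) / X i) \<longlonglongrightarrow> \<psi> x * exp (l * \<psi> x)"
          using X unfolding DERIV_def tendsto_at_iff_sequentially by (auto simp: o_def)
      qed
      fix i
      show "AE x in M. norm ((exp ((l + X i) * \<psi> x) - exp (l * \<psi> x)) / X i) \<le> B * (E + E)"
      proof (rule AE_I2)
        fix x assume x: "x \<in> space M"
        have e1: "exp ((l + X i) * \<psi> x) \<le> E"
          using exp_le[OF x, of "l + X i"] K[of i] B0 unfolding E_def
          by (elim order_trans) (auto intro!: mult_right_mono)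
        have "0 \<le> K" using K[of 0] by linarith
        then have e2: "exp (l * \<psi> x) \<le> E"
          using exp_le[OF x, of "l"] B0 unfolding E_def
          by (elim order_trans) (auto intro!: mult_right_mono)
        have "\<bar>exp ((l + X i) * \<psi> x) - exp (l * \<psi> x)\<bar> \<le> \<bar>X i * \<psi> x\<bar> * (exp ((l + X i) * \<psi> x) + exp (l * \<psi> x))"
          using abs_exp_diff_le[of "(l + X i) * \<psi> x" "l * \<psi> x"] by (simp add: algebra_simps)
        also have "\<dots> \<le> (\<bar>X i\<bar> * B) * (E + E)"
          unfolding abs_mult using B[OF x] B0 e1 e2
          by (intro mult_mono add_mono mult_nonneg_nonneg add_nonneg_nonneg) auto
        finally show "norm ((exp ((l + X i) * \<psi> x) - exp (l * \<psi> x)) / X i) \<le> B * (E + E)"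
          using X0[of i] by (simp add: abs_divide divide_le_eq mult.commute mult.left_commute)
      qed
    qed auto
  qed
qed

text \<open>The entropy bound says that the cumulant generating function, after subtracting
  \<open>l * m + C * l^2 / 2\<close> and dividing by \<open>l\<close>, is nonincreasing. It tends to
  0 at the right of 0 because the mean was subtracted, so it is nonpositive.\<close>

lemma herbst_argument:
  fixes \<psi> :: "'a \<Rightarrow> real"
  assumes [measurable]: "\<psi> \<in> borel_measurable M" and B: "\<And>x. x \<in> space M \<Longrightarrow> \<bar>\<psi> x\<bar> \<le> B"
    and entropy: "\<And>l. 0 < l \<Longrightarrow>
      l * expectation (\<lambda>x. \<psi> x * exp (l * \<psi> x)) - expectation (\<lambda>x. exp (l * \<psi> x)) * ln (expectation (\<lambda>x. exp (l * \<psi> x)))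
        \<le> C * l^2 / 2 * expectation (\<lambda>x. exp (l * \<psi> x))"
    and l: "0 < l"
  shows "expectation (\<lambda>x. exp (l * \<psi> x)) \<le> exp (l * expectation \<psi> + C * l^2 / 2)"
proof -
  define H where "H l = expectation (\<lambda>x. exp (l * \<psi> x))" for l :: real
  define H1 where "H1 l = expectation (\<lambda>x. \<psi> x * exp (l * \<psi> x))" for l :: real
  define m where "m = expectation \<psi>"
  have H_deriv: "(H has_real_derivative H1 l) (at l)" for l
    unfolding H_def[abs_def] H1_def by (rule mgf_has_real_derivative[OF assms(1) B])
  have H_pos: "0 < H l" for l
  proof -
    have "exp (- \<bar>l\<bar> * B) \<le> exp (l * \<psi> x)" if "x \<in> space M" for x
      using exp_mult_le_of_abs_le[OF B[OF that], of "- l"] by simp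
    moreover have "integrable M (\<lambda>x. exp (l * \<psi> x))"
      using exp_mult_le_of_abs_le[OF B]
      by (intro integrable_const_bound[where B="exp (\<bar>l\<bar> * B)"]) auto
    ultimately have "exp (- \<bar>l\<bar> * B) \<le> H l"
      unfolding H_def by (intro integral_ge_const) auto
    then show ?thesis by (rule less_le_trans[rotated]) simp
  qed
  have H0: "H 0 = 1" "H1 0 = m" by (auto simp: H_def H1_def m_def prob_space)
  define A where "A l = ln (H l) - l * m - C * l^2 / 2" for l :: real
  have A_deriv: "(A has_real_derivative (H1 l / H l - m - C * l)) (at l)" for l
    unfolding A_def[abs_def]
    by (rule derivative_eq_intros H_deriv H_pos refl | simp)+
  have A_le: "l * (H1 l / H l - m - C * l) \<le> A l" if l: "0 < l" for l
  proof -
    have "l * H1 l - H l * ln (H l) \<le> C * l^2 / 2 * H l"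
      using entropy[OF l] by (simp add: H_def H1_def)
    then have "(l * H1 l - H l * ln (H l)) / H l \<le> C * l^2 / 2"
      using H_pos[of l] by (simp add: pos_divide_le_eq)
    moreover define x where "x = H1 l / H l"
    ultimately have "l * x - ln (H l) \<le> C * l^2 / 2"
      using H_pos[of l] by (simp add: diff_divide_distrib)
    then show ?thesis
      unfolding A_def x_def[symmetric] by (simp add: right_diff_distrib power2_eq_square mult.left_commute)
  qed
  have mono: "A l / l \<le> A s / s" if s: "0 < s" "s \<le> l" for s
  proof (rule DERIV_nonpos_imp_nonincreasing[OF s(2)])
    fix t assume t: "s \<le> t" "t \<le> l"
    then have t0: "0 < t" using s by simp
    have "((\<lambda>t. A t / t) has_real_derivative ((H1 t / H t - m - C * t) * t - A t * 1) / (t * t)) (at t)"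
      using t0 by (intro DERIV_divide A_deriv DERIV_ident) simp
    moreover have "((H1 t / H t - m - C * t) * t - A t * 1) / (t * t) \<le> 0"
      using A_le[OF t0] t0 by (simp add: divide_le_0_iff mult.commute)
    ultimately show "\<exists>d. ((\<lambda>t. A t / t) has_real_derivative d) (at t) \<and> d \<le> 0" by blast
  qed
  \<comment> \<open>\<open>A 0 = 0\<close> and the derivative of \<open>A\<close> at 0 is
    \<open>H1 0 / H 0 - m = 0\<close>.\<close>
  have "(\<lambda>s. (A (0 + s) - A 0) / s) \<midarrow>0\<rightarrow> 0"
    using A_deriv[of 0] H0 unfolding DERIV_def by simp
  then have "((\<lambda>s. A s / s) \<longlongrightarrow> 0) (at_right 0)"
    using H0 by (simp add: A_def filterlim_at_split)
  then have "A l / l \<le> 0"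
  proof (rule tendsto_lowerbound)
    show "eventually (\<lambda>s. A l / l \<le> A s / s) (at_right 0)"
      unfolding eventually_at_right_field using mono l by (intro exI[of _ l]) auto
  qed simp
  then have "ln (H l) \<le> l * m + C * l^2 / 2"
    using l by (simp add: A_def divide_le_0_iff)
  then have "exp (ln (H l)) \<le> exp (l * m + C * l^2 / 2)" by simp
  then show ?thesis unfolding exp_ln[OF H_pos] by (simp only: H_def m_def)
qed

end

section \<open>From the log-Sobolev inequality to sub-Gaussian linear functionals\<close>

lemma abs_arctan_le: "\<bar>arctan x\<bar> \<le> \<bar>x\<bar>"
proof -
  have *: "arctan x \<le> x" if "0 \<le> x" for x
  proof -
    have "arctan x - x \<le> arctan 0 - 0"
    proof (rule DERIV_nonpos_imp_nonincreasing[OF that])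
      fix t :: real
      have "((\<lambda>x. arctan x - x) has_real_derivative inverse (1 + t^2) - 1) (at t)"
        by (auto intro!: derivative_eq_intros)
      moreover have "inverse (1 + t^2) - 1 \<le> 0"
        by (simp add: inverse_le_1_iff)
      ultimately show "\<exists>d. ((\<lambda>x. arctan x - x) has_real_derivative d) (at t) \<and> d \<le> 0" by blast
    qed
    then show ?thesis by simp
  qed
  show ?thesis
    using *[of x] *[of "- x"] by (cases "0 \<le> x") (auto simp: arctan_minus)
qed

lemma abs_scaled_arctan_le: "0 < k \<Longrightarrow> \<bar>k * arctan (t / k)\<bar> \<le> k * pi"
  using arctan_lbound[of "t / k"] arctan_ubound[of "t / k"]
  by (auto simp: abs_mult intro!: mult_left_mono)

lemma scaled_arctan_tendsto: "(\<lambda>k. real (Suc k) * arctan (t / real (Suc k))) \<longlonglongrightarrow> t"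
proof -
  have "((\<lambda>h. arctan (t * h)) has_real_derivative t) (at 0)"
    by (auto intro!: derivative_eq_intros)
  then have "(\<lambda>h. arctan (t * h) / h) \<midarrow>0\<rightarrow> t" by (simp add: DERIV_def)
  moreover have "filterlim (\<lambda>k. inverse (real (Suc k))) (at 0) sequentially"
    using LIMSEQ_inverse_real_of_nat by (auto simp: filterlim_at)
  ultimately have "(\<lambda>k. arctan (t * inverse (real (Suc k))) / inverse (real (Suc k))) \<longlonglongrightarrow> t"
    by (rule filterlim_compose)
  then show ?thesis by (simp add: field_simps)
qed

text \<open>The test function is \<open>exp (l / 2 * \<psi> x)\<close>: its square is the integrand
  of the moment generating function, and its squared gradient is at most \<open>l^2 / 4\<close>
  times that square because \<open>\<psi>\<close> is 1-Lipschitz. The log-Sobolev inequality becomes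
  the entropy hypothesis of Herbst's argument.\<close>

lemma log_sobolev_mgf_arctan:
  fixes \<nu> :: "(real^'d) measure"
  assumes "prob_space \<nu>" and sets: "sets \<nu> = sets borel" and LSI: "log_sobolev \<nu> C" and C: "0 \<le> C"
    and u: "norm u \<le> 1" and k: "0 < k" and l: "0 < l"
  defines "\<psi> \<equiv> \<lambda>x. k * arctan (u \<bullet> x / k)"
  shows "(\<integral>x. exp (l * \<psi> x) \<partial>\<nu>) \<le> exp (l * (\<integral>x. \<psi> x \<partial>\<nu>) + C * l^2 / 2)"
proof -
  interpret prob_space \<nu> by fact
  note [measurable_cong] = sets
  have \<psi>_meas[measurable]: "\<psi> \<in> borel_measurable \<nu>" unfolding \<psi>_def by measurable
  have bd: "\<bar>\<psi> x\<bar> \<le> k * pi" for x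
    unfolding \<psi>_def by (rule abs_scaled_arctan_le[OF k])
  show ?thesis
  proof (rule herbst_argument[OF \<psi>_meas bd _ l])
    fix l :: real assume l: "0 < l"
    define v where "v = (1 / k) *\<^sub>R u"
    define c where "c = l / 2 * k"
    define g where "g x = exp (l / 2 * \<psi> x)" for x
    have g_eq: "g x = poly 1 (v \<bullet> x) / (1 + (v \<bullet> x)^2) ^ 0 * exp (c * arctan (v \<bullet> x))" for x
      by (simp add: g_def \<psi>_def v_def c_def mult.assoc)
    have smooth: "smooth_fun g"
      unfolding g_eq[abs_def] by (rule smooth_fun_poly_arctan)
    have "(g has_derivative (\<lambda>y. ((c * inverse (1 + (v \<bullet> x)^2) * g x) *\<^sub>R v) \<bullet> y)) (at x)" for x
    proof -
      have "((\<lambda>s. exp (c * arctan s)) has_real_derivative exp (c * arctan (v \<bullet> x)) * (c * inverse (1 + (v \<bullet> x)^2))) (at (v \<bullet> x))"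
        by (intro DERIV_fun_exp DERIV_cmult DERIV_arctan)
      from has_derivative_ridge[OF this] show ?thesis
        by (simp add: g_eq[abs_def] ac_simps)
    qed
    then have grad: "grad g x = (c * inverse (1 + (v \<bullet> x)^2) * g x) *\<^sub>R v" for x
      by (rule grad_eqI)
    have g_sq: "(g x)^2 = exp (l * \<psi> x)" for x
      by (simp add: g_def exp_double[symmetric])
    have grad_le: "(norm (grad g x))^2 \<le> l^2 / 4 * exp (l * \<psi> x)" for x
    proof -
      have "norm (grad g x) = (l / 2 * k) * inverse (1 + (v \<bullet> x)^2) * g x * (norm u / k)"
        using l k unfolding grad by (simp add: c_def v_def abs_mult g_def add_nonneg_nonneg)
      also have "\<dots> \<le> (l / 2 * k) * 1 * g x * (1 / k)"
        using l k u by (intro mult_mono divide_right_mono) (auto simp: g_def inverse_le_1_iff add_nonneg_nonneg)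
      also have "\<dots> = l / 2 * g x" using k by simp
      finally have "(norm (grad g x))^2 \<le> (l / 2 * g x)^2" by (intro power_mono) auto
      then show ?thesis by (simp add: power_mult_distrib g_sq power_divide)
    qed
    have exp_le: "exp (l * \<psi> x) \<le> exp (l * (k * pi))" for x
      using bd[of x] l by (simp add: abs_le_iff)
    have i1: "integrable \<nu> (\<lambda>x. exp (l * \<psi> x))"
      using exp_le by (intro integrable_const_bound[where B="exp (l * (k * pi))"]) auto
    have i2: "integrable \<nu> (\<lambda>x. \<psi> x * exp (l * \<psi> x))"
    proof (rule integrable_const_bound[where B="(k * pi) * exp (l * (k * pi))"])
      show "AE x in \<nu>. norm (\<psi> x * exp (l * \<psi> x)) \<le> (k * pi) * exp (l * (k * pi))"
        unfolding real_norm_def abs_mult abs_exp_cancel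
        using k by (intro AE_I2 mult_mono bd exp_le) auto
    qed measurable
    have g_meas[measurable]: "g \<in> borel_measurable \<nu>" unfolding g_def by measurable
    have grad_meas[measurable]: "grad g \<in> borel_measurable \<nu>"
      unfolding grad[abs_def] by measurable
    have i3: "integrable \<nu> (\<lambda>x. (norm (grad g x))^2)"
      by (rule integrable_pointwise_bound[OF integrable_mult_right[OF i1, of "l^2 / 4"]])
         (use grad_le in auto)
    have i4: "integrable \<nu> (\<lambda>x. (g x)^2 * \<bar>ln \<bar>g x\<bar>\<bar>)"
    proof -
      have "(g x)^2 * \<bar>ln \<bar>g x\<bar>\<bar> = l / 2 * \<bar>\<psi> x * exp (l * \<psi> x)\<bar>" for x
        using l by (simp add: g_sq) (simp add: g_def abs_mult)
      then have "(\<lambda>x. (g x)^2 * \<bar>ln \<bar>g x\<bar>\<bar>) = (\<lambda>x. l / 2 * \<bar>\<psi> x * exp (l * \<psi> x)\<bar>)" by blast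
      then show ?thesis
        by (simp only:) (intro integrable_mult_right Bochner_Integration.integrable_abs i2)
    qed
    from LSI smooth i3 i4 have "(\<integral>x. (g x)^2 * ln ((g x)^2) \<partial>\<nu>) - (\<integral>x. (g x)^2 \<partial>\<nu>) * ln (\<integral>x. (g x)^2 \<partial>\<nu>)
       \<le> 2 * C * (\<integral>x. (norm (grad g x))^2 \<partial>\<nu>)"
      unfolding log_sobolev_def by blast
    also have "\<dots> \<le> 2 * C * (\<integral>x. l^2 / 4 * exp (l * \<psi> x) \<partial>\<nu>)"
      using C i1 by (intro mult_left_mono integral_mono i3 grad_le) auto
    also have "(\<integral>x. (g x)^2 * ln ((g x)^2) \<partial>\<nu>) = l * (\<integral>x. \<psi> x * exp (l * \<psi> x) \<partial>\<nu>)"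
      by (simp add: g_sq mult.left_commute mult.assoc) (simp add: mult.commute)
    finally show "l * (\<integral>x. \<psi> x * exp (l * \<psi> x) \<partial>\<nu>) - (\<integral>x. exp (l * \<psi> x) \<partial>\<nu>) * ln (\<integral>x. exp (l * \<psi> x) \<partial>\<nu>)
        \<le> C * l^2 / 2 * (\<integral>x. exp (l * \<psi> x) \<partial>\<nu>)"
      by (simp add: g_sq)
  qed
qed

lemma log_sobolev_subgaussian_arctan:
  fixes \<nu> :: "(real^'d) measure"
  assumes P: "prob_space \<nu>" and sets: "sets \<nu> = sets borel" and LSI: "log_sobolev \<nu> C" and C: "0 \<le> C"
    and u: "norm u \<le> 1" and k: "0 < k"
  defines "\<psi> \<equiv> \<lambda>x. k * arctan (u \<bullet> x / k)"
  shows "subgaussian \<nu> (\<lambda>x. \<psi> x - (\<integral>x. \<psi> x \<partial>\<nu>)) C"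
  unfolding subgaussian_shift_iff
proof (intro allI conjI)
  interpret prob_space \<nu> by fact
  note [measurable_cong] = sets
  fix l :: real
  let ?m = "\<integral>x. \<psi> x \<partial>\<nu>"
  have [measurable]: "\<psi> \<in> borel_measurable \<nu>" unfolding \<psi>_def by measurable
  have bd: "\<bar>\<psi> x\<bar> \<le> k * pi" for x
    unfolding \<psi>_def by (rule abs_scaled_arctan_le[OF k])
  show "integrable \<nu> (\<lambda>x. exp (l * \<psi> x))"
    using exp_mult_le_of_abs_le[OF bd]
    by (intro integrable_const_bound[where B="exp (\<bar>l\<bar> * (k * pi))"]) auto
  show "(\<integral>x. exp (l * \<psi> x) \<partial>\<nu>) \<le> exp (l * ?m + C * l^2 / 2)"
  proof (cases l "0 :: real" rule: linorder_cases)
    case less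
    \<comment> \<open>The arctangent is odd, so a negative \<open>l\<close> for \<open>u\<close> is
      a positive one for \<open>- u\<close>.\<close>
    have eq: "k * arctan (- u \<bullet> x / k) = - \<psi> x" for x
      by (simp add: \<psi>_def arctan_minus)
    have "(\<integral>x. exp (- l * (k * arctan (- u \<bullet> x / k))) \<partial>\<nu>)
      \<le> exp (- l * (\<integral>x. k * arctan (- u \<bullet> x / k) \<partial>\<nu>) + C * (- l)^2 / 2)"
      using less by (intro log_sobolev_mgf_arctan[OF P sets LSI C _ k]) (auto simp: u)
    then show ?thesis unfolding eq by simp
  next
    case greater
    then show ?thesis unfolding \<psi>_def by (rule log_sobolev_mgf_arctan[OF P sets LSI C u k])
  qed (simp add: prob_space)
qed

text \<open>Limit of the truncations: bounded truncated means give exponential moments of the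
  functional by Fatou's lemma, and these provide the dominating functions that carry means and
  moment bounds to the limit.\<close>

lemma log_sobolev_subgaussian:
  fixes \<nu> :: "(real^'d) measure"
  assumes P: "prob_space \<nu>" and sets: "sets \<nu> = sets borel" and LSI: "log_sobolev \<nu> C" and C: "0 \<le> C"
    and u: "norm u \<le> 1"
  shows "integrable \<nu> (\<lambda>x. u \<bullet> x)" "subgaussian \<nu> (\<lambda>x. u \<bullet> x - (\<integral>x. u \<bullet> x \<partial>\<nu>)) C"
proof -
  interpret prob_space \<nu> by fact
  note [measurable_cong] = sets
  define \<psi> where "\<psi> k x = real (Suc k) * arctan (u \<bullet> x / real (Suc k))" for k x
  define m where "m k = expectation (\<psi> k)" for k
  have [measurable]: "\<psi> k \<in> borel_measurable \<nu>" for k unfolding \<psi>_def by measurable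
  have sg: "subgaussian \<nu> (\<lambda>x. \<psi> k x - m k) C" for k
    unfolding \<psi>_def m_def by (rule log_sobolev_subgaussian_arctan[OF P sets LSI C u]) simp
  have \<psi>_lim: "(\<lambda>k. \<psi> k x) \<longlonglongrightarrow> u \<bullet> x" for x
    unfolding \<psi>_def by (rule scaled_arctan_tendsto)
  have \<psi>_le: "\<bar>\<psi> k x\<bar> \<le> \<bar>u \<bullet> x\<bar>" for k x
  proof -
    have "\<bar>\<psi> k x\<bar> = real (Suc k) * \<bar>arctan (u \<bullet> x / real (Suc k))\<bar>"
      by (simp add: \<psi>_def abs_mult)
    also have "\<dots> \<le> real (Suc k) * \<bar>u \<bullet> x / real (Suc k)\<bar>"
      by (intro mult_left_mono abs_arctan_le) simp
    also have "\<dots> = \<bar>u \<bullet> x\<bar>" by (simp add: abs_divide del: of_nat_Suc)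
    finally show ?thesis .
  qed
  obtain R :: nat where R: "prob {x \<in> space \<nu>. real R < \<bar>u \<bullet> x\<bar>} < 1/2"
  proof -
    have "(\<lambda>R. prob {x \<in> space \<nu>. real R < \<bar>u \<bullet> x\<bar>}) \<longlonglongrightarrow> prob (\<Inter>R. {x \<in> space \<nu>. real R < \<bar>u \<bullet> x\<bar>})"
      by (intro finite_Lim_measure_decseq) (auto simp: decseq_def)
    also have "(\<Inter>R. {x \<in> space \<nu>. real R < \<bar>u \<bullet> x\<bar>}) = {}"
      by auto (meson linorder_not_le real_arch_simple)
    finally have "eventually (\<lambda>R. prob {x \<in> space \<nu>. real R < \<bar>u \<bullet> x\<bar>} < 1/2) sequentially"
      by (rule order_tendstoD(2)) simp
    then show ?thesis using that by (auto simp: eventually_sequentially)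
  qed
  \<comment> \<open>Chebyshev's inequality with proxy \<open>C + 1\<close>, positive even for
    \<open>C = 0\<close>, bounds deviations of size \<open>S\<close> by \<open>1/2\<close>. Together
    with the choice of \<open>R\<close> the two exceptional sets have total probability below
    1.\<close>
  define S where "S = sqrt (2 * (C + 1))"
  have S: "0 < S" "S^2 = 2 * (C + 1)" using C by (auto simp: S_def)
  \<comment> \<open>The linear functional is not yet known to be integrable; concentration of its truncations
    around their means together with tightness keeps these means bounded.\<close>
  have m_bd: "\<bar>m k\<bar> \<le> real R + S" for k
  proof (rule ccontr)
    assume "\<not> ?thesis"
    then have mk: "real R + S < \<bar>m k\<bar>" by simp
    have sg': "subgaussian \<nu> (\<lambda>x. \<psi> k x - m k) (C + 1)"
      by (rule subgaussian_mono[OF sg]) simp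
    have "prob {x \<in> space \<nu>. S^2 \<le> (\<psi> k x - m k)^2} \<le> expectation (\<lambda>x. (\<psi> k x - m k)^2) / S^2"
      using S C by (intro integral_Markov_inequality_measure[where A="{}"] subgaussian_integrable_power2[OF sg']) auto
    also have "\<dots> \<le> (C + 1) / S^2"
      using C by (intro divide_right_mono subgaussian_second_moment[OF sg']) auto
    also have "\<dots> = 1/2" using C unfolding S(2) by (simp add: field_simps)
    finally have "prob ({x \<in> space \<nu>. S^2 \<le> (\<psi> k x - m k)^2} \<union> {x \<in> space \<nu>. real R < \<bar>u \<bullet> x\<bar>}) < 1"
      using R by (intro le_less_trans[OF measure_Un_le]) auto
    moreover have "{x \<in> space \<nu>. S^2 \<le> (\<psi> k x - m k)^2} \<union> {x \<in> space \<nu>. real R < \<bar>u \<bullet> x\<bar>} = space \<nu>"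
    proof safe
      fix x assume x: "x \<in> space \<nu>" "\<not> real R < \<bar>u \<bullet> x\<bar>"
      then have "\<bar>S\<bar> \<le> \<bar>\<psi> k x - m k\<bar>" using mk \<psi>_le[of k x] S by linarith
      then show "S^2 \<le> (\<psi> k x - m k)^2" by (simp add: abs_le_square_iff)
    qed
    ultimately show False by (simp add: prob_space)
  qed
  have mgf_k: "integrable \<nu> (\<lambda>x. exp (l * \<psi> k x))" "(\<integral>x. exp (l * \<psi> k x) \<partial>\<nu>) \<le> exp (l * m k + C * l^2 / 2)" for l k
    using sg[of k] unfolding subgaussian_shift_iff by auto
  have int_exp: "integrable \<nu> (\<lambda>x. exp (l * (u \<bullet> x)))" for l
  proof (rule integrableI_nonneg)
    define K where "K = exp (\<bar>l\<bar> * (real R + S) + C * l^2 / 2)"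
    \<comment> \<open>Fatou's lemma for the truncations, whose moment generating functions are
      bounded uniformly in \<open>k\<close>.\<close>
    have "(\<integral>\<^sup>+x. ennreal (exp (l * (u \<bullet> x))) \<partial>\<nu>) = (\<integral>\<^sup>+x. liminf (\<lambda>k. ennreal (exp (l * \<psi> k x))) \<partial>\<nu>)"
      by (intro nn_integral_cong lim_imp_Liminf[symmetric] tendsto_intros \<psi>_lim) auto
    also have "\<dots> \<le> liminf (\<lambda>k. \<integral>\<^sup>+x. ennreal (exp (l * \<psi> k x)) \<partial>\<nu>)"
      by (rule nn_integral_liminf) measurable
    also have "\<dots> \<le> limsup (\<lambda>k. \<integral>\<^sup>+x. ennreal (exp (l * \<psi> k x)) \<partial>\<nu>)"
      by (rule Liminf_le_Limsup) simp
    also have "\<dots> \<le> ennreal K"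
    proof (rule Limsup_bounded[OF always_eventually], rule allI)
      fix k
      have "(\<integral>\<^sup>+x. ennreal (exp (l * \<psi> k x)) \<partial>\<nu>) = ennreal (\<integral>x. exp (l * \<psi> k x) \<partial>\<nu>)"
        by (intro nn_integral_eq_integral mgf_k) auto
      also have "\<dots> \<le> ennreal (exp (l * m k + C * l^2 / 2))"
        by (intro ennreal_leI mgf_k)
      also have "\<dots> \<le> ennreal K"
      proof -
        have "exp (l * m k) \<le> exp (\<bar>l\<bar> * (real R + S))" by (rule exp_mult_le_of_abs_le[OF m_bd])
        then show ?thesis unfolding K_def by (intro ennreal_leI) simp
      qed
      finally show "(\<integral>\<^sup>+x. ennreal (exp (l * \<psi> k x)) \<partial>\<nu>) \<le> ennreal K" .
    qed
    finally show "(\<integral>\<^sup>+x. ennreal (exp (l * (u \<bullet> x))) \<partial>\<nu>) < \<infinity>"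
      by (rule le_less_trans) simp
  qed auto
  have exp_abs: "exp \<bar>l * t\<bar> \<le> exp (l * t) + exp (- l * t)" for l t :: real
    by (simp add: abs_if)
  show int: "integrable \<nu> (\<lambda>x. u \<bullet> x)"
    by (rule square_integrable_imp_integrable[OF _ exp_integrable_imp_integrable_power2[OF int_exp]]) measurable
  define a where "a = (\<integral>x. u \<bullet> x \<partial>\<nu>)"
  have m_lim: "m \<longlonglongrightarrow> a"
    unfolding m_def[abs_def] a_def
    by (rule integral_dominated_convergence[where w="\<lambda>x. \<bar>u \<bullet> x\<bar>"]) (use int \<psi>_lim \<psi>_le in auto)
  show "subgaussian \<nu> (\<lambda>x. u \<bullet> x - (\<integral>x. u \<bullet> x \<partial>\<nu>)) C"
    unfolding subgaussian_shift_iff a_def[symmetric]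
  proof (intro allI conjI)
    fix l
    show "integrable \<nu> (\<lambda>x. exp (l * (u \<bullet> x)))" by (rule int_exp)
    have "(\<lambda>k. \<integral>x. exp (l * \<psi> k x) \<partial>\<nu>) \<longlonglongrightarrow> (\<integral>x. exp (l * (u \<bullet> x)) \<partial>\<nu>)"
    proof (rule integral_dominated_convergence[where w="\<lambda>x. exp (l * (u \<bullet> x)) + exp (- l * (u \<bullet> x))"])
      show "integrable \<nu> (\<lambda>x. exp (l * (u \<bullet> x)) + exp (- l * (u \<bullet> x)))"
        by (intro Bochner_Integration.integrable_add int_exp)
      show "AE x in \<nu>. (\<lambda>k. exp (l * \<psi> k x)) \<longlonglongrightarrow> exp (l * (u \<bullet> x))"
        by (intro AE_I2 tendsto_intros \<psi>_lim)
      fix k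
      show "AE x in \<nu>. norm (exp (l * \<psi> k x)) \<le> exp (l * (u \<bullet> x)) + exp (- l * (u \<bullet> x))"
      proof (rule AE_I2)
        fix x
        have "l * \<psi> k x \<le> \<bar>l * \<psi> k x\<bar>" by simp
        also have "\<dots> \<le> \<bar>l * (u \<bullet> x)\<bar>" unfolding abs_mult by (intro mult_left_mono \<psi>_le) simp
        finally have "exp (l * \<psi> k x) \<le> exp \<bar>l * (u \<bullet> x)\<bar>" by simp
        also have "\<dots> \<le> exp (l * (u \<bullet> x)) + exp (- l * (u \<bullet> x))" by (rule exp_abs)
        finally show "norm (exp (l * \<psi> k x)) \<le> exp (l * (u \<bullet> x)) + exp (- l * (u \<bullet> x))" by simp
      qed
    qed measurable
    moreover have "(\<lambda>k. exp (l * m k + C * l^2 / 2)) \<longlonglongrightarrow> exp (l * a + C * l^2 / 2)"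
      by (intro tendsto_intros m_lim)
    ultimately show "(\<integral>x. exp (l * (u \<bullet> x)) \<partial>\<nu>) \<le> exp (l * a + C * l^2 / 2)"
      using mgf_k by (intro LIMSEQ_le) auto
  qed
qed

section \<open>Nets and symmetric matrices\<close>

text \<open>Volume comparison: disjoint balls of radius \<open>1/8\<close> around the points fit
  into a ball of radius \<open>9/8\<close>, and the ratio of the radii is 9.\<close>

lemma card_separated_sphere_le:
  fixes T :: "(real^'d) set"
  assumes T: "finite T" "T \<subseteq> sphere 0 1" and sep: "\<And>x y. x \<in> T \<Longrightarrow> y \<in> T \<Longrightarrow> x \<noteq> y \<Longrightarrow> 1/4 < dist x y"
  shows "card T \<le> 9 ^ CARD('d)"
proof -
  let ?d = "DIM(real^'d)"
  have fin: "ball x r \<in> lmeasurable" for x :: "real^'d" and r by simp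
  have disj: "disjoint_family_on (\<lambda>x. ball x (1/8)) T"
    unfolding disjoint_family_on_def
  proof safe
    fix x y z assume "x \<in> T" "y \<in> T" "x \<noteq> y" "z \<in> ball x (1/8)" "z \<in> ball y (1/8)"
    then have "1/4 < dist x y" "dist x y < 1/8 + 1/8"
      using sep dist_triangle_less_add[of x z "1/8" y "1/8"] by (auto simp: dist_commute)
    then show "z \<in> {}" by simp
  qed
  have "(\<Sum>x\<in>T. measure lebesgue (ball x (1/8))) = measure lebesgue (\<Union>x\<in>T. ball x (1/8))"
    using T disj fin by (intro measure_finite_Union[symmetric]) (auto simp: fmeasurable_def less_top[symmetric])
  also have "\<dots> \<le> measure lebesgue (ball (0 :: real^'d) (9/8))"
  proof (rule measure_mono_fmeasurable)
    show "(\<Union>x\<in>T. ball x (1/8)) \<subseteq> ball 0 (9/8)"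
    proof safe
      fix x z assume "x \<in> T" "z \<in> ball x (1/8)"
      then have "dist 0 x = 1" "dist x z < 1/8" using T by auto
      then show "z \<in> ball 0 (9/8)" using dist_triangle[of 0 z x] by simp
    qed
    show "(\<Union>x\<in>T. ball x (1/8)) \<in> sets lebesgue" using T fin by (intro sets.finite_UN) auto
  qed (rule fin)
  finally have "real (card T) * (unit_ball_vol ?d * (1/8) ^ ?d) \<le> unit_ball_vol ?d * (9/8) ^ ?d"
    by (simp add: content_ball)
  then have "unit_ball_vol ?d * (real (card T) * (1/8) ^ ?d) \<le> unit_ball_vol ?d * (9/8) ^ ?d"
    by (simp add: ac_simps)
  then have "real (card T) * (1/8) ^ ?d \<le> (9/8) ^ ?d"
    by (subst (asm) mult_le_cancel_left_pos) (auto intro: unit_ball_vol_pos)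
  then have "real (card T) \<le> real (9 ^ ?d)"
    by (simp add: power_divide divide_le_cancel)
  then show ?thesis by (simp only: of_nat_le_iff) simp
qed

text \<open>A separated set of largest cardinality is a net, since a uncovered point could be added
  to it; the cardinality bound makes a largest one exist.\<close>

lemma sphere_net_exists:
  "\<exists>S :: (real^'d) set. finite S \<and> S \<subseteq> sphere 0 1 \<and> card S \<le> 9 ^ CARD('d) \<and>
    (\<forall>x. norm x = 1 \<longrightarrow> (\<exists>u\<in>S. norm (x - u) \<le> 1/4))"
proof -
  define P where "P T \<longleftrightarrow> finite T \<and> T \<subseteq> sphere 0 1 \<and> (\<forall>x\<in>T. \<forall>y\<in>T. x \<noteq> y \<longrightarrow> 1/4 < dist x y)" for T :: "(real^'d) set"
  have "P {}" by (simp add: P_def)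
  moreover have "card T \<le> 9 ^ CARD('d)" if "P T" for T
    using that by (intro card_separated_sphere_le) (auto simp: P_def)
  ultimately have "\<exists>S. P S \<and> (\<forall>T. P T \<longrightarrow> card T \<le> card S)"
    by (intro ex_has_greatest_nat[of P "{}" card "Suc (9 ^ CARD('d))"]) (auto simp: less_Suc_eq_le)
  then obtain S where S: "P S" "\<And>T. P T \<Longrightarrow> card T \<le> card S" by auto
  have "\<exists>u\<in>S. norm (x - u) \<le> 1/4" if x: "norm x = 1" for x
  proof (rule ccontr)
    assume far: "\<not> ?thesis"
    then have "x \<notin> S" by force
    have "P (insert x S)"
      using S(1) far x unfolding P_def by (auto simp: dist_norm norm_minus_commute not_le)
    from S(2)[OF this] show False using S(1) \<open>x \<notin> S\<close> by (simp add: P_def)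
  qed
  moreover have "card S \<le> 9 ^ CARD('d)" using S(1) by (intro card_separated_sphere_le) (auto simp: P_def)
  ultimately show ?thesis using S(1) by (intro exI[of _ S]) (auto simp: P_def)
qed

text \<open>Let \<open>q\<close> be the maximum of the absolute quadratic form on the sphere, which
  bounds the operator norm by polarization. Moving from a maximizer to the nearest net point loses
  at most \<open>q / 2\<close>, so the net sees at least half of \<open>q\<close>.\<close>

lemma symmetric_matrix_net_bound:
  fixes A :: "real^'d^'d" and S :: "(real^'d) set"
  assumes sym: "transpose A = A"
    and net: "S \<subseteq> sphere 0 1" "\<And>x. norm x = 1 \<Longrightarrow> \<exists>u\<in>S. norm (x - u) \<le> 1/4"
    and K: "\<And>u. u \<in> S \<Longrightarrow> \<bar>u \<bullet> (A *v u)\<bar> \<le> K"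
  shows "onorm (\<lambda>v. A *v v) \<le> 2 * K"
proof -
  have swap: "x \<bullet> (A *v y) = y \<bullet> (A *v x)" for x y
    using dot_lmul_matrix[of x A y] sym by (simp add: inner_commute transpose_matrix_vector[symmetric])
  define Q where "Q x = x \<bullet> (A *v x)" for x
  have "continuous_on (sphere 0 1) (\<lambda>x. \<bar>Q x\<bar>)"
    unfolding Q_def by (intro continuous_intros matrix_vector_mult_linear_continuous_on)
  moreover have "sphere (0 :: real^'d) 1 \<noteq> {}"
    by (auto intro!: exI[of _ "axis undefined 1"])
  ultimately obtain x0 where x0: "norm x0 = 1" "\<And>x. norm x = 1 \<Longrightarrow> \<bar>Q x\<bar> \<le> \<bar>Q x0\<bar>"
    using continuous_attains_sup[OF compact_sphere] by (metis mem_sphere_0)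
  define q where "q = \<bar>Q x0\<bar>"
  have Q_le: "\<bar>Q z\<bar> \<le> q * (norm z)^2" for z
  proof (cases "z = 0")
    case False
    have "Q z = (norm z)^2 * Q (z /\<^sub>R norm z)"
      using False by (simp add: Q_def matrix_vector_mult_scaleR power2_eq_square field_simps)
    moreover have "\<bar>Q (z /\<^sub>R norm z)\<bar> \<le> q" unfolding q_def by (rule x0(2)) (use False in simp)
    ultimately show ?thesis by (simp add: abs_mult mult.commute[of q] mult_left_mono)
  qed (simp add: Q_def)
  have bil1: "\<bar>x \<bullet> (A *v y)\<bar> \<le> q" if "norm x = 1" "norm y = 1" for x y
  proof -
    \<comment> \<open>Polarization followed by the parallelogram law, which makes the two squared
      norms add up to 4.\<close>
    have "4 * (x \<bullet> (A *v y)) = Q (x + y) - Q (x - y)"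
      using swap[of x y] by (simp add: Q_def algebra_simps matrix_vector_right_distrib matrix_vector_mult_diff_distrib inner_add_left inner_diff_left)
    then have "4 * \<bar>x \<bullet> (A *v y)\<bar> \<le> \<bar>Q (x + y)\<bar> + \<bar>Q (x - y)\<bar>" by linarith
    also have "\<dots> \<le> q * ((norm (x + y))^2 + (norm (x - y))^2)"
      using Q_le[of "x + y"] Q_le[of "x - y"] by (simp add: distrib_left)
    also have "(norm (x + y))^2 + (norm (x - y))^2 = 4"
      using that by (simp add: power2_norm_eq_inner inner_add_left inner_add_right inner_diff_left inner_diff_right inner_commute norm_eq_1)
    finally show ?thesis by simp
  qed
  have bil: "\<bar>x \<bullet> (A *v y)\<bar> \<le> q * norm x * norm y" for x y
  proof (cases "x = 0 \<or> y = 0")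
    case False
    have "x \<bullet> (A *v y) = (norm x * norm y) * ((x /\<^sub>R norm x) \<bullet> (A *v (y /\<^sub>R norm y)))"
      using False by (simp add: matrix_vector_mult_scaleR field_simps)
    moreover have "\<bar>(x /\<^sub>R norm x) \<bullet> (A *v (y /\<^sub>R norm y))\<bar> \<le> q"
      by (rule bil1) (use False in simp_all)
    ultimately have "\<bar>x \<bullet> (A *v y)\<bar> \<le> (norm x * norm y) * q"
      by (simp only: abs_mult) (simp add: mult_left_mono)
    then show ?thesis by (simp add: ac_simps)
  qed auto
  obtain u where u: "u \<in> S" "norm (x0 - u) \<le> 1/4" using net(2)[OF x0(1)] by blast
  have nu: "norm u = 1" using u net(1) by auto
  have q0: "0 \<le> q" by (simp add: q_def)
  \<comment> \<open>Symmetry factors the difference like a difference of squares; the factors have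
    norms at most \<open>1/4\<close> and 2.\<close>
  have "Q x0 - Q u = (x0 - u) \<bullet> (A *v (x0 + u))"
    using swap[of x0 u] by (simp add: Q_def matrix_vector_right_distrib inner_add_right inner_diff_left)
  then have "\<bar>Q x0 - Q u\<bar> \<le> q * norm (x0 - u) * norm (x0 + u)"
    using bil by simp
  also have "\<dots> \<le> q * (1/4) * 2"
    using norm_triangle_ineq[of x0 u] x0(1) nu u q0 by (intro mult_mono mult_left_mono) auto
  finally have "q \<le> 2 * K" using K[OF u(1)] unfolding q_def Q_def[symmetric] by linarith
  moreover have "onorm (\<lambda>v. A *v v) \<le> q"
  proof (rule onorm_le)
    fix v
    show "norm (A *v v) \<le> q * norm v"
    proof (cases "A *v v = 0")
      case False
      have "norm (A *v v) * norm (A *v v) = \<bar>(A *v v) \<bullet> (A *v v)\<bar>"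
        by (simp add: dot_square_norm power2_eq_square)
      also have "\<dots> \<le> q * norm (A *v v) * norm v" by (rule bil)
      finally have "norm (A *v v) * norm (A *v v) \<le> (q * norm v) * norm (A *v v)"
        by (simp only: ac_simps)
      then show ?thesis by (rule mult_right_le_imp_le) (use False in simp)
    qed (use q0 in simp)
  qed
  ultimately show ?thesis by simp
qed

text \<open>In its own direction \<open>y\<close> is seen by a net point up to an error of
  \<open>1/4\<close> of its norm, whence the factor \<open>1 / (1 - 1/4)\<close>.\<close>

lemma norm_le_net:
  fixes S :: "(real^'d) set"
  assumes net: "S \<subseteq> sphere 0 1" "\<And>x. norm x = 1 \<Longrightarrow> \<exists>u\<in>S. norm (x - u) \<le> 1/4"
    and K: "\<And>u. u \<in> S \<Longrightarrow> u \<bullet> y \<le> K" and "0 \<le> K"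
  shows "norm y \<le> 4/3 * K"
proof (cases "y = 0")
  case False
  define x where "x = y /\<^sub>R norm y"
  have x: "norm x = 1" "x \<bullet> y = norm y"
    using False by (auto simp: x_def power2_norm_eq_inner[symmetric] power2_eq_square)
  obtain u where u: "u \<in> S" "norm (x - u) \<le> 1/4" using net(2)[OF x(1)] by blast
  have "norm y = (x - u) \<bullet> y + u \<bullet> y" using x by (simp add: inner_diff_left)
  also have "(x - u) \<bullet> y \<le> norm (x - u) * norm y" by (rule norm_cauchy_schwarz)
  also have "\<dots> \<le> 1/4 * norm y" using u by (intro mult_right_mono) auto
  finally show ?thesis using K[OF u(1)] by simp
qed (use assms in simp)

text \<open>Makes the deviation event of the theorem measurable; the operator norm condition is an
  intersection of closed conditions, one per vector.\<close>

lemma closed_onorm_le: "closed {A :: real^'d^'d. onorm (\<lambda>v. A *v v) \<le> c}"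
proof (cases "0 \<le> c")
  case True
  have "onorm (\<lambda>v. A *v v) \<le> c \<longleftrightarrow> (\<forall>v. norm (A *v v) \<le> c * norm v)" for A :: "real^'d^'d"
  proof
    assume "onorm (\<lambda>v. A *v v) \<le> c"
    then show "\<forall>v. norm (A *v v) \<le> c * norm v"
      using onorm[OF matrix_vector_mul_bounded_linear, of A]
      by (meson mult_right_mono norm_ge_zero order_trans)
  qed (auto intro: onorm_le)
  then have "{A :: real^'d^'d. onorm (\<lambda>v. A *v v) \<le> c} = (\<Inter>v. {A. norm (A *v v) \<le> c * norm v})"
    by auto
  moreover have "closed {A :: real^'d^'d. norm (A *v v) \<le> c * norm v}" for v
    unfolding matrix_vector_mult_def by (intro closed_Collect_le continuous_intros)
  ultimately show ?thesis by auto
next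
  case False
  then have "{A :: real^'d^'d. onorm (\<lambda>v. A *v v) \<le> c} = {}"
    using onorm_pos_le[OF matrix_vector_mul_bounded_linear] by (auto dest: order_trans)
  then show ?thesis by simp
qed

section \<open>Contraction of the gradient step\<close>

text \<open>The Baillon--Haddad argument: sandwiching \<open>\<psi>\<close> between the affine
  minorant at one point and the quadratic majorant at the other gives cocoercivity of
  \<open>T\<close>, and Cauchy--Schwarz turns this into the Lipschitz bound.\<close>

lemma lipschitz_gradient_of_smooth_convex:
  fixes \<psi> :: "'a::real_inner \<Rightarrow> real"
  assumes L: "0 < L"
    and lower: "\<And>x y. \<psi> x + T x \<bullet> (y - x) \<le> \<psi> y"
    and upper: "\<And>x y. \<psi> y \<le> \<psi> x + T x \<bullet> (y - x) + L / 2 * (norm (y - x))^2"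
  shows "norm (T x - T y) \<le> L * norm (x - y)"
proof -
  have half: "\<psi> x + T x \<bullet> (y - x) + (norm (T y - T x))^2 / (2 * L) \<le> \<psi> y" for x y
  proof -
    define g where "g = T y - T x"
    \<comment> \<open>The minimizer over \<open>z\<close> of the majorant at \<open>y\<close> minus
      the minorant at \<open>x\<close>.\<close>
    define z where "z = y - (1 / L) *\<^sub>R g"
    have "\<psi> x + T x \<bullet> (z - x) \<le> \<psi> y + T y \<bullet> (z - y) + L / 2 * (norm (z - y))^2"
      using lower[of x z] upper[of z y] by linarith
    moreover have "T x \<bullet> (z - x) = T x \<bullet> (y - x) - (T x \<bullet> g) / L"
      by (simp add: z_def inner_diff_right)
    moreover have "T y \<bullet> (z - y) = - (T x \<bullet> g) / L - (norm g)^2 / L"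
      unfolding power2_norm_eq_inner by (simp add: z_def g_def inner_diff_left add_divide_distrib diff_divide_distrib)
    moreover have "L / 2 * (norm (z - y))^2 = (norm g)^2 / (2 * L)"
      using L by (simp add: z_def power_mult_distrib power_divide power2_eq_square)
    moreover have "(norm g)^2 / L = (norm g)^2 / (2 * L) + (norm g)^2 / (2 * L)"
      using L by (simp add: field_simps)
    ultimately show ?thesis unfolding g_def[symmetric] by linarith
  qed
  have "(norm (T y - T x))^2 / (2 * L) + (norm (T x - T y))^2 / (2 * L) \<le> (T x - T y) \<bullet> (x - y)"
    using half[of x y] half[of y x] by (simp add: inner_diff_left inner_diff_right)
  moreover have "(norm (T y - T x))^2 / (2 * L) + (norm (T x - T y))^2 / (2 * L) = (norm (T x - T y))^2 / L"
    using L by (simp add: norm_minus_commute field_simps)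
  ultimately have "(norm (T x - T y))^2 / L \<le> norm (T x - T y) * norm (x - y)"
    using norm_cauchy_schwarz[of "T x - T y" "x - y"] by linarith
  then have "norm (T x - T y) * norm (T x - T y) \<le> (L * norm (x - y)) * norm (T x - T y)"
    using L by (simp add: divide_le_eq power2_eq_square ac_simps)
  then show ?thesis using L by (cases "T x = T y") (auto dest: mult_right_le_imp_le)
qed

lemma hessian_bounds_second_order:
  fixes f :: "real^'d \<Rightarrow> real"
  assumes grad_f: "\<And>x. (f has_derivative (\<lambda>h. gradf x \<bullet> h)) (at x)"
    and hess_f: "\<And>x. (gradf has_derivative (\<lambda>h. H x *v h)) (at x)"
    and hess_bounds: "\<And>x h. \<alpha> * (norm h)^2 \<le> h \<bullet> (H x *v h) \<and> h \<bullet> (H x *v h) \<le> \<beta> * (norm h)^2"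
  shows "\<alpha> / 2 * (norm (y - x))^2 \<le> f y - f x - gradf x \<bullet> (y - x)"
    and "f y - f x - gradf x \<bullet> (y - x) \<le> \<beta> / 2 * (norm (y - x))^2"
proof -
  define h where "h = y - x"
  \<comment> \<open>The restriction to the segment and its first two derivatives, indexed by order
    for the Lagrange form of the Taylor formula.\<close>
  define D where "D k t = (if k = 0 then f (x + t *\<^sub>R h) else if k = 1 then gradf (x + t *\<^sub>R h) \<bullet> h
     else h \<bullet> (H (x + t *\<^sub>R h) *v h))" for k :: nat and t :: real
  have line: "((\<lambda>t. x + t *\<^sub>R h) has_derivative (\<lambda>s. s *\<^sub>R h)) (at t)" for t
    by (auto intro!: derivative_eq_intros)
  have d0: "((\<lambda>t. f (x + t *\<^sub>R h)) has_real_derivative gradf (x + t *\<^sub>R h) \<bullet> h) (at t)" for t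
  proof -
    have "(f \<circ> (\<lambda>t. x + t *\<^sub>R h) has_derivative (\<lambda>h'. gradf (x + t *\<^sub>R h) \<bullet> h') \<circ> (\<lambda>s. s *\<^sub>R h)) (at t)"
      by (intro diff_chain_at line grad_f)
    then show ?thesis by (simp add: o_def has_field_derivative_def mult_commute_abs)
  qed
  have d1: "((\<lambda>t. gradf (x + t *\<^sub>R h) \<bullet> h) has_real_derivative h \<bullet> (H (x + t *\<^sub>R h) *v h)) (at t)" for t
  proof -
    have "(gradf \<circ> (\<lambda>t. x + t *\<^sub>R h) has_derivative (\<lambda>h'. H (x + t *\<^sub>R h) *v h') \<circ> (\<lambda>s. s *\<^sub>R h)) (at t)"
      by (intro diff_chain_at line hess_f)
    then have "((\<lambda>t. gradf (x + t *\<^sub>R h) \<bullet> h) has_derivative (\<lambda>s. (H (x + t *\<^sub>R h) *v (s *\<^sub>R h)) \<bullet> h)) (at t)"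
      by (intro has_derivative_inner_left) (simp add: o_def)
    then show ?thesis
      by (simp add: has_field_derivative_def matrix_vector_mult_scaleR inner_commute mult_commute_abs)
  qed
  have "\<exists>t>0. t < 1 \<and> f (x + 1 *\<^sub>R h) = (\<Sum>m<2. D m 0 / fact m * 1 ^ m) + D 2 t / fact 2 * 1 ^ 2"
    by (rule Maclaurin) (auto simp: D_def less_2_cases_iff intro: d0 d1)
  then obtain t where "f (x + 1 *\<^sub>R h) = (\<Sum>m<2. D m 0 / fact m * 1 ^ m) + D 2 t / fact 2 * 1 ^ 2"
    by blast
  then have "f y - f x - gradf x \<bullet> (y - x) = h \<bullet> (H (x + t *\<^sub>R h) *v h) / 2"
    by (simp add: D_def h_def numeral_2_eq_2)
  then show "\<alpha> / 2 * (norm (y - x))^2 \<le> f y - f x - gradf x \<bullet> (y - x)"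
    "f y - f x - gradf x \<bullet> (y - x) \<le> \<beta> / 2 * (norm (y - x))^2"
    using hess_bounds[of h "x + t *\<^sub>R h"] by (auto simp: h_def)
qed

text \<open>The step is the gradient of \<open>(norm x)^2 / 2 - \<eta> * f x\<close>. This function
  is convex because \<open>\<eta> * \<beta> \<le> 1\<close>, and its curvature is at most
  \<open>1 - \<alpha> * \<eta>\<close>, so the preceding Lipschitz bound applies.\<close>

lemma gradient_step_contraction:
  fixes f :: "real^'d \<Rightarrow> real"
  assumes grad_f: "\<And>x. (f has_derivative (\<lambda>h. gradf x \<bullet> h)) (at x)"
    and hess_f: "\<And>x. (gradf has_derivative (\<lambda>h. H x *v h)) (at x)"
    and hess_bounds: "\<And>x h. \<alpha> * (norm h)^2 \<le> h \<bullet> (H x *v h) \<and> h \<bullet> (H x *v h) \<le> \<beta> * (norm h)^2"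
    and \<eta>: "0 < \<eta>" "\<eta> * \<beta> \<le> 1" "\<eta> * \<alpha> < 1"
  shows "norm ((x - \<eta> *\<^sub>R gradf x) - (y - \<eta> *\<^sub>R gradf y)) \<le> (1 - \<alpha> * \<eta>) * norm (x - y)"
proof (rule lipschitz_gradient_of_smooth_convex[where \<psi> = "\<lambda>x. (norm x)^2 / 2 - \<eta> * f x"])
  have id: "((norm y)^2 / 2 - \<eta> * f y) - ((norm x)^2 / 2 - \<eta> * f x) - (x - \<eta> *\<^sub>R gradf x) \<bullet> (y - x)
     = (norm (y - x))^2 / 2 - \<eta> * (f y - f x - gradf x \<bullet> (y - x))" for x y
    by (simp add: power2_norm_eq_inner inner_diff_left inner_diff_right inner_commute algebra_simps add_divide_distrib diff_divide_distrib)
  fix x y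
  have "\<eta> * (f y - f x - gradf x \<bullet> (y - x)) \<le> \<eta> * (\<beta> / 2 * (norm (y - x))^2)"
    by (intro mult_left_mono hessian_bounds_second_order[OF grad_f hess_f hess_bounds]) (use \<eta> in simp)
  also have "\<dots> = (\<eta> * \<beta>) * ((norm (y - x))^2 / 2)" by simp
  also have "\<dots> \<le> 1 * ((norm (y - x))^2 / 2)" using \<eta> by (intro mult_right_mono) auto
  finally show "(norm x)^2 / 2 - \<eta> * f x + (x - \<eta> *\<^sub>R gradf x) \<bullet> (y - x) \<le> (norm y)^2 / 2 - \<eta> * f y"
    using id[of y x] by simp
  have "\<eta> * (\<alpha> / 2 * (norm (y - x))^2) \<le> \<eta> * (f y - f x - gradf x \<bullet> (y - x))"
    by (intro mult_left_mono hessian_bounds_second_order[OF grad_f hess_f hess_bounds]) (use \<eta> in simp)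
  then have "(norm (y - x))^2 / 2 - \<eta> * (f y - f x - gradf x \<bullet> (y - x)) \<le> (1 - \<alpha> * \<eta>) / 2 * (norm (y - x))^2"
    by (simp add: algebra_simps)
  then show "(norm y)^2 / 2 - \<eta> * f y \<le> (norm x)^2 / 2 - \<eta> * f x + (x - \<eta> *\<^sub>R gradf x) \<bullet> (y - x)
     + (1 - \<alpha> * \<eta>) / 2 * (norm (y - x))^2"
    using id[of y x] by linarith
qed (use \<eta> in \<open>simp add: mult.commute\<close>)

section \<open>Contractive recursions as functions of the starting point and the noise path\<close>

primrec chain :: "('v::real_vector \<Rightarrow> 'v) \<Rightarrow> real \<Rightarrow> 'v \<Rightarrow> (nat \<Rightarrow> 'v) \<Rightarrow> nat \<Rightarrow> 'v" where
  "chain T s x z 0 = x"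
| "chain T s x z (Suc i) = T (chain T s x z i) + s *\<^sub>R z (Suc i)"

lemma ula_eq_chain:
  "ula gf \<eta> X0 Z i w = chain (\<lambda>x. x - \<eta> *\<^sub>R gf x) (sqrt (2 * \<eta>)) (X0 w) (\<lambda>i. Z i w) i"
  by (induction i) auto

lemma chain_cong:
  assumes "\<And>k. 1 \<le> k \<Longrightarrow> k \<le> i \<Longrightarrow> z k = z' k"
  shows "chain T s x z i = chain T s x z' i"
  using assms by (induction i) auto

lemma chain_add: "chain T s x z (k + i) = chain T s (chain T s x z k) (\<lambda>j. z (j + k)) i"
  by (induction i) (auto simp: add.commute)

text \<open>Convexity of the square with weights \<open>\<rho>\<close> and \<open>1 - \<rho>\<close>
  at the points \<open>a\<close> and \<open>b / (1 - \<rho>)\<close>.\<close>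

lemma convex_square_bound:
  fixes a b \<rho> :: real
  assumes "0 \<le> \<rho>" "\<rho> < 1"
  shows "(\<rho> * a + b)^2 \<le> \<rho> * a^2 + b^2 / (1 - \<rho>)"
proof -
  have "\<rho> * a^2 + b^2 / (1 - \<rho>) - (\<rho> * a + b)^2 = \<rho> / (1 - \<rho>) * ((1 - \<rho>) * a - b)^2"
    using assms by (simp add: divide_simps) (simp add: power2_eq_square algebra_simps)
  moreover have "0 \<le> \<rho> / (1 - \<rho>) * ((1 - \<rho>) * a - b)^2" using assms by simp
  ultimately show ?thesis by linarith
qed

locale contraction =
  fixes T :: "real^'d \<Rightarrow> real^'d" and \<rho> s :: real
  assumes rho: "0 < \<rho>" "\<rho> < 1" and s_nonneg: "0 \<le> s"
    and contr: "norm (T x - T y) \<le> \<rho> * norm (x - y)"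
begin

lemma chain_diff_init: "norm (chain T s x z i - chain T s x' z i) \<le> \<rho> ^ i * norm (x - x')"
proof (induction i)
  case (Suc i)
  have "norm (chain T s x z (Suc i) - chain T s x' z (Suc i)) \<le> \<rho> * norm (chain T s x z i - chain T s x' z i)"
    using contr by simp
  also have "\<dots> \<le> \<rho> * (\<rho> ^ i * norm (x - x'))" using Suc rho by (intro mult_left_mono) auto
  finally show ?case by simp
qed simp

lemma chain_diff_step:
  "(norm (chain T s x z (Suc i) - chain T s x z' (Suc i)))^2
     \<le> \<rho> * (norm (chain T s x z i - chain T s x z' i))^2 + s^2 / (1 - \<rho>) * (norm (z (Suc i) - z' (Suc i)))^2"
proof -
  let ?D = "chain T s x z i - chain T s x z' i"
  have "chain T s x z (Suc i) - chain T s x z' (Suc i)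
    = (T (chain T s x z i) - T (chain T s x z' i)) + s *\<^sub>R (z (Suc i) - z' (Suc i))"
    by (simp add: algebra_simps)
  then have "norm (chain T s x z (Suc i) - chain T s x z' (Suc i))
    \<le> norm (T (chain T s x z i) - T (chain T s x z' i)) + norm (s *\<^sub>R (z (Suc i) - z' (Suc i)))"
    using norm_triangle_ineq by metis
  also have "\<dots> \<le> \<rho> * norm ?D + s * norm (z (Suc i) - z' (Suc i))"
    using contr s_nonneg by (intro add_mono) auto
  finally have "(norm (chain T s x z (Suc i) - chain T s x z' (Suc i)))^2 \<le> (\<rho> * norm ?D + s * norm (z (Suc i) - z' (Suc i)))^2"
    by (intro power_mono) auto
  also have "\<dots> \<le> \<rho> * (norm ?D)^2 + (s * norm (z (Suc i) - z' (Suc i)))^2 / (1 - \<rho>)"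
    using rho by (intro convex_square_bound) auto
  finally show ?thesis by (simp add: power_mult_distrib)
qed

lemma chain_diff_sq:
  "(norm (chain T s x z i - chain T s x z' i))^2 \<le> s^2 / (1 - \<rho>) * (\<Sum>k\<in>{1..i}. (norm (z k - z' k))^2)"
proof (induction i)
  case (Suc i)
  have "\<rho> * (norm (chain T s x z i - chain T s x z' i))^2 \<le> 1 * (norm (chain T s x z i - chain T s x z' i))^2"
    using rho by (intro mult_right_mono) auto
  then show ?case using chain_diff_step[of x z i z'] Suc by (simp add: distrib_left)
qed simp

text \<open>Source of the dimension-free Lipschitz constant. Summing the one-step bound over time
  costs one more factor \<open>1 / (1 - \<rho>)\<close> and nothing that grows with
  \<open>N\<close>.\<close>

lemma chain_diff_sum_sq:
  "(\<Sum>i\<in>{1..N}. (norm (chain T s x z i - chain T s x z' i))^2)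
     \<le> s^2 / (1 - \<rho>)^2 * (\<Sum>k\<in>{1..N}. (norm (z k - z' k))^2)"
proof -
  let ?D = "\<lambda>i. (norm (chain T s x z i - chain T s x z' i))^2"
  \<comment> \<open>The boundary term \<open>\<rho> * ?D N\<close> is what the next step consumes,
    so the induction telescopes.\<close>
  have "(1 - \<rho>) * (\<Sum>i\<in>{1..N}. ?D i) + \<rho> * ?D N \<le> s^2 / (1 - \<rho>) * (\<Sum>k\<in>{1..N}. (norm (z k - z' k))^2)"
  proof (induction N)
    case (Suc N)
    then show ?case using chain_diff_step[of x z N z'] by (simp add: distrib_left left_diff_distrib)
  qed simp
  moreover have "0 \<le> \<rho> * ?D N" using rho by simp
  ultimately have "(1 - \<rho>) * (\<Sum>i\<in>{1..N}. ?D i) \<le> s^2 / (1 - \<rho>) * (\<Sum>k\<in>{1..N}. (norm (z k - z' k))^2)"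
    by linarith
  then have "(\<Sum>i\<in>{1..N}. ?D i) \<le> s^2 / (1 - \<rho>) * (\<Sum>k\<in>{1..N}. (norm (z k - z' k))^2) / (1 - \<rho>)"
    using rho by (simp only: pos_le_divide_eq diff_gt_0_iff_gt mult.commute)
  then show ?thesis by (simp add: power2_eq_square)
qed

end

section \<open>The empirical standard deviation as a Euclidean seminorm\<close>

definition spread :: "(nat \<Rightarrow> real) \<Rightarrow> nat set \<Rightarrow> real" where
  "spread y I = L2_set (\<lambda>i. y i - (\<Sum>j\<in>I. y j) / real (card I)) I"

lemma spread_nonneg: "0 \<le> spread y I"
  by (simp add: spread_def L2_set_nonneg)

lemma spread_sq:
  assumes "finite I" "I \<noteq> {}"
  shows "(spread y I)^2 = (\<Sum>i\<in>I. (y i)^2) - (\<Sum>i\<in>I. y i)^2 / real (card I)"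
proof -
  define c where "c = (\<Sum>j\<in>I. y j) / real (card I)"
  have n: "real (card I) \<noteq> 0" using assms by simp
  have sum: "(\<Sum>i\<in>I. y i) = c * real (card I)" using n by (simp add: c_def)
  have "(spread y I)^2 = (\<Sum>i\<in>I. (y i - c)^2)"
    by (simp add: spread_def L2_set_def c_def sum_nonneg)
  also have "\<dots> = (\<Sum>i\<in>I. (y i)^2 - 2 * c * y i + c^2)"
    by (intro sum.cong) (auto simp: power2_diff)
  also have "\<dots> = (\<Sum>i\<in>I. (y i)^2) - 2 * c * (c * real (card I)) + real (card I) * c^2"
    unfolding sum[symmetric] by (simp add: sum.distrib sum_subtractf sum_distrib_left)
  also have "\<dots> = (\<Sum>i\<in>I. (y i)^2) - (\<Sum>i\<in>I. y i)^2 / real (card I)"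
    unfolding sum using n by (simp add: power2_eq_square)
  finally show ?thesis .
qed

text \<open>The mean minimizes the sum of squared distances; the freedom in \<open>c\<close> permits
  one centre common to all times.\<close>

lemma spread_sq_le:
  assumes "finite I" "I \<noteq> {}"
  shows "(spread y I)^2 \<le> (\<Sum>i\<in>I. (y i - c)^2)"
proof -
  have eq: "spread y I = spread (\<lambda>i. y i - c) I"
    using assms by (simp add: spread_def sum_subtractf diff_divide_distrib)
  have "0 \<le> (\<Sum>i\<in>I. y i - c)^2 / real (card I)" by simp
  then show ?thesis unfolding eq spread_sq[OF assms] by linarith
qed

text \<open>\<open>spread\<close> is the Euclidean norm after the orthogonal projection that
  subtracts the mean, hence a seminorm dominated by the norm.\<close>

lemma spread_lipschitz:
  assumes "finite I" "I \<noteq> {}"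
  shows "\<bar>spread y I - spread y' I\<bar> \<le> L2_set (\<lambda>i. y i - y' i) I"
proof -
  have *: "spread y I \<le> spread y' I + L2_set (\<lambda>i. y i - y' i) I" for y y'
  proof -
    have "spread y I \<le> spread y' I + spread (\<lambda>i. y i - y' i) I"
    proof -
      have "spread y I = L2_set (\<lambda>i. (y' i - (\<Sum>j\<in>I. y' j) / real (card I)) + ((y i - y' i) - (\<Sum>j\<in>I. y j - y' j) / real (card I))) I"
        unfolding spread_def by (intro L2_set_cong) (auto simp: sum_subtractf diff_divide_distrib)
      also have "\<dots> \<le> spread y' I + spread (\<lambda>i. y i - y' i) I"
        unfolding spread_def by (rule L2_set_triangle_ineq)
      finally show ?thesis .
    qed
    moreover have "spread (\<lambda>i. y i - y' i) I \<le> L2_set (\<lambda>i. y i - y' i) I"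
    proof (rule power2_le_imp_le)
      show "(spread (\<lambda>i. y i - y' i) I)^2 \<le> (L2_set (\<lambda>i. y i - y' i) I)^2"
        using spread_sq_le[OF assms, of "\<lambda>i. y i - y' i" 0] by (simp add: L2_set_def sum_nonneg)
    qed (rule L2_set_nonneg)
    ultimately show ?thesis by linarith
  qed
  have "L2_set (\<lambda>i. y' i - y i) I = L2_set (\<lambda>i. y i - y' i) I"
    by (simp add: L2_set_def power2_commute)
  then show ?thesis using *[of y y'] *[of y' y] by linarith
qed

lemma inner_sum_matrix_vector_mult:
  fixes A :: "'i \<Rightarrow> real^'d^'d"
  shows "u \<bullet> ((\<Sum>i\<in>I. A i) *v u) = (\<Sum>i\<in>I. u \<bullet> (A i *v u))"
  by (induction I rule: infinite_finite_induct) (auto simp: matrix_vector_mult_add_rdistrib inner_add_right)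

lemma inner_outer_mult: "u \<bullet> (outer x x *v u) = (u \<bullet> x)^2"
proof -
  have "outer x x *v u = (u \<bullet> x) *\<^sub>R x"
    by (simp add: vec_eq_iff outer_def matrix_vector_mult_def inner_vec_def sum_distrib_right sum_distrib_left ac_simps)
  then show ?thesis by (simp add: power2_eq_square)
qed

lemma inner_sample_cov:
  assumes "1 \<le> n"
  shows "u \<bullet> (sample_cov X m n *v u) = (spread (\<lambda>i. u \<bullet> X i) {m+1..m+n} / sqrt (real n))^2"
proof -
  let ?I = "{m+1..m+n}"
  have I: "?I \<noteq> {}" "card ?I = n" using assms by auto
  have "u \<bullet> (sample_cov X m n *v u) = (1 / real n) * (\<Sum>i\<in>?I. (u \<bullet> X i)^2) - (u \<bullet> ((1 / real n) *\<^sub>R (\<Sum>i\<in>?I. X i)))^2"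
    unfolding sample_cov_def Let_def
    by (simp only: matrix_vector_mult_diff_rdistrib inner_diff_right inner_outer_mult scaleR_matrix_vector_assoc[symmetric]
          inner_scaleR_right inner_sum_matrix_vector_mult)
  also have "u \<bullet> ((1 / real n) *\<^sub>R (\<Sum>i\<in>?I. X i)) = (\<Sum>i\<in>?I. u \<bullet> X i) / real n"
    by (simp add: inner_sum_right)
  also have "(1 / real n) * (\<Sum>i\<in>?I. (u \<bullet> X i)^2) - ((\<Sum>i\<in>?I. u \<bullet> X i) / real n)^2 = (spread (\<lambda>i. u \<bullet> X i) ?I)^2 / real n"
    using assms by (simp only: spread_sq[OF finite_atLeastAtMost I(1)] I(2))
      (simp add: power2_eq_square diff_divide_distrib)
  finally show ?thesis by (simp add: power_divide)
qed

lemma transpose_sample_cov: "transpose (sample_cov X m n) = sample_cov X m n"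
  by (simp add: sample_cov_def Let_def vec_eq_iff transpose_def outer_def mult.commute)

section \<open>Chains driven by Gaussian noise\<close>

text \<open>Serves both the time shift of the noise and the removal of the \<open>Some\<close> tags
  of the joint family.\<close>

lemma (in prob_space) indep_sets_reindex:
  assumes ind: "indep_sets F (f ` I)" and f: "inj_on f I"
  shows "indep_sets (\<lambda>i. F (f i)) I"
  unfolding indep_sets_def
proof (intro conjI ballI allI impI)
  fix i assume "i \<in> I" then show "F (f i) \<subseteq> events" using ind by (auto simp: indep_sets_def)
next
  fix J A assume J: "J \<subseteq> I" "J \<noteq> {}" "finite J" and A: "A \<in> Pi J (\<lambda>i. F (f i))"
  have fJ: "inj_on f J" using f J(1) by (rule inj_on_subset)
  define A' where "A' = (\<lambda>k. A (the_inv_into J f k))"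
  have A': "A' (f j) = A j" if "j \<in> J" for j
    using the_inv_into_f_f[OF fJ that] by (simp add: A'_def)
  have "prob (\<Inter>k\<in>f ` J. A' k) = (\<Prod>k\<in>f ` J. prob (A' k))"
    using ind J A A' by (intro indep_setsD[OF ind]) auto
  then show "prob (\<Inter>j\<in>J. A j) = (\<Prod>j\<in>J. prob (A j))"
    using A' by (simp add: prod.reindex[OF fJ])
qed

lemma (in prob_space) indep_vars_reindex:
  assumes "indep_vars M' X (f ` I)" "inj_on f I"
  shows "indep_vars (\<lambda>i. M' (f i)) (\<lambda>i. X (f i)) I"
  using assms(1) indep_sets_reindex[OF _ assms(2), of "\<lambda>i. {X i -` A \<inter> space M |A. A \<in> sets (M' i)}"]
  unfolding indep_vars_def2 by blast

lemma std_normal_moments: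
  "integrable std_normal (\<lambda>x. x)" "(\<integral>x. x \<partial>std_normal) = 0"
  "integrable std_normal (\<lambda>x. x^2)" "(\<integral>x. x^2 \<partial>std_normal) = 1"
proof -
  have 1: "has_bochner_integral lborel (\<lambda>x. std_normal_density x * x) 0"
    using std_normal_moment_odd[of 0] by simp
  have 2: "has_bochner_integral lborel (\<lambda>x. std_normal_density x * x^2) 1"
    using std_normal_moment_even[of 1] by (simp add: fact_2 power2_eq_square)
  show "integrable std_normal (\<lambda>x. x)" "integrable std_normal (\<lambda>x. x^2)"
    using 1 2 by (auto simp: integrable_density has_bochner_integral_iff)
  show "(\<integral>x. x \<partial>std_normal) = 0" "(\<integral>x. x^2 \<partial>std_normal) = 1"
    using 1 2 by (auto simp: integral_density has_bochner_integral_iff)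
qed

lemma std_gauss_coordinate:
  fixes b :: "real^'d"
  assumes b: "b \<in> Basis"
  shows "distr std_gauss borel (\<lambda>x. x \<bullet> b) = std_normal"
proof -
  have "distr (std_gauss :: (real^'d) measure) borel (\<lambda>x. x \<bullet> b)
    = distr (PiM Basis (\<lambda>_. std_normal)) borel ((\<lambda>x. x \<bullet> b) \<circ> (\<lambda>f :: (real^'d) \<Rightarrow> real. \<Sum>b\<in>Basis. f b *\<^sub>R b))"
    unfolding std_gauss_eq_distr_PiM by (intro distr_distr) measurable
  also have "\<dots> = distr (PiM Basis (\<lambda>_. std_normal)) std_normal (\<lambda>f :: (real^'d) \<Rightarrow> real. f b)"
    using b by (intro distr_cong) auto
  also have "\<dots> = std_normal"
    using b prob_space_normal_density by (intro distr_PiM_component) auto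
  finally show ?thesis .
qed

lemma subgaussian_distr:
  assumes X[measurable]: "X \<in> measurable M N" and Y: "subgaussian (distr M N X) Y C"
  shows "subgaussian M (\<lambda>w. Y (X w)) C"
  unfolding subgaussian_def
proof (intro allI conjI)
  fix l
  have [measurable]: "Y \<in> borel_measurable N" using subgaussian_measurable[OF Y] by simp
  show "integrable M (\<lambda>x. exp (l * Y (X x)))"
    using subgaussianD(1)[OF Y, of l] by (subst (asm) integrable_distr_eq) auto
  show "(\<integral>x. exp (l * Y (X x)) \<partial>M) \<le> exp (C * l^2 / 2)"
    using subgaussianD(2)[OF Y, of l] by (subst (asm) integral_distr) auto
qed

lemma inner_unit_sq_le: "norm u \<le> 1 \<Longrightarrow> (u \<bullet> x)^2 \<le> (norm x)^2" for u x :: "'a::real_inner"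
  using Cauchy_Schwarz_ineq2[of u x] mult_right_mono[of "norm u" 1 "norm x"]
  by (simp add: abs_le_square_iff[symmetric])

locale gaussian_noise = prob_space M for M :: "'a measure" +
  fixes Z :: "nat \<Rightarrow> 'a \<Rightarrow> real^'d"
  assumes Z_gauss: "1 \<le> i \<Longrightarrow> distributed M lborel (Z i) (\<lambda>x. ennreal (std_gauss_density x))"
    and Z_indep: "indep_vars (\<lambda>_. borel) Z {1..}"
begin

lemma Z_measurable: "1 \<le> i \<Longrightarrow> Z i \<in> borel_measurable M"
  using distributed_measurable[OF Z_gauss] by simp

lemma distr_Z: "1 \<le> i \<Longrightarrow> distr M borel (Z i) = std_gauss"
  using distributed_distr_eq_density[OF Z_gauss, of i] unfolding std_gauss_def
  by (simp cong: distr_cong)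

lemma distr_Z_block:
  assumes "1 \<le> N"
  shows "distr M (PiM {1..N} (\<lambda>_. borel)) (\<lambda>w. \<lambda>i\<in>{1..N}. Z (i + k) w) = PiM {1..N} (\<lambda>_. std_gauss)"
proof -
  have "indep_vars (\<lambda>_. borel) Z ((\<lambda>i. i + k) ` {1..N})"
    by (rule indep_vars_subset[OF Z_indep]) auto
  then have "indep_vars (\<lambda>_. borel) (\<lambda>i. Z (i + k)) {1..N}"
    by (rule indep_vars_reindex) simp
  then have "distr M (PiM {1..N} (\<lambda>_. borel)) (\<lambda>w. \<lambda>i\<in>{1..N}. Z (i + k) w) = PiM {1..N} (\<lambda>i. distr M borel (Z (i + k)))"
    using assms by (subst (asm) indep_vars_iff_distr_eq_PiM') (auto intro: Z_measurable)
  also have "\<dots> = PiM {1..N} (\<lambda>_. std_gauss)"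
    by (intro PiM_cong refl distr_Z) auto
  finally show ?thesis .
qed

lemma Z_block_measurable:
  "(\<lambda>w. \<lambda>i\<in>{1..N}. Z (i + k) w) \<in> measurable M (PiM {1..N} (\<lambda>_. borel))"
  by (intro measurable_restrict Z_measurable) auto

text \<open>\<open>L\<close> is the squared Lipschitz constant in the joint noise vector. The
  hypothesis \<open>cong\<close>, that \<open>F\<close> looks at coordinates 1 to \<open>N\<close>
  only, links the extensional functions of the product space with the full noise path.\<close>

lemma gaussian_concentration:
  fixes F :: "(nat \<Rightarrow> real^'d) \<Rightarrow> real"
  assumes N: "1 \<le> N" and F: "F \<in> borel_measurable (PiM {1..N} (\<lambda>_. borel))" and L: "0 \<le> L"
    and lip: "\<And>x y. (F x - F y)^2 \<le> L * (\<Sum>i\<in>{1..N}. (norm (x i - y i))^2)"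
    and cong: "\<And>x. F (restrict x {1..N}) = F x"
  shows "integrable M (\<lambda>w. F (\<lambda>i. Z i w))"
    and "subgaussian M (\<lambda>w. F (\<lambda>i. Z i w) - expectation (\<lambda>w. F (\<lambda>i. Z i w))) (2 * L)"
proof -
  let ?Q = "PiM {1..N} (\<lambda>_. std_gauss :: (real^'d) measure)"
  let ?X = "\<lambda>w. \<lambda>i\<in>{1..N}. Z (i + 0) w"
  have Q: "distr M (PiM {1..N} (\<lambda>_. borel)) ?X = ?Q" by (rule distr_Z_block[OF N])
  have X: "?X \<in> measurable M (PiM {1..N} (\<lambda>_. borel))" by (rule Z_block_measurable)
  have s: "sets ?Q = sets (PiM {1..N} (\<lambda>_. borel :: (real^'d) measure))" by (intro sets_PiM_cong) auto
  interpret Q: prob_space ?Q by (intro prob_space_PiM prob_space_std_gauss)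
  have dual: "exp_cost_duality ?Q (\<lambda>x y. \<Sum>i\<in>{1..N}. (norm (x i - y i))^2 / 4)"
    by (intro exp_cost_duality_PiM exp_cost_duality_std_gauss product_sigma_finite.intro prob_space_imp_sigma_finite prob_space_std_gauss) simp
  have F': "F \<in> borel_measurable ?Q" using F s by (simp cong: measurable_cong_sets)
  have lip': "(F x - F y)^2 \<le> 4 * L * (\<Sum>i\<in>{1..N}. (norm (x i - y i))^2 / 4)" for x y
    using lip[of x y] by (simp add: sum_divide_distrib[symmetric])
  have q: "integrable ?Q F" "subgaussian ?Q (\<lambda>x. F x - Q.expectation F) (2 * L)"
    using Q.subgaussian_lipschitz[OF dual F' L lip'] by (auto simp: sum_nonneg)
  have FX: "F (?X w) = F (\<lambda>i. Z i w)" for w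
    using cong[of "\<lambda>i. Z i w"] by simp
  have E: "Q.expectation F = expectation (\<lambda>w. F (\<lambda>i. Z i w))"
    unfolding Q[symmetric] by (subst integral_distr[OF X F]) (simp only: FX)
  show "integrable M (\<lambda>w. F (\<lambda>i. Z i w))"
    using q(1) unfolding Q[symmetric] by (subst (asm) integrable_distr_eq[OF X F]) (simp only: FX)
  show "subgaussian M (\<lambda>w. F (\<lambda>i. Z i w) - expectation (\<lambda>w. F (\<lambda>i. Z i w))) (2 * L)"
    using subgaussian_distr[OF X q(2)[folded Q]] unfolding FX Q E by simp
qed

lemma expectation_shift:
  fixes F :: "(nat \<Rightarrow> real^'d) \<Rightarrow> real"
  assumes N: "1 \<le> N" and F: "F \<in> borel_measurable (PiM {1..N} (\<lambda>_. borel))"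
    and cong: "\<And>x. F (restrict x {1..N}) = F x"
  shows "expectation (\<lambda>w. F (\<lambda>i. Z (i + k) w)) = expectation (\<lambda>w. F (\<lambda>i. Z i w))"
proof -
  have *: "expectation (\<lambda>w. F (\<lambda>i. Z (i + k) w)) = (\<integral>x. F x \<partial>PiM {1..N} (\<lambda>_. std_gauss))" for k
    unfolding distr_Z_block[OF N, of k, symmetric]
    by (subst integral_distr[OF Z_block_measurable F]) (simp only: cong)
  show ?thesis using *[of k] *[of 0] by simp
qed

end

locale gaussian_chain = gaussian_noise M Z + contraction T \<rho> s
  for M :: "'a measure" and Z :: "nat \<Rightarrow> 'a \<Rightarrow> real^'d" and T :: "real^'d \<Rightarrow> real^'d" and \<rho> s :: real
begin

lemma T_measurable[measurable]: "T \<in> borel_measurable borel"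
proof -
  have "continuous_on UNIV T"
    unfolding continuous_on_iff
  proof (intro ballI allI impI)
    fix x and e :: real assume "0 < e"
    show "\<exists>d>0. \<forall>x'\<in>UNIV. dist x' x < d \<longrightarrow> dist (T x') (T x) < e"
    proof (intro exI[of _ e] conjI ballI impI)
      fix x' assume "dist x' x < e"
      moreover have "dist (T x') (T x) \<le> 1 * dist x' x"
        unfolding dist_norm using contr[of x' x] rho by (elim order_trans) (intro mult_right_mono; simp)
      ultimately show "dist (T x') (T x) < e" by simp
    qed fact
  qed
  then show ?thesis by (rule borel_measurable_continuous_onI)
qed

text \<open>The starting point is an argument, so chains from different, even random, starts share
  one noise path: a synchronous coupling.\<close>

definition X :: "real^'d \<Rightarrow> nat \<Rightarrow> 'a \<Rightarrow> real^'d" where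
  "X a i w = chain T s a (\<lambda>k. Z k w) i"

lemma chain_measurable:
  "i \<le> N \<Longrightarrow> (\<lambda>z. chain T s a z i) \<in> borel_measurable (PiM {1..N} (\<lambda>_. borel))"
proof (induction i)
  case (Suc i)
  have [measurable]: "(\<lambda>z. z (Suc i)) \<in> borel_measurable (PiM {1..N} (\<lambda>_. borel :: (real^'d) measure))"
    using Suc.prems by (intro measurable_component_singleton) auto
  have [measurable]: "(\<lambda>z. chain T s a z i) \<in> borel_measurable (PiM {1..N} (\<lambda>_. borel))"
    using Suc by simp
  show ?case unfolding chain.simps by measurable
qed simp

lemma chain_restrict: "i \<le> N \<Longrightarrow> chain T s a (restrict z {1..N}) i = chain T s a z i"
  by (rule chain_cong) auto

lemma X_random_init_measurable:
  assumes [measurable]: "X0 \<in> borel_measurable M"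
  shows "(\<lambda>w. X (X0 w) i w) \<in> borel_measurable M"
  unfolding X_def
proof (induction i)
  case (Suc i)
  have [measurable]: "Z (Suc i) \<in> borel_measurable M" by (rule Z_measurable) simp
  note Suc[measurable]
  show ?case unfolding chain.simps by measurable
qed simp

lemma X_measurable[measurable]: "X a i \<in> borel_measurable M"
  using X_random_init_measurable[of "\<lambda>_. a"] by simp

text \<open>The block ends at \<open>Suc i\<close> so that it is nonempty for \<open>i = 0\<close>
  too, as concentration and time shift require.\<close>

lemma inner_chain_measurable:
  "(\<lambda>z. u \<bullet> chain T s a z i) \<in> borel_measurable (PiM {1..Suc i} (\<lambda>_. borel))"
  using chain_measurable[of i "Suc i"] by (intro borel_measurable_inner) auto

lemma X_subgaussian:
  assumes u: "norm u \<le> 1"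
  shows "integrable M (\<lambda>w. u \<bullet> X a i w)"
    and "subgaussian M (\<lambda>w. u \<bullet> X a i w - expectation (\<lambda>w. u \<bullet> X a i w)) (2 * (s^2 / (1 - \<rho>)))"
proof -
  define F where "F z = u \<bullet> chain T s a z i" for z
  have F: "F \<in> borel_measurable (PiM {1..Suc i} (\<lambda>_. borel))"
    unfolding F_def by (rule inner_chain_measurable)
  have lip: "(F x - F y)^2 \<le> s^2 / (1 - \<rho>) * (\<Sum>k\<in>{1..Suc i}. (norm (x k - y k))^2)" for x y
  proof -
    have "(F x - F y)^2 \<le> (norm (chain T s a x i - chain T s a y i))^2"
      unfolding F_def inner_diff_right[symmetric] by (rule inner_unit_sq_le[OF u])
    also have "\<dots> \<le> s^2 / (1 - \<rho>) * (\<Sum>k\<in>{1..i}. (norm (x k - y k))^2)"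
      by (rule chain_diff_sq)
    also have "\<dots> \<le> s^2 / (1 - \<rho>) * (\<Sum>k\<in>{1..Suc i}. (norm (x k - y k))^2)"
      using rho by (intro mult_left_mono sum_mono2) auto
    finally show ?thesis by simp
  qed
  have cong: "F (restrict x {1..Suc i}) = F x" for x
    unfolding F_def by (subst chain_restrict) auto
  have "0 \<le> s^2 / (1 - \<rho>)" using rho by simp
  from gaussian_concentration[OF _ F this lip cong]
  show "integrable M (\<lambda>w. u \<bullet> X a i w)"
    "subgaussian M (\<lambda>w. u \<bullet> X a i w - expectation (\<lambda>w. u \<bullet> X a i w)) (2 * (s^2 / (1 - \<rho>)))"
    by (auto simp: F_def X_def)
qed

text \<open>\<open>spread\<close> is 1-Lipschitz in the path, whose summed squared response to the
  noise is already bounded. With \<open>s^2 = 2 * \<eta>\<close> and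
  \<open>1 - \<rho> = \<alpha> * \<eta>\<close> the proxy is
  \<open>4 / (\<alpha>^2 * \<eta> * n)\<close>.\<close>

lemma spread_subgaussian:
  fixes a :: "real^'d" and m n :: nat
  assumes u: "norm u \<le> 1" and n: "1 \<le> n"
  defines "G \<equiv> \<lambda>w. spread (\<lambda>i. u \<bullet> X a i w) {m+1..m+n} / sqrt (real n)"
  shows "subgaussian M (\<lambda>w. G w - expectation G) (2 * (s^2 / ((1 - \<rho>)^2 * real n)))"
    and "integrable M G"
proof -
  define F where "F z = spread (\<lambda>i. u \<bullet> chain T s a z i) {m+1..m+n} / sqrt (real n)" for z
  have I: "finite {m+1..m+n}" "{m+1..m+n} \<noteq> {}" using n by auto
  have [measurable]: "(\<lambda>z. chain T s a z i) \<in> borel_measurable (PiM {1..m+n} (\<lambda>_. borel))"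
    if "i \<in> {m+1..m+n}" for i
    using that by (intro chain_measurable) simp
  have F: "F \<in> borel_measurable (PiM {1..m+n} (\<lambda>_. borel))"
    unfolding F_def spread_def L2_set_def by measurable
  have lip: "(F x - F y)^2 \<le> s^2 / ((1 - \<rho>)^2 * real n) * (\<Sum>k\<in>{1..m+n}. (norm (x k - y k))^2)" for x y
  proof -
    have "\<bar>F x - F y\<bar> = \<bar>spread (\<lambda>i. u \<bullet> chain T s a x i) {m+1..m+n} - spread (\<lambda>i. u \<bullet> chain T s a y i) {m+1..m+n}\<bar> / sqrt (real n)"
      by (simp add: F_def diff_divide_distrib[symmetric] abs_divide)
    also have "\<dots> \<le> L2_set (\<lambda>i. u \<bullet> chain T s a x i - u \<bullet> chain T s a y i) {m+1..m+n} / sqrt (real n)"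
      by (intro divide_right_mono spread_lipschitz I) simp
    finally have "\<bar>F x - F y\<bar>^2 \<le> (L2_set (\<lambda>i. u \<bullet> chain T s a x i - u \<bullet> chain T s a y i) {m+1..m+n} / sqrt (real n))^2"
      by (intro power_mono) auto
    also have "\<dots> = (\<Sum>i\<in>{m+1..m+n}. (u \<bullet> (chain T s a x i - chain T s a y i))^2) / real n"
      by (simp add: power_divide L2_set_def sum_nonneg inner_diff_right)
    also have "\<dots> \<le> (\<Sum>i\<in>{m+1..m+n}. (norm (chain T s a x i - chain T s a y i))^2) / real n"
      by (intro divide_right_mono sum_mono inner_unit_sq_le u) simp
    also have "\<dots> \<le> (\<Sum>i\<in>{1..m+n}. (norm (chain T s a x i - chain T s a y i))^2) / real n"
      by (intro divide_right_mono sum_mono2) auto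
    also have "\<dots> \<le> (s^2 / (1 - \<rho>)^2 * (\<Sum>k\<in>{1..m+n}. (norm (x k - y k))^2)) / real n"
      by (intro divide_right_mono chain_diff_sum_sq) simp
    finally show ?thesis by simp
  qed
  have cong: "F (restrict x {1..m+n}) = F x" for x
  proof -
    have "(\<lambda>i. u \<bullet> chain T s a (restrict x {1..m+n}) i) i = (\<lambda>i. u \<bullet> chain T s a x i) i" if "i \<in> {m+1..m+n}" for i
      using that by (simp add: chain_restrict del: One_nat_def)
    then show ?thesis
      unfolding F_def spread_def by (intro arg_cong2[where f="(/)"] L2_set_cong refl arg_cong2[where f="(-)"] sum.cong) auto
  qed
  have "0 \<le> s^2 / ((1 - \<rho>)^2 * real n)" using rho by simp
  from gaussian_concentration[OF _ F this lip cong] n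
  show "subgaussian M (\<lambda>w. G w - expectation G) (2 * (s^2 / ((1 - \<rho>)^2 * real n)))" "integrable M G"
    by (auto simp: F_def X_def G_def)
qed

lemma indep_X_Z: "indep_var borel (X a i) borel (Z (Suc i))"
proof -
  have "indep_var (PiM {1..i} (\<lambda>_. borel)) (\<lambda>w. restrict (\<lambda>k. Z k w) {1..i}) (PiM {Suc i} (\<lambda>_. borel)) (\<lambda>w. restrict (\<lambda>k. Z k w) {Suc i})"
    by (rule indep_var_restrict[OF Z_indep]) auto
  then have "indep_var borel ((\<lambda>z. chain T s a z i) \<circ> (\<lambda>w. restrict (\<lambda>k. Z k w) {1..i})) borel ((\<lambda>z. z (Suc i)) \<circ> (\<lambda>w. restrict (\<lambda>k. Z k w) {Suc i}))"
    by (rule indep_var_compose[OF _ chain_measurable[OF order_refl] measurable_component_singleton]) simp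
  then show ?thesis by (simp add: o_def chain_restrict X_def[abs_def] del: One_nat_def)
qed

lemma Z_moments:
  assumes "1 \<le> i" and b: "b \<in> Basis"
  shows "integrable M (\<lambda>w. Z i w \<bullet> b)" "expectation (\<lambda>w. Z i w \<bullet> b) = 0"
    "integrable M (\<lambda>w. (Z i w \<bullet> b)^2)" "expectation (\<lambda>w. (Z i w \<bullet> b)^2) = 1"
proof -
  have m[measurable]: "Z i \<in> borel_measurable M" by (rule Z_measurable[OF assms(1)])
  have c: "(\<lambda>w. Z i w \<bullet> b) \<in> borel_measurable M" by measurable
  have "distr M borel ((\<lambda>x. x \<bullet> b) \<circ> Z i) = distr (distr M borel (Z i)) borel (\<lambda>x. x \<bullet> b)"
    by (intro distr_distr[symmetric] m) measurable
  then have d: "distr M borel (\<lambda>w. Z i w \<bullet> b) = std_normal"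
    by (simp add: o_def distr_Z[OF assms(1)] std_gauss_coordinate[OF b])
  show "integrable M (\<lambda>w. Z i w \<bullet> b)"
    by (rule integrable_distr[OF c, unfolded d, OF std_normal_moments(1)])
  show "integrable M (\<lambda>w. (Z i w \<bullet> b)^2)"
    by (rule integrable_distr[OF c, unfolded d, OF std_normal_moments(3)])
  show "expectation (\<lambda>w. Z i w \<bullet> b) = 0"
    using integral_distr[OF c, of "\<lambda>x. x"] unfolding d std_normal_moments by simp
  show "expectation (\<lambda>w. (Z i w \<bullet> b)^2) = 1"
    using integral_distr[OF c, of "\<lambda>x. x^2"] unfolding d std_normal_moments by simp
qed

lemma Z_norm_sq:
  assumes "1 \<le> i"
  shows "integrable M (\<lambda>w. (norm (Z i w))^2)" "expectation (\<lambda>w. (norm (Z i w))^2) = real CARD('d)"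
proof -
  show "integrable M (\<lambda>w. (norm (Z i w))^2)"
    unfolding norm_sq_eq_sum_Basis by (intro Bochner_Integration.integrable_sum Z_moments[OF assms])
  show "expectation (\<lambda>w. (norm (Z i w))^2) = real CARD('d)"
    unfolding norm_sq_eq_sum_Basis by (subst Bochner_Integration.integral_sum) (auto simp: Z_moments[OF assms])
qed

text \<open>The new noise is centred and independent of the past, so the cross term vanishes and the
  second moment about the fixed point contracts up to \<open>s^2 * d\<close>, where \<open>d\<close>
  is the dimension. The stated bound is preserved by this recursion.\<close>

lemma X_second_moment:
  assumes fixp: "T p = p"
  shows "integrable M (\<lambda>w. (norm (X a i w - p))^2)"
    and "expectation (\<lambda>w. (norm (X a i w - p))^2) \<le> (norm (a - p))^2 + s^2 / (1 - \<rho>) * real CARD('d)"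
proof (induction i)
  case 0
  case 1 show ?case by (simp add: X_def)
  case 2 show ?case using rho by (simp add: X_def prob_space)
next
  case (Suc i)
  define V where "V w = T (X a i w) - p" for w
  define W where "W = Z (Suc i)"
  have [measurable]: "V \<in> borel_measurable M" unfolding V_def by measurable
  have [measurable]: "W \<in> borel_measurable M" unfolding W_def by (rule Z_measurable) simp
  have V_le: "(norm (V w))^2 \<le> \<rho>^2 * (norm (X a i w - p))^2" for w
  proof -
    have "norm (V w) \<le> \<rho> * norm (X a i w - p)" using contr[of "X a i w" p] by (simp add: V_def fixp)
    then have "(norm (V w))^2 \<le> (\<rho> * norm (X a i w - p))^2" by (intro power_mono) auto
    then show ?thesis by (simp add: power_mult_distrib)
  qed
  have iV: "integrable M (\<lambda>w. (norm (V w))^2)"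
    by (rule integrable_pointwise_bound[OF integrable_mult_right[OF Suc(1), of "\<rho>^2"]])
       (use V_le in auto)
  have iW: "integrable M (\<lambda>w. (norm (W w))^2)" "expectation (\<lambda>w. (norm (W w))^2) = real CARD('d)"
    unfolding W_def by (auto intro: Z_norm_sq)
  have iVb: "integrable M (\<lambda>w. V w \<bullet> b)" if "b \<in> Basis" for b
  proof (rule square_integrable_imp_integrable)
    show "integrable M (\<lambda>w. (V w \<bullet> b)^2)"
      by (rule integrable_pointwise_bound[OF iV])
         (use Basis_le_norm[OF that] in \<open>auto simp: abs_le_square_iff[symmetric]\<close>)
  qed measurable
  have ind: "indep_var borel (\<lambda>w. V w \<bullet> b) borel (\<lambda>w. W w \<bullet> b)" for b
  proof -
    have "indep_var borel ((\<lambda>x. (T x - p) \<bullet> b) \<circ> X a i) borel ((\<lambda>x. x \<bullet> b) \<circ> Z (Suc i))"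
      by (rule indep_var_compose[OF indep_X_Z]) measurable
    then show ?thesis by (simp add: o_def V_def W_def)
  qed
  \<comment> \<open>Independence is used coordinate by coordinate, where the product rule for real
    expectations applies.\<close>
  have iVWb: "integrable M (\<lambda>w. (V w \<bullet> b) * (W w \<bullet> b))" "expectation (\<lambda>w. (V w \<bullet> b) * (W w \<bullet> b)) = 0"
    if b: "b \<in> Basis" for b
    using indep_var_integrable[OF ind iVb[OF b]] indep_var_lebesgue_integral[OF ind iVb[OF b]] Z_moments[of "Suc i" b] b
    by (auto simp: W_def)
  have VW: "V w \<bullet> W w = (\<Sum>b\<in>Basis. (V w \<bullet> b) * (W w \<bullet> b))" for w
    by (rule euclidean_inner)
  have iVW: "integrable M (\<lambda>w. V w \<bullet> W w)" "expectation (\<lambda>w. V w \<bullet> W w) = 0"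
    unfolding VW using iVWb by (auto simp: Bochner_Integration.integral_sum)
  have sq: "(norm (X a (Suc i) w - p))^2 = (norm (V w))^2 + 2 * s * (V w \<bullet> W w) + s^2 * (norm (W w))^2" for w
  proof -
    have "X a (Suc i) w - p = V w + s *\<^sub>R W w" by (simp add: X_def V_def W_def)
    then have "(norm (X a (Suc i) w - p))^2 = (V w + s *\<^sub>R W w) \<bullet> (V w + s *\<^sub>R W w)"
      by (simp only: power2_norm_eq_inner)
    also have "\<dots> = V w \<bullet> V w + 2 * s * (V w \<bullet> W w) + s^2 * (W w \<bullet> W w)"
      by (simp add: inner_add_left inner_add_right inner_commute power2_eq_square)
    finally show ?thesis by (simp only: power2_norm_eq_inner)
  qed
  case 1
  show ?case unfolding sq using iV iVW iW by simp
  case 2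
  define B where "B = (norm (a - p))^2 + s^2 / (1 - \<rho>) * real CARD('d)"
  have B0: "0 \<le> B" using rho by (simp add: B_def)
  have "expectation (\<lambda>w. (norm (V w))^2) \<le> expectation (\<lambda>w. \<rho>^2 * (norm (X a i w - p))^2)"
    using V_le Suc(1) iV by (intro integral_mono) auto
  also have "\<dots> \<le> \<rho>^2 * B" using Suc(2) by (simp add: mult_left_mono B_def)
  also have "\<dots> \<le> \<rho> * B"
    using rho B0 by (intro mult_right_mono) (auto simp: power2_eq_square mult_left_le)
  finally have EV: "expectation (\<lambda>w. (norm (V w))^2) \<le> \<rho> * B" .
  have "s^2 * real CARD('d) = (1 - \<rho>) * (s^2 / (1 - \<rho>) * real CARD('d))" using rho by simp
  also have "\<dots> \<le> (1 - \<rho>) * B" unfolding B_def using rho by (intro mult_left_mono) auto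
  finally have sd: "\<rho> * B + s^2 * real CARD('d) \<le> B" by (simp add: left_diff_distrib)
  have "expectation (\<lambda>w. (norm (X a (Suc i) w - p))^2) = expectation (\<lambda>w. (norm (V w))^2) + s^2 * real CARD('d)"
    unfolding sq using iV iVW iW by simp
  then show ?case using EV sd unfolding B_def by linarith
qed

end

section \<open>Drift of the means and dependence on the starting point\<close>

lemma (in prob_space) square_expectation_le:
  fixes Y :: "'a \<Rightarrow> real"
  assumes [measurable]: "Y \<in> borel_measurable M" and Y: "integrable M (\<lambda>w. (Y w)^2)"
  shows "(expectation Y)^2 \<le> expectation (\<lambda>w. (Y w)^2)"
proof -
  have "integrable M Y" by (rule square_integrable_imp_integrable) (use Y in auto)
  then have "variance Y = expectation (\<lambda>w. (Y w)^2) - (expectation Y)^2"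
    using Y by (rule variance_eq)
  then show ?thesis using variance_positive[of Y] by linarith
qed

lemma norm_diff_sq_le: "(norm (x - z))^2 \<le> 2 * (norm (x - y))^2 + 2 * (norm (y - z))^2"
  for x y z :: "'a::real_normed_vector"
proof -
  have "norm (x - z) \<le> norm (x - y) + norm (y - z)" by (rule norm_diff_triangle_le) auto
  then have "(norm (x - z))^2 \<le> (norm (x - y) + norm (y - z))^2" by (intro power_mono) auto
  also have "\<dots> \<le> 2 * (norm (x - y))^2 + 2 * (norm (y - z))^2"
    using sum_squares_bound[of "norm (x - y)" "norm (y - z)"] by (simp add: power2_sum)
  finally show ?thesis .
qed

lemma sum_power_atLeastAtMost_le:
  fixes \<rho> :: real
  assumes "0 < \<rho>" "\<rho> < 1"
  shows "(\<Sum>i\<in>{m+1..m+n}. (\<rho> ^ i)^2) \<le> (\<rho> ^ (m+1))^2 / (1 - \<rho>)"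
proof -
  have eq: "(1 - \<rho>) * (\<Sum>i\<in>{m+1..m+n}. \<rho> ^ i) = \<rho> ^ (m+1) - \<rho> ^ (m+n+1)" for n
  proof (induction n)
    case (Suc n)
    have "(\<Sum>i\<in>{m+1..m+Suc n}. \<rho> ^ i) = (\<Sum>i\<in>{m+1..m+n}. \<rho> ^ i) + \<rho> ^ (m+n+1)" by simp
    then show ?case using Suc by (simp only: distrib_left) (simp add: left_diff_distrib)
  qed simp
  have "(\<Sum>i\<in>{m+1..m+n}. (\<rho> ^ i)^2) \<le> (\<Sum>i\<in>{m+1..m+n}. \<rho> ^ (m+1) * \<rho> ^ i)"
    unfolding power2_eq_square using assms
    by (intro sum_mono mult_right_mono power_decreasing) auto
  also have "\<dots> = \<rho> ^ (m+1) * (\<Sum>i\<in>{m+1..m+n}. \<rho> ^ i)" by (simp only: sum_distrib_left)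
  also have "(\<Sum>i\<in>{m+1..m+n}. \<rho> ^ i) = (\<rho> ^ (m+1) - \<rho> ^ (m+n+1)) / (1 - \<rho>)"
    using eq[of n] assms by (simp add: field_simps)
  also have "\<rho> ^ (m+1) * ((\<rho> ^ (m+1) - \<rho> ^ (m+n+1)) / (1 - \<rho>)) \<le> \<rho> ^ (m+1) * (\<rho> ^ (m+1) / (1 - \<rho>))"
    using assms by (intro mult_left_mono divide_right_mono) auto
  also have "\<dots> = (\<rho> ^ (m+1))^2 / (1 - \<rho>)" by (simp add: power2_eq_square)
  finally show ?thesis .
qed

context gaussian_chain
begin

text \<open>After \<open>k\<close> steps the chain runs on from \<open>X a k\<close> with shifted
  noise. A copy started at \<open>a\<close> with the same shifted noise has the law of
  \<open>X a i\<close>, and the two differ by at most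
  \<open>\<rho> ^ i * norm (X a k w - a)\<close>, whose mean the second moment controls.\<close>

lemma X_drift:
  assumes fixp: "T p = p" and u: "norm u \<le> 1"
  shows "(expectation (\<lambda>w. u \<bullet> X a (k + i) w) - expectation (\<lambda>w. u \<bullet> X a i w))^2
    \<le> (\<rho> ^ i)^2 * (4 * (norm (a - p))^2 + 2 * (s^2 / (1 - \<rho>) * real CARD('d)))"
proof -
  define F where "F z = u \<bullet> chain T s a z i" for z
  have F: "F \<in> borel_measurable (PiM {1..Suc i} (\<lambda>_. borel))"
    unfolding F_def by (rule inner_chain_measurable)
  have cong: "F (restrict x {1..Suc i}) = F x" for x
    unfolding F_def by (subst chain_restrict) auto
  define Y where "Y w = F (\<lambda>j. Z (j + k) w)" for w
  have EY: "expectation Y = expectation (\<lambda>w. u \<bullet> X a i w)"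
    unfolding Y_def using expectation_shift[OF _ F cong, of k] by (simp add: F_def X_def)
  have [measurable]: "Y \<in> borel_measurable M"
    using measurable_compose[OF Z_block_measurable[where N = "Suc i" and k = k] F] by (simp only: cong Y_def[abs_def])
  define R where "R w = norm (X a k w - a)" for w
  have [measurable]: "R \<in> borel_measurable M" unfolding R_def by measurable
  have R_le: "(R w)^2 \<le> 2 * (norm (X a k w - p))^2 + 2 * (norm (a - p))^2" for w
    using norm_diff_sq_le[of "X a k w" a p] by (simp add: R_def norm_minus_commute)
  have iR2: "integrable M (\<lambda>w. (R w)^2)"
  proof (rule integrable_pointwise_bound)
    show "integrable M (\<lambda>w. 2 * (norm (X a k w - p))^2 + 2 * (norm (a - p))^2)"
      using X_second_moment(1)[OF fixp] by simp
  qed (use R_le in auto)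
  have iR: "integrable M R"
    by (rule square_integrable_imp_integrable) (use iR2 in auto)
  have "expectation (\<lambda>w. (R w)^2) \<le> expectation (\<lambda>w. 2 * (norm (X a k w - p))^2 + 2 * (norm (a - p))^2)"
    using R_le X_second_moment(1)[OF fixp] by (intro integral_mono iR2) auto
  also have "\<dots> = 2 * expectation (\<lambda>w. (norm (X a k w - p))^2) + 2 * (norm (a - p))^2"
    using X_second_moment(1)[OF fixp] by (simp add: prob_space)
  also have "\<dots> \<le> 4 * (norm (a - p))^2 + 2 * (s^2 / (1 - \<rho>) * real CARD('d))"
    using X_second_moment(2)[OF fixp, of a k] by linarith
  finally have ER2: "(expectation R)^2 \<le> 4 * (norm (a - p))^2 + 2 * (s^2 / (1 - \<rho>) * real CARD('d))"
    using square_expectation_le[OF _ iR2] by simp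
  have diff: "\<bar>u \<bullet> X a (k + i) w - Y w\<bar> \<le> \<rho> ^ i * R w" for w
  proof -
    have "u \<bullet> X a (k + i) w - Y w = u \<bullet> (chain T s (X a k w) (\<lambda>j. Z (j + k) w) i - chain T s a (\<lambda>j. Z (j + k) w) i)"
      by (simp add: X_def Y_def F_def chain_add inner_diff_right)
    also have "\<bar>\<dots>\<bar> \<le> norm u * norm (chain T s (X a k w) (\<lambda>j. Z (j + k) w) i - chain T s a (\<lambda>j. Z (j + k) w) i)"
      by (rule Cauchy_Schwarz_ineq2)
    also have "\<dots> \<le> 1 * (\<rho> ^ i * R w)"
      unfolding R_def by (intro mult_mono u chain_diff_init) auto
    finally show ?thesis by simp
  qed
  have iX: "integrable M (\<lambda>w. u \<bullet> X a (k + i) w)" by (rule X_subgaussian(1)[OF u])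
  have iD: "integrable M (\<lambda>w. u \<bullet> X a (k + i) w - Y w)"
    by (rule integrable_pointwise_bound[OF integrable_mult_right[OF iR, of "\<rho> ^ i"]]) (use diff in auto)
  have iY: "integrable M Y"
    using Bochner_Integration.integrable_diff[OF iX iD] by simp
  have "\<bar>expectation (\<lambda>w. u \<bullet> X a (k + i) w) - expectation Y\<bar> = \<bar>expectation (\<lambda>w. u \<bullet> X a (k + i) w - Y w)\<bar>"
    using iX iY by simp
  also have "\<dots> \<le> expectation (\<lambda>w. \<bar>u \<bullet> X a (k + i) w - Y w\<bar>)"
    by (rule integral_abs_bound)
  also have "\<dots> \<le> expectation (\<lambda>w. \<rho> ^ i * R w)"
    using iD iR diff by (intro integral_mono) auto
  also have "\<dots> = \<rho> ^ i * expectation R" by simp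
  finally have "\<bar>expectation (\<lambda>w. u \<bullet> X a (k + i) w) - expectation Y\<bar>^2 \<le> (\<rho> ^ i * expectation R)^2"
    by (intro power_mono) auto
  also have "\<dots> \<le> (\<rho> ^ i)^2 * (4 * (norm (a - p))^2 + 2 * (s^2 / (1 - \<rho>) * real CARD('d)))"
    unfolding power_mult_distrib by (intro mult_left_mono ER2) simp
  finally show ?thesis unfolding EY by simp
qed

text \<open>Bounds the mean of the standard deviation by its second moment, split into the variances
  of the projections and the squared drift of their means.\<close>

lemma spread_mean_sq_le:
  fixes a :: "real^'d" and m n :: nat
  assumes fixp: "T p = p" and u: "norm u \<le> 1" and n: "1 \<le> n" and s: "0 < s"
  defines "G \<equiv> \<lambda>w. spread (\<lambda>i. u \<bullet> X a i w) {m+1..m+n} / sqrt (real n)"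
  shows "(expectation G)^2 \<le> 2 * (s^2 / (1 - \<rho>)) +
     (4 * (norm (a - p))^2 + 2 * (s^2 / (1 - \<rho>) * real CARD('d))) * ((\<rho> ^ (m+1))^2 / ((1 - \<rho>) * real n))"
proof -
  let ?I = "{m+1..m+n}"
  let ?V = "2 * (s^2 / (1 - \<rho>))"
  define D where "D = 4 * (norm (a - p))^2 + 2 * (s^2 / (1 - \<rho>) * real CARD('d))"
  have D0: "0 \<le> D" using rho by (simp add: D_def)
  define \<mu> where "\<mu> i = expectation (\<lambda>w. u \<bullet> X a i w)" for i
  \<comment> \<open>The mean at the last time as common centre: every time in the window is earlier,
    so the drift bound applies with geometric weight \<open>\<rho> ^ i\<close>.\<close>
  define c where "c = \<mu> (m + n)"
  note sg = X_subgaussian(2)[OF u, of a, folded \<mu>_def]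
  have var: "integrable M (\<lambda>w. (u \<bullet> X a i w - c)^2)"
    "expectation (\<lambda>w. (u \<bullet> X a i w - c)^2) \<le> ?V + (\<rho> ^ i)^2 * D" if i: "i \<in> ?I" for i
  proof -
    have i1: "integrable M (\<lambda>w. u \<bullet> X a i w - \<mu> i)" using X_subgaussian(1)[OF u] by simp
    have i2: "integrable M (\<lambda>w. (u \<bullet> X a i w - \<mu> i)^2)" by (rule subgaussian_integrable_power2[OF sg])
    have eq: "(u \<bullet> X a i w - c)^2 = (u \<bullet> X a i w - \<mu> i)^2 + 2 * (\<mu> i - c) * (u \<bullet> X a i w - \<mu> i) + (\<mu> i - c)^2" for w
      by (simp add: power2_eq_square algebra_simps)
    have m0: "expectation (\<lambda>w. u \<bullet> X a i w - \<mu> i) = 0"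
      using X_subgaussian(1)[OF u, of a i] by (simp add: \<mu>_def prob_space)
    show "integrable M (\<lambda>w. (u \<bullet> X a i w - c)^2)"
      unfolding eq by (intro Bochner_Integration.integrable_add i2 integrable_mult_right i1) simp
    have "expectation (\<lambda>w. (u \<bullet> X a i w - c)^2) = expectation (\<lambda>w. (u \<bullet> X a i w - \<mu> i)^2) + 2 * (\<mu> i - c) * expectation (\<lambda>w. u \<bullet> X a i w - \<mu> i) + (\<mu> i - c)^2"
      unfolding eq using i1 i2 by (simp add: prob_space del: Bochner_Integration.integral_diff)
    moreover have "expectation (\<lambda>w. (u \<bullet> X a i w - \<mu> i)^2) \<le> ?V"
      using s rho by (intro subgaussian_second_moment[OF sg]) simp
    moreover have "(\<mu> i - c)^2 \<le> (\<rho> ^ i)^2 * D"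
    proof -
      have "m + n = (m + n - i) + i" using i by simp
      then show ?thesis
        using X_drift[OF fixp u, of a "m + n - i" i] unfolding c_def \<mu>_def D_def by (simp add: power2_commute)
    qed
    ultimately show "expectation (\<lambda>w. (u \<bullet> X a i w - c)^2) \<le> ?V + (\<rho> ^ i)^2 * D"
      unfolding m0 by simp
  qed
  have sgG: "subgaussian M (\<lambda>w. G w - expectation G) (2 * (s^2 / ((1 - \<rho>)^2 * real n)))"
    unfolding G_def by (rule spread_subgaussian[OF u n])
  have iG: "integrable M G" unfolding G_def by (rule spread_subgaussian[OF u n])
  have iG2: "integrable M (\<lambda>w. (G w)^2)"
  proof -
    have "(G w)^2 = (G w - expectation G)^2 + 2 * expectation G * G w - (expectation G)^2" for w
      by (simp add: power2_eq_square algebra_simps)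
    then show ?thesis using subgaussian_integrable_power2[OF sgG] iG by simp
  qed
  have "(expectation G)^2 \<le> expectation (\<lambda>w. (G w)^2)"
    by (rule square_expectation_le[OF borel_measurable_integrable[OF iG] iG2])
  also have "\<dots> \<le> expectation (\<lambda>w. (\<Sum>i\<in>?I. (u \<bullet> X a i w - c)^2) / real n)"
  proof (rule integral_mono[OF iG2])
    show "integrable M (\<lambda>w. (\<Sum>i\<in>?I. (u \<bullet> X a i w - c)^2) / real n)"
      by (intro integrable_divide_zero Bochner_Integration.integrable_sum var)
    fix w
    have "(spread (\<lambda>i. u \<bullet> X a i w) ?I)^2 \<le> (\<Sum>i\<in>?I. (u \<bullet> X a i w - c)^2)"
      using n by (intro spread_sq_le) auto
    then show "(G w)^2 \<le> (\<Sum>i\<in>?I. (u \<bullet> X a i w - c)^2) / real n"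
      by (simp add: G_def power_divide divide_right_mono)
  qed
  also have "\<dots> = (\<Sum>i\<in>?I. expectation (\<lambda>w. (u \<bullet> X a i w - c)^2)) / real n"
    using var(1) by (subst integral_divide_zero) (simp add: Bochner_Integration.integral_sum)
  also have "\<dots> \<le> (\<Sum>i\<in>?I. ?V + (\<rho> ^ i)^2 * D) / real n"
    by (intro divide_right_mono sum_mono var(2)) auto
  also have "\<dots> = (real n * ?V + (\<Sum>i\<in>?I. (\<rho> ^ i)^2) * D) / real n"
    by (simp add: sum.distrib sum_distrib_right)
  also have "\<dots> \<le> (real n * ?V + (\<rho> ^ (m+1))^2 / (1 - \<rho>) * D) / real n"
    by (intro divide_right_mono add_left_mono mult_right_mono sum_power_atLeastAtMost_le rho D0) simp
  also have "\<dots> = ?V + D * ((\<rho> ^ (m+1))^2 / ((1 - \<rho>) * real n))"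
    using n by (simp add: add_divide_distrib)
  finally show ?thesis unfolding D_def .
qed

lemma spread_diff_init:
  fixes m n :: nat
  assumes u: "norm u \<le> 1" and n: "1 \<le> n"
  shows "(spread (\<lambda>i. u \<bullet> X x i w) {m+1..m+n} / sqrt (real n) - spread (\<lambda>i. u \<bullet> X y i w) {m+1..m+n} / sqrt (real n))^2
    \<le> (\<rho> ^ (m+1))^2 / ((1 - \<rho>) * real n) * (norm (x - y))^2"
proof -
  let ?I = "{m+1..m+n}"
  let ?F = "\<lambda>x. spread (\<lambda>i. u \<bullet> X x i w) ?I"
  have "\<bar>?F x - ?F y\<bar> \<le> L2_set (\<lambda>i. u \<bullet> X x i w - u \<bullet> X y i w) ?I"
    using n by (intro spread_lipschitz) auto
  then have "\<bar>?F x - ?F y\<bar>^2 \<le> (L2_set (\<lambda>i. u \<bullet> X x i w - u \<bullet> X y i w) ?I)^2"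
    by (intro power_mono) auto
  also have "\<dots> = (\<Sum>i\<in>?I. (u \<bullet> (X x i w - X y i w))^2)"
    by (simp add: L2_set_def sum_nonneg inner_diff_right)
  also have "\<dots> \<le> (\<Sum>i\<in>?I. (\<rho> ^ i)^2 * (norm (x - y))^2)"
  proof (rule sum_mono)
    fix i
    have "(u \<bullet> (X x i w - X y i w))^2 \<le> (norm (X x i w - X y i w))^2"
      by (rule inner_unit_sq_le[OF u])
    also have "\<dots> \<le> (\<rho> ^ i * norm (x - y))^2"
      unfolding X_def by (intro power_mono chain_diff_init) simp
    finally show "(u \<bullet> (X x i w - X y i w))^2 \<le> (\<rho> ^ i)^2 * (norm (x - y))^2"
      by (simp add: power_mult_distrib)
  qed
  also have "\<dots> = (\<Sum>i\<in>?I. (\<rho> ^ i)^2) * (norm (x - y))^2" by (simp add: sum_distrib_right)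
  also have "\<dots> \<le> (\<rho> ^ (m+1))^2 / (1 - \<rho>) * (norm (x - y))^2"
    by (intro mult_right_mono sum_power_atLeastAtMost_le rho) simp
  finally have "(?F x - ?F y)^2 / real n \<le> (\<rho> ^ (m+1))^2 / (1 - \<rho>) * (norm (x - y))^2 / real n"
    by (intro divide_right_mono) auto
  then show ?thesis by (simp add: diff_divide_distrib[symmetric] power_divide)
qed

end

section \<open>Deviation of the quadratic forms\<close>

lemma (in prob_space) subgaussian_norm_sq:
  fixes Y :: "'a \<Rightarrow> 'b::euclidean_space"
  assumes Y: "\<And>u. norm u \<le> 1 \<Longrightarrow> subgaussian M (\<lambda>w. u \<bullet> Y w) C" and C: "0 < C"
  shows "integrable M (\<lambda>w. (norm (Y w))^2)" "expectation (\<lambda>w. (norm (Y w))^2) \<le> real DIM('b) * C"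
proof -
  have sub: "subgaussian M (\<lambda>w. Y w \<bullet> b) C" if "b \<in> Basis" for b
    using Y[of b] that by (simp add: inner_commute)
  show "integrable M (\<lambda>w. (norm (Y w))^2)"
    unfolding norm_sq_eq_sum_Basis
    by (intro Bochner_Integration.integrable_sum subgaussian_integrable_power2[OF sub])
  have "expectation (\<lambda>w. (norm (Y w))^2) = (\<Sum>b\<in>Basis. expectation (\<lambda>w. (Y w \<bullet> b)^2))"
    unfolding norm_sq_eq_sum_Basis
    by (intro Bochner_Integration.integral_sum subgaussian_integrable_power2[OF sub])
  also have "\<dots> \<le> (\<Sum>b\<in>(Basis :: 'b set). C)"
    by (intro sum_mono subgaussian_second_moment[OF sub] C)
  finally show "expectation (\<lambda>w. (norm (Y w))^2) \<le> real DIM('b) * C" by simp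
qed

lemma subgaussian_uminus:
  assumes "subgaussian M Y C"
  shows "subgaussian M (\<lambda>x. - Y x) C"
  unfolding subgaussian_def
proof
  fix l
  show "integrable M (\<lambda>x. exp (l * - Y x)) \<and> (\<integral>x. exp (l * - Y x) \<partial>M) \<le> exp (C * l^2 / 2)"
    using subgaussianD[OF assms, of "- l"] by simp
qed

text \<open>Absorbs the \<open>9 ^ d\<close> points of the net into \<open>exp (9 * d / 4)\<close>;
  this is where the \<open>9 d\<close> of the theorem comes from.\<close>

lemma nine_le_exp: "9 \<le> exp (9/4 :: real)"
proof -
  have "1 + 1/4 + (1/4)^2 / 2 \<le> exp (1/4 :: real)"
    by (rule exp_lower_Taylor_quadratic) simp
  then have "(1 + 1/4 + (1/4)^2 / 2) ^ 9 \<le> exp (1/4 :: real) ^ 9"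
    by (intro power_mono) auto
  also have "exp (1/4 :: real) ^ 9 = exp (9/4)"
    by (simp add: exp_of_nat_mult[symmetric])
  finally show ?thesis by (rule order_trans[rotated]) (simp add: power2_eq_square eval_nat_numeral)
qed

text \<open>With \<open>e = F - g\<close>, the centred square is the centred \<open>e^2\<close> plus
  \<open>2 * g\<close> times the centred \<open>e\<close>. On the good event the first part is at
  most \<open>4 * r^2 + r^2\<close> and the second at most \<open>2 * K * (2 * r + r)\<close>. The
  centre \<open>g\<close> need not be the mean of \<open>F\<close>.\<close>

lemma (in prob_space) square_deviation:
  fixes F :: "'a \<Rightarrow> real"
  assumes [measurable]: "F \<in> borel_measurable M"
    and int: "integrable M (\<lambda>w. (F w - g)^2)"
    and second: "expectation (\<lambda>w. (F w - g)^2) \<le> r^2" and r: "0 \<le> r"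
    and g: "0 \<le> g" "g \<le> K"
  shows "integrable M (\<lambda>w. (F w)^2)"
    and "\<bar>F x - g\<bar> \<le> 2 * r \<Longrightarrow> \<bar>(F x)^2 - expectation (\<lambda>w. (F w)^2)\<bar> \<le> 5 * r^2 + 6 * K * r"
proof -
  define e where "e w = F w - g" for w
  have [measurable]: "e \<in> borel_measurable M" unfolding e_def by measurable
  have ie2: "integrable M (\<lambda>w. (e w)^2)" using int by (simp add: e_def)
  have ie: "integrable M e" by (rule square_integrable_imp_integrable) (use ie2 in auto)
  have eq: "(F w)^2 = (e w)^2 + 2 * g * e w + g^2" for w
    by (simp add: e_def power2_eq_square algebra_simps)
  show "integrable M (\<lambda>w. (F w)^2)"
    unfolding eq using ie ie2 by simp
  have E: "expectation (\<lambda>w. (F w)^2) = expectation (\<lambda>w. (e w)^2) + 2 * g * expectation e + g^2"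
    unfolding eq using ie ie2 by (simp add: prob_space)
  have "(expectation e)^2 \<le> r^2"
    using square_expectation_le[OF _ ie2] order_trans[OF _ second[folded e_def]] by simp
  then have Ee: "\<bar>expectation e\<bar> \<le> r" using r by (simp add: abs_le_square_iff[symmetric])
  have Ee2: "0 \<le> expectation (\<lambda>w. (e w)^2)" "expectation (\<lambda>w. (e w)^2) \<le> r^2"
    using second by (auto simp: e_def)
  assume "\<bar>F x - g\<bar> \<le> 2 * r"
  then have ex: "\<bar>e x\<bar> \<le> 2 * r" by (simp add: e_def)
  then have "\<bar>e x\<bar>^2 \<le> (2 * r)^2" by (intro power_mono) auto
  then have ex2: "(e x)^2 \<le> 4 * r^2" by (simp add: power_mult_distrib)
  have "\<bar>2 * g * (e x - expectation e)\<bar> = 2 * g * \<bar>e x - expectation e\<bar>"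
    using g by (simp add: abs_mult)
  also have "\<dots> \<le> 2 * K * (3 * r)"
    using g r Ee ex by (intro mult_mono) auto
  finally have "\<bar>2 * g * (e x - expectation e)\<bar> \<le> 6 * K * r" by simp
  moreover have "\<bar>(e x)^2 - expectation (\<lambda>w. (e w)^2)\<bar> \<le> 5 * r^2"
    using Ee2 ex2 zero_le_power2[of "e x"] zero_le_power2[of r] by linarith
  moreover have "(F x)^2 - expectation (\<lambda>w. (F w)^2) = ((e x)^2 - expectation (\<lambda>w. (e w)^2)) + 2 * g * (e x - expectation e)"
    unfolding E unfolding eq by (simp add: algebra_simps)
  ultimately show "\<bar>(F x)^2 - expectation (\<lambda>w. (F w)^2)\<bar> \<le> 5 * r^2 + 6 * K * r"
    by linarith
qed

context gaussian_chain
begin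

text \<open>\<open>F - g\<close> is split at \<open>G\<close>, the chain started at \<open>a\<close>
  with the same noise. Gaussian concentration handles \<open>G - g\<close>; the coupling reduces
  \<open>F - G\<close> to \<open>norm (X0 - a)\<close>, which the net controls. Only unions over the
  net are taken, so the bad set is common to all \<open>u\<close>.\<close>

lemma quadratic_form_deviation:
  fixes X0 :: "'a \<Rightarrow> real^'d" and a p :: "real^'d" and S :: "(real^'d) set" and m n :: nat
    and \<alpha> \<eta> \<kappa> \<delta> :: real
  assumes \<alpha>: "0 < \<alpha>" and \<eta>: "0 < \<eta>" and \<alpha>\<eta>: "\<alpha> * \<eta> < 1" and rho_eq: "\<rho> = 1 - \<alpha> * \<eta>" and s2: "s^2 = 2 * \<eta>"
    and fixp: "T p = p" and n: "1 \<le> n"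
    and X0[measurable]: "X0 \<in> borel_measurable M"
    and X0_sub: "\<And>u. norm u \<le> 1 \<Longrightarrow> subgaussian M (\<lambda>w. u \<bullet> (X0 w - a)) \<kappa>"
    and \<kappa>: "0 < \<kappa>" "\<kappa> * \<rho> ^ (m+1) \<le> \<eta>"
    and burn: "4 * ((norm (a - p))^2 + real CARD('d) / \<alpha>) * \<rho> ^ (m+1) \<le> \<eta> * real n"
    and \<delta>: "0 < \<delta>" "\<delta> \<le> 1"
    and S: "finite S" "S \<subseteq> sphere 0 1" "card S \<le> 9 ^ CARD('d)" "\<And>x. norm x = 1 \<Longrightarrow> \<exists>u\<in>S. norm (x - u) \<le> 1/4"
  defines "t \<equiv> (9 * real CARD('d) + 4 * ln (1 / \<delta>)) / (\<alpha> * \<eta> * real n)"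
    and "F \<equiv> \<lambda>u w. spread (\<lambda>i. u \<bullet> X (X0 w) i w) {m+1..m+n} / sqrt (real n)"
  shows "\<exists>B. B \<in> events \<and> prob B \<le> 3 * \<delta> \<and>
     (\<forall>u\<in>S. \<forall>w\<in>space M - B. \<bar>(F u w)^2 - expectation (\<lambda>w. (F u w)^2)\<bar> \<le> 5 * t / \<alpha> + 18 * sqrt t / \<alpha>)"
proof -
  let ?d = "real CARD('d)"
  define q where "q = 9 * ?d + 4 * ln (1 / \<delta>)"
  define \<tau> where "\<tau> = 1 / (\<alpha> * \<eta> * real n)"
  define r where "r = sqrt (t / \<alpha>)"
  define L where "L = (\<rho> ^ (m+1))^2 / ((1 - \<rho>) * real n)"
  define R where "R w = norm (X0 w - a)" for w
  define G where "G u w = spread (\<lambda>i. u \<bullet> X a i w) {m+1..m+n} / sqrt (real n)" for u w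
  define g where "g u = expectation (G u)" for u
  \<comment> \<open>Both thresholds \<open>s0\<close> and \<open>s1\<close> are chosen so that the
    sub-Gaussian tail is exactly \<open>exp (- q / 4)\<close>, for the proxies
    \<open>\<kappa>\<close> and \<open>4 * \<tau> / \<alpha>\<close>.\<close>
  define s0 where "s0 = sqrt (\<kappa> * q / 2)"
  define s1 where "s1 = sqrt 2 * r"
  have d1: "1 \<le> ?d" using zero_less_card_finite[where 'a='d] by linarith
  have lnd: "0 \<le> ln (1 / \<delta>)" using \<delta> by simp
  have q9: "9 * ?d \<le> q" using lnd by (simp add: q_def)
  have q0: "0 < q" using q9 d1 by linarith
  have \<tau>0: "0 < \<tau>" using \<alpha> \<eta> n by (simp add: \<tau>_def)
  have t_eq: "t = q * \<tau>" by (simp add: t_def q_def \<tau>_def)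
  have t0: "0 < t" using q0 \<tau>0 by (simp add: t_eq)
  have r2: "r^2 = q * \<tau> / \<alpha>" using t0 \<alpha> by (simp add: r_def t_eq)
  have r0: "0 < r" using t0 \<alpha> by (simp add: r_def)
  have s: "0 < s" using s2 \<eta> s_nonneg by (cases "s = 0") auto
  have om: "1 - \<rho> = \<alpha> * \<eta>" by (simp add: rho_eq)
  have L0: "0 \<le> L" using rho by (simp add: L_def)
  have C1: "2 * (s^2 / ((1 - \<rho>)^2 * real n)) = 4 * \<tau> / \<alpha>"
    using \<alpha> \<eta> n unfolding om s2 \<tau>_def by (simp add: field_simps power2_eq_square)
  \<comment> \<open>\<open>\<alpha> * \<eta> * (1 - \<alpha> * \<eta>) \<le> 1/4\<close>, from a
    completed square.\<close>
  have \<eta>\<rho>: "\<eta> * \<rho> \<le> 1 / (4 * \<alpha>)"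
  proof -
    have "0 \<le> (2 * (\<alpha> * \<eta>) - 1)^2" by simp
    then have "\<eta> * \<rho> * (4 * \<alpha>) \<le> 1" unfolding rho_eq by (simp add: power2_eq_square algebra_simps)
    then show ?thesis using \<alpha> by (simp add: pos_le_divide_eq)
  qed
  \<comment> \<open>Of the two factors \<open>\<rho> ^ (m+1)\<close> in \<open>L\<close> one meets
    \<open>\<kappa>\<close> in the burn-in condition; the other is bounded by a single
    \<open>\<rho>\<close>, which supplies the \<open>1/4\<close>.\<close>
  have L\<kappa>: "L * \<kappa> \<le> \<tau> / (4 * \<alpha>)"
  proof -
    have "L * \<kappa> = \<tau> * (\<rho> ^ (m+1) * (\<kappa> * \<rho> ^ (m+1)))"
      unfolding L_def om \<tau>_def by (simp add: power2_eq_square)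
    also have "\<dots> \<le> \<tau> * (\<rho> ^ 1 * \<eta>)"
      using \<tau>0 \<kappa> rho \<eta> by (intro mult_left_mono mult_mono power_decreasing) auto
    also have "\<dots> \<le> \<tau> * (1 / (4 * \<alpha>))"
      using \<eta>\<rho> \<tau>0 by (intro mult_left_mono) (auto simp: mult.commute)
    finally show ?thesis by simp
  qed
  have [measurable]: "R \<in> borel_measurable M" unfolding R_def by measurable
  have R2: "integrable M (\<lambda>w. (R w)^2)" "expectation (\<lambda>w. (R w)^2) \<le> ?d * \<kappa>"
    using subgaussian_norm_sq[OF X0_sub \<kappa>(1)] by (auto simp: R_def)
  have G_sub: "subgaussian M (\<lambda>w. G u w - g u) (4 * \<tau> / \<alpha>)" and G_int: "integrable M (G u)" if "u \<in> S" for u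
    using that S(2) spread_subgaussian[OF _ n, where u = u and m = m and a = a] unfolding C1 by (auto simp: G_def[abs_def] g_def)
  have [measurable]: "G u \<in> borel_measurable M" for u
    unfolding G_def spread_def L2_set_def by measurable
  note [measurable] = X_random_init_measurable[OF X0]
  have [measurable]: "F u \<in> borel_measurable M" for u
    unfolding F_def spread_def L2_set_def by measurable
  have g_nonneg: "0 \<le> g u" for u
    unfolding g_def G_def by (intro Bochner_Integration.integral_nonneg) (simp add: spread_nonneg)
  \<comment> \<open>The variances contribute \<open>4 / \<alpha>\<close> and the burn-in condition
    reduces the drift to \<open>1 / \<alpha>\<close>; 3 is a convenient bound for
    \<open>sqrt 5\<close>.\<close>
  have g_le: "g u \<le> 3 / sqrt \<alpha>" if "u \<in> S" for u
  proof -
    have "norm u \<le> 1" using that S(2) by auto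
    from spread_mean_sq_le[OF fixp this n s, where a = a and m = m]
    have "(g u)^2 \<le> 2 * (s^2 / (1 - \<rho>)) + (4 * (norm (a - p))^2 + 2 * (s^2 / (1 - \<rho>) * ?d)) * L"
      unfolding g_def G_def[abs_def] L_def .
    also have "s^2 / (1 - \<rho>) = 2 / \<alpha>" using \<alpha> \<eta> unfolding s2 om by (simp add: field_simps)
    also have "(4 * (norm (a - p))^2 + 2 * (2 / \<alpha> * ?d)) * L = (4 * ((norm (a - p))^2 + ?d / \<alpha>) * \<rho> ^ (m+1)) * (\<rho> ^ (m+1) * \<tau>)"
      unfolding L_def om \<tau>_def by (simp add: power2_eq_square algebra_simps add_divide_distrib)
    also have "2 * (2 / \<alpha>) + \<dots> \<le> 2 * (2 / \<alpha>) + (\<eta> * real n) * (1 * \<tau>)"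
    proof (intro add_left_mono mult_mono[OF burn])
      show "\<rho> ^ (m+1) * \<tau> \<le> 1 * \<tau>" using rho \<tau>0 by (intro mult_right_mono power_le_one) auto
    qed (use \<tau>0 rho \<eta> in auto)
    also have "\<dots> = 5 / \<alpha>" using \<alpha> \<eta> n by (simp add: \<tau>_def field_simps)
    also have "\<dots> \<le> (3 / sqrt \<alpha>)^2" using \<alpha> by (simp add: power_divide divide_right_mono)
    finally show ?thesis by (rule power2_le_imp_le) (use \<alpha> in simp)
  qed
  have FG: "(F u w - G u w)^2 \<le> L * (R w)^2" if "u \<in> S" for u w
    unfolding F_def G_def L_def R_def using that S(2) by (intro spread_diff_init n) auto
  \<comment> \<open>In units of \<open>\<tau> / \<alpha>\<close> the starting point contributes
    \<open>d / 2\<close> and the noise 8, hence at most \<open>17/2 * d\<close>, which lies below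
    the \<open>9 * d\<close> in \<open>q\<close>.\<close>
  have second: "integrable M (\<lambda>w. (F u w - g u)^2)" "expectation (\<lambda>w. (F u w - g u)^2) \<le> r^2"
    if u: "u \<in> S" for u
  proof -
    have le: "(F u w - g u)^2 \<le> 2 * (L * (R w)^2) + 2 * (G u w - g u)^2" for w
      using norm_diff_sq_le[of "F u w" "g u" "G u w"] FG[OF u, of w] by simp
    have i: "integrable M (\<lambda>w. (G u w - g u)^2)"
      by (rule subgaussian_integrable_power2[OF G_sub[OF u]])
    have i': "integrable M (\<lambda>w. 2 * (L * (R w)^2) + 2 * (G u w - g u)^2)"
      using i R2(1) by simp
    show int: "integrable M (\<lambda>w. (F u w - g u)^2)"
      by (rule integrable_pointwise_bound[OF i']) (use le in auto)
    have "expectation (\<lambda>w. (F u w - g u)^2) \<le> expectation (\<lambda>w. 2 * (L * (R w)^2) + 2 * (G u w - g u)^2)"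
      by (intro integral_mono int i' le)
    also have "\<dots> = 2 * (L * expectation (\<lambda>w. (R w)^2)) + 2 * expectation (\<lambda>w. (G u w - g u)^2)"
      using i R2(1) by simp
    also have "\<dots> \<le> 2 * (L * (?d * \<kappa>)) + 2 * (4 * \<tau> / \<alpha>)"
      using \<alpha> \<tau>0 by (intro add_mono mult_left_mono R2 L0 subgaussian_second_moment[OF G_sub[OF u]]) auto
    also have "\<dots> = 2 * ?d * (L * \<kappa>) + 8 * (\<tau> / \<alpha>)" by simp
    also have "\<dots> \<le> 2 * ?d * (\<tau> / (4 * \<alpha>)) + 8 * ?d * (\<tau> / \<alpha>)"
      using L\<kappa> d1 \<tau>0 \<alpha> by (intro add_mono mult_left_mono mult_right_mono) auto
    also have "\<dots> = (17/2 * ?d) * (\<tau> / \<alpha>)" by (simp add: field_simps)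
    also have "\<dots> \<le> q * (\<tau> / \<alpha>)" using q9 d1 \<tau>0 \<alpha> by (intro mult_right_mono) auto
    finally show "expectation (\<lambda>w. (F u w - g u)^2) \<le> r^2" by (simp add: r2)
  qed
  define B1 where "B1 u = {w \<in> space M. s1 \<le> G u w - g u}" for u
  define B2 where "B2 u = {w \<in> space M. s1 \<le> - (G u w - g u)}" for u
  define B3 where "B3 u = {w \<in> space M. s0 \<le> u \<bullet> (X0 w - a)}" for u
  define B where "B = (\<Union>u\<in>S. (B1 u \<union> B2 u) \<union> B3 u)"
  have [measurable]: "B1 u \<in> events" "B2 u \<in> events" "B3 u \<in> events" for u
    unfolding B1_def B2_def B3_def by measurable
  have B: "B \<in> events" unfolding B_def using S(1) by (intro sets.finite_UN) auto
  have pB: "prob (B1 u) \<le> exp (- q / 4)" "prob (B2 u) \<le> exp (- q / 4)" "prob (B3 u) \<le> exp (- q / 4)" if u: "u \<in> S" for u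
  proof -
    have s1: "0 \<le> s1" "- s1\<^sup>2 / (2 * (4 * \<tau> / \<alpha>)) = - q / 4"
      using r0 \<tau>0 \<alpha> by (auto simp: s1_def power_mult_distrib r2)
    have s0: "0 \<le> s0" "- s0\<^sup>2 / (2 * \<kappa>) = - q / 4"
      using q0 \<kappa> by (auto simp: s0_def)
    have pos: "0 < 4 * \<tau> / \<alpha>" using \<tau>0 \<alpha> by simp
    show "prob (B1 u) \<le> exp (- q / 4)"
      using subgaussian_tail[OF G_sub[OF u] pos s1(1)] unfolding B1_def s1(2) .
    show "prob (B2 u) \<le> exp (- q / 4)"
      using subgaussian_tail[OF subgaussian_uminus[OF G_sub[OF u]] pos s1(1)] unfolding B2_def s1(2) .
    have "norm u \<le> 1" using u S(2) by auto
    from subgaussian_tail[OF X0_sub[OF this] \<kappa>(1) s0(1)] show "prob (B3 u) \<le> exp (- q / 4)"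
      unfolding B3_def s0(2) .
  qed
  have "prob B \<le> (\<Sum>u\<in>S. prob ((B1 u \<union> B2 u) \<union> B3 u))"
    unfolding B_def by (intro finite_measure_subadditive_finite S(1)) auto
  also have "\<dots> \<le> (\<Sum>u\<in>S. 3 * exp (- q / 4))"
  proof (rule sum_mono)
    fix u assume u: "u \<in> S"
    have "prob ((B1 u \<union> B2 u) \<union> B3 u) \<le> prob (B1 u \<union> B2 u) + prob (B3 u)"
      by (rule measure_Un_le) auto
    also have "prob (B1 u \<union> B2 u) \<le> prob (B1 u) + prob (B2 u)"
      by (rule measure_Un_le) auto
    finally show "prob ((B1 u \<union> B2 u) \<union> B3 u) \<le> 3 * exp (- q / 4)"
      using pB[OF u] by linarith
  qed
  also have "\<dots> = 3 * (real (card S) * exp (- q / 4))" by simp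
  also have "\<dots> \<le> 3 * (9 ^ CARD('d) * exp (- q / 4))"
  proof -
    have "real (card S) \<le> real (9 ^ CARD('d))" using S(3) by (simp only: of_nat_le_iff)
    then show ?thesis by (intro mult_left_mono mult_right_mono) auto
  qed
  also have "9 ^ CARD('d) * exp (- q / 4) \<le> exp (9/4) ^ CARD('d) * exp (- q / 4)"
    using nine_le_exp by (intro mult_right_mono power_mono) auto
  also have "\<dots> = exp (- ln (1 / \<delta>))"
    by (simp add: q_def exp_of_nat_mult[symmetric] exp_add[symmetric] field_simps)
  also have "\<dots> = \<delta>" using \<delta> by (simp add: ln_div)
  finally have PB: "prob B \<le> 3 * \<delta>" by simp
  have good: "\<bar>(F u w)^2 - expectation (\<lambda>w. (F u w)^2)\<bar> \<le> 5 * t / \<alpha> + 18 * sqrt t / \<alpha>"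
    if u: "u \<in> S" and w: "w \<in> space M - B" for u w
  proof -
    have "\<bar>G u w - g u\<bar> \<le> s1" using u w by (fastforce simp: B_def B1_def B2_def)
    \<comment> \<open>The allowance \<open>2 * r\<close> is shared as \<open>3/2 * r\<close> for the
      noise and \<open>r / 2\<close> for the starting point: \<open>(4/3)^2 / 2\<close> times the
      \<open>1/4\<close> from \<open>L\<kappa>\<close> is \<open>2/9\<close>, below
      \<open>1/4\<close>.\<close>
    moreover have "\<bar>F u w - G u w\<bar> \<le> r / 2"
    proof -
      have s00: "0 \<le> s0" using q0 \<kappa> by (simp add: s0_def)
      have "R w \<le> 4/3 * s0"
        unfolding R_def
      proof (rule norm_le_net[OF S(2,4) _ s00])
        fix v assume "v \<in> S"
        then show "v \<bullet> (X0 w - a) \<le> s0" using w by (fastforce simp: B_def B3_def)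
      qed
      then have "(R w)^2 \<le> (4/3 * s0)^2" by (intro power_mono) (auto simp: R_def)
      also have "\<dots> = 8/9 * (\<kappa> * q)" using \<kappa> q0 by (simp add: s0_def power_mult_distrib power2_eq_square)
      finally have "L * (R w)^2 \<le> L * (8/9 * (\<kappa> * q))" by (intro mult_left_mono L0)
      also have "\<dots> = 8/9 * q * (L * \<kappa>)" by simp
      also have "\<dots> \<le> 8/9 * q * (\<tau> / (4 * \<alpha>))" using q0 L\<kappa> by (intro mult_left_mono) auto
      also have "\<dots> = 2/9 * r^2" by (simp add: r2)
      also have "\<dots> \<le> (r / 2)^2" by (simp add: power_divide)
      finally have "(F u w - G u w)^2 \<le> (r / 2)^2" using FG[OF u, of w] by linarith
      then show ?thesis using r0 by (simp add: abs_le_square_iff[symmetric])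
    qed
    moreover have "s1 \<le> 3/2 * r"
    proof -
      have "sqrt 2 \<le> 3/2" by (rule real_le_lsqrt) (auto simp: power2_eq_square)
      then show ?thesis using r0 unfolding s1_def by (intro mult_right_mono) auto
    qed
    ultimately have "\<bar>F u w - g u\<bar> \<le> 2 * r" by linarith
    from square_deviation(2)[OF _ second[OF u] _ g_nonneg g_le[OF u] this] r0
    have "\<bar>(F u w)^2 - expectation (\<lambda>w. (F u w)^2)\<bar> \<le> 5 * r^2 + 6 * (3 / sqrt \<alpha>) * r" by simp
    also have "\<dots> = 5 * t / \<alpha> + 18 * sqrt t / \<alpha>"
    proof -
      have "sqrt \<alpha> * sqrt \<alpha> = \<alpha>" using \<alpha> by simp
      then have "1 / sqrt \<alpha> * r = sqrt t / \<alpha>" by (simp add: r_def real_sqrt_divide)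
      then have "6 * (3 / sqrt \<alpha>) * r = 18 * sqrt t / \<alpha>" by simp
      then show ?thesis by (simp add: r2 t_eq)
    qed
    finally show ?thesis .
  qed
  show ?thesis using B PB good by blast
qed

end

section \<open>The sample covariance matrix\<close>

text \<open>\<open>norm\<close> on matrices is the Frobenius norm, the one in which Bochner
  integrability of the covariance is checked.\<close>

lemma norm_outer: "norm (outer x y) = norm x * norm y"
proof -
  have "norm (outer x y) = L2_set (\<lambda>j. norm (outer x y $ j)) UNIV"
    by (rule norm_vec_def)
  also have "\<dots> = L2_set (\<lambda>j. norm (x $ j) * norm y) UNIV"
  proof (rule L2_set_cong[OF refl])
    fix j
    have "outer x y $ j = x $ j *\<^sub>R y" by (simp add: outer_def vec_eq_iff)
    then show "norm (outer x y $ j) = norm (x $ j) * norm y" by simp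
  qed
  also have "\<dots> = L2_set (\<lambda>j. norm (x $ j)) UNIV * norm y"
    by (rule L2_set_left_distrib[symmetric]) simp
  also have "\<dots> = norm x * norm y" by (simp only: norm_vec_def)
  finally show ?thesis .
qed

lemma outer_measurable[measurable]:
  assumes [measurable]: "X \<in> borel_measurable M" "Y \<in> borel_measurable M"
  shows "(\<lambda>w. outer (X w) (Y w) :: real^'d^'d) \<in> borel_measurable M"
  by (rule borel_measurable_continuous_Pair[OF assms]) (unfold outer_def, intro continuous_intros)

lemma integrable_outer:
  fixes X :: "'a \<Rightarrow> real^'d"
  assumes [measurable]: "X \<in> borel_measurable M" "Y \<in> borel_measurable M"
    and X: "integrable M (\<lambda>w. (norm (X w))^2)" and Y: "integrable M (\<lambda>w. (norm (Y w))^2)"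
  shows "integrable M (\<lambda>w. outer (X w) (Y w))"
proof (rule integrable_pointwise_bound[OF Bochner_Integration.integrable_add[OF X Y]])
  fix w
  have "2 * (norm (X w) * norm (Y w)) \<le> (norm (X w))^2 + (norm (Y w))^2"
    using sum_squares_bound[of "norm (X w)" "norm (Y w)"] by simp
  moreover have "0 \<le> norm (X w) * norm (Y w)" by simp
  ultimately show "norm (outer (X w) (Y w)) \<le> (norm (X w))^2 + (norm (Y w))^2"
    unfolding norm_outer by linarith
qed measurable

lemma integrable_norm_sq_sum:
  fixes X :: "'i \<Rightarrow> 'a \<Rightarrow> real^'d"
  assumes [measurable]: "\<And>i. i \<in> I \<Longrightarrow> X i \<in> borel_measurable M"
    and X: "\<And>i. i \<in> I \<Longrightarrow> integrable M (\<lambda>w. (norm (X i w))^2)"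
  shows "integrable M (\<lambda>w. (norm (\<Sum>i\<in>I. X i w))^2)"
proof (rule integrable_pointwise_bound)
  show "integrable M (\<lambda>w. (\<Sum>i\<in>I. (norm (X i w))^2) * real (card I))"
    by (intro integrable_mult_left Bochner_Integration.integrable_sum X)
  fix w
  have "(norm (\<Sum>i\<in>I. X i w))^2 \<le> (\<Sum>i\<in>I. norm (X i w))^2"
    by (intro power_mono norm_sum) simp
  also have "\<dots> \<le> (\<Sum>i\<in>I. (norm (X i w))^2) * real (card I)"
    by (rule sum_squared_le_sum_of_squares)
  finally show "norm ((norm (\<Sum>i\<in>I. X i w))^2) \<le> (\<Sum>i\<in>I. (norm (X i w))^2) * real (card I)"
    by simp
qed measurable

text \<open>Guarantees that the matrix expectation in the theorem is a genuine one, not the default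
  value 0, and lets it commute with quadratic forms.\<close>

lemma integrable_sample_cov:
  fixes X :: "nat \<Rightarrow> 'a \<Rightarrow> real^'d"
  assumes [measurable]: "\<And>i. X i \<in> borel_measurable M"
    and X: "\<And>i. integrable M (\<lambda>w. (norm (X i w))^2)"
  shows "integrable M (\<lambda>w. sample_cov (\<lambda>i. X i w) m n)"
proof -
  define A where "A w = (1 / real n) *\<^sub>R (\<Sum>i\<in>{m+1..m+n}. X i w)" for w
  have [measurable]: "A \<in> borel_measurable M" unfolding A_def by measurable
  have "integrable M (\<lambda>w. (norm (\<Sum>i\<in>{m+1..m+n}. X i w))^2)"
    by (rule integrable_norm_sq_sum) (rule assms)+
  then have "integrable M (\<lambda>w. (norm (A w))^2)"
    unfolding A_def norm_scaleR power_mult_distrib by (rule integrable_mult_right)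
  then have "integrable M (\<lambda>w. outer (A w) (A w))"
    by (intro integrable_outer) auto
  moreover have "integrable M (\<lambda>w. outer (X i w) (X i w))" for i
    by (rule integrable_outer[OF assms(1) assms(1) X X])
  then have "integrable M (\<lambda>w. (1 / real n) *\<^sub>R (\<Sum>i\<in>{m+1..m+n}. outer (X i w) (X i w)))"
    by (rule integrable_scaleR_right[OF Bochner_Integration.integrable_sum])
  ultimately show ?thesis
    unfolding sample_cov_def Let_def A_def by (rule Bochner_Integration.integrable_diff[rotated])
qed

lemma inner_expectation_matrix:
  fixes S :: "'a \<Rightarrow> real^'d^'d"
  assumes "integrable M S"
  shows "u \<bullet> ((\<integral>w. S w \<partial>M) *v u) = (\<integral>w. u \<bullet> (S w *v u) \<partial>M)"
proof -
  have "linear (\<lambda>A :: real^'d^'d. u \<bullet> (A *v u))"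
    by (rule linearI) (simp_all only: matrix_vector_mult_add_rdistrib inner_add_right
        scaleR_matrix_vector_assoc[symmetric] inner_scaleR_right real_scaleR_def)
  then have "bounded_linear (\<lambda>A :: real^'d^'d. u \<bullet> (A *v u))" by (rule linear_conv_bounded_linear[THEN iffD1])
  from integral_bounded_linear[OF this assms] show ?thesis by simp
qed

lemma transpose_expectation:
  fixes S :: "'a \<Rightarrow> real^'d^'d"
  assumes "integrable M S" and symmetric: "\<And>w. transpose (S w) = S w"
  shows "transpose (\<integral>w. S w \<partial>M) = (\<integral>w. S w \<partial>M)"
proof -
  have "linear (transpose :: real^'d^'d \<Rightarrow> _)"
    by (rule linearI) (simp_all add: transpose_def vec_eq_iff)
  then have "bounded_linear (transpose :: real^'d^'d \<Rightarrow> _)" by (rule linear_conv_bounded_linear[THEN iffD1])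
  from integral_bounded_linear[OF this assms(1)] show ?thesis unfolding symmetric by (rule sym)
qed

text \<open>Exponentiated form of the burn-in conditions. The \<open>- 1\<close> there matches the
  exponent \<open>m+1\<close>, the index of the first retained iterate.\<close>

lemma power_le_of_log_ratio_le:
  fixes \<rho> A :: real
  assumes "0 < \<rho>" "\<rho> < 1" "0 < A" and m: "ln A / ln (1 / \<rho>) - 1 \<le> real m"
  shows "A * \<rho> ^ (m+1) \<le> 1"
proof -
  have l: "0 < ln (1 / \<rho>)" using assms by simp
  have "ln A / ln (1 / \<rho>) \<le> real (m+1)" using m by simp
  then have "ln A \<le> real (m+1) * ln (1 / \<rho>)" using l by (simp only: pos_divide_le_eq)
  also have "\<dots> = - ln (\<rho> ^ (m+1))" using assms by (simp only: ln_realpow ln_div) simp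
  finally have "ln (A * \<rho> ^ (m+1)) \<le> 0" using assms by (simp add: ln_mult)
  then show ?thesis using assms ln_le_zero_iff[of "A * \<rho> ^ (m+1)"] by simp
qed

text \<open>The two entries of the maximum cross at \<open>sqrt t = 8\<close>: below, the left side
  is at most \<open>116 * sqrt t / \<alpha>\<close>, against \<open>128\<close>; above, at most
  \<open>14.5 * t / \<alpha>\<close>, against \<open>16\<close>. The leading 2 is the loss from the
  net.\<close>

lemma deviation_bound_le_max:
  fixes t \<alpha> :: real
  assumes "0 < \<alpha>" "0 \<le> t"
  shows "2 * (5 * t / \<alpha> + 18 * sqrt t / \<alpha>) \<le> 16 / \<alpha> * max (8 * sqrt t) t"
proof -
  have t: "sqrt t * sqrt t = t" using assms by simp
  have "10 * t + 36 * sqrt t \<le> 16 * max (8 * sqrt t) t"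
  proof (cases "sqrt t \<le> 8")
    case True
    then have "sqrt t * sqrt t \<le> 8 * sqrt t" using assms by (intro mult_right_mono) auto
    then show ?thesis using assms unfolding t by (simp add: max_def)
  next
    case False
    then have "8 * sqrt t \<le> sqrt t * sqrt t" using assms by (intro mult_right_mono) auto
    then show ?thesis using assms unfolding t by (simp add: max_def)
  qed
  then have "(10 * t + 36 * sqrt t) / \<alpha> \<le> 16 * max (8 * sqrt t) t / \<alpha>"
    using assms by (intro divide_right_mono) auto
  then show ?thesis by (simp add: add_divide_distrib)
qed

theorem theorem2p3:
  fixes M :: "'a measure"
    and f :: "real^'d \<Rightarrow> real" and gradf :: "real^'d \<Rightarrow> real^'d"
    and H :: "real^'d \<Rightarrow> real^'d^'d"
    and \<alpha> \<beta> \<eta> \<kappa>0 \<delta> :: real and xs :: "real^'d" and m n :: nat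
    and X0 :: "'a \<Rightarrow> real^'d" and Z :: "nat \<Rightarrow> 'a \<Rightarrow> real^'d"
  assumes P: "prob_space M"
    and grad_f: "\<And>x. (f has_derivative (\<lambda>h. gradf x \<bullet> h)) (at x)"
    and hess_f: "\<And>x. (gradf has_derivative (\<lambda>h. H x *v h)) (at x)"
    and hess_cont: "continuous_on UNIV H"
    and alpha_pos: "0 < \<alpha>" and alpha_beta: "\<alpha> \<le> \<beta>"
    and hess_bounds: "\<And>x h. \<alpha> * (norm h)^2 \<le> h \<bullet> (H x *v h) \<and> h \<bullet> (H x *v h) \<le> \<beta> * (norm h)^2"
    and argmin: "\<And>x. f xs \<le> f x"
    and eta: "0 < \<eta>" "\<eta> < 1 / \<beta>"
    and n_pos: "1 \<le> n"
    and X0_meas: "X0 \<in> borel_measurable M"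
    and kappa0: "0 \<le> \<kappa>0"
    and LSI: "log_sobolev (distr M borel X0) \<kappa>0"
    and Z_gauss: "\<And>i. 1 \<le> i \<Longrightarrow> distributed M lborel (Z i) (\<lambda>x. ennreal (std_gauss_density x))"
    and indep: "prob_space.indep_vars M (\<lambda>_. borel)
                  (\<lambda>j. case j of None \<Rightarrow> X0 | Some i \<Rightarrow> Z i) (insert None (Some ` {1..}))"
    and m1: "0 < \<kappa>0 \<Longrightarrow> real m \<ge> ln (\<kappa>0 / \<eta>) / ln (1 / (1 - \<alpha> * \<eta>)) - 1"
    and m2: "real m \<ge> ln (4 * (prob_space.expectation M (\<lambda>\<omega>. (norm (X0 \<omega> - xs))^2)
                                  + real CARD('d) / \<alpha>) / (\<eta> * real n))
                        / ln (1 / (1 - \<alpha> * \<eta>)) - 1"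
    and delta: "0 < \<delta>"
  shows "measure M {\<omega> \<in> space M.
           onorm (\<lambda>v. (sample_cov (\<lambda>i. ula gradf \<eta> X0 Z i \<omega>) m n
                        - prob_space.expectation M (\<lambda>\<omega>'. sample_cov (\<lambda>i. ula gradf \<eta> X0 Z i \<omega>') m n)) *v v)
           \<le> 16 / \<alpha> * max (8 * sqrt ((9 * real CARD('d) + 4 * ln (1 / \<delta>)) / (\<alpha> * \<eta> * real n)))
                            ((9 * real CARD('d) + 4 * ln (1 / \<delta>)) / (\<alpha> * \<eta> * real n))}
         \<ge> 1 - 4 * \<delta>"
proof (cases "1 - 4 * \<delta> \<le> 0")
  case True
  then show ?thesis by (rule order_trans) simp
next
  \<comment> \<open>Now \<open>\<delta> < 1/4\<close>, so \<open>ln (1 / \<delta>)\<close> is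
    positive and the bound has a nonnegative radicand.\<close>
  case False
  interpret prob_space M by (rule P)
  define s where "s = sqrt (2 * \<eta>)"
  define \<rho> where "\<rho> = 1 - \<alpha> * \<eta>"
  define T where "T x = x - \<eta> *\<^sub>R gradf x" for x
  have \<eta>\<beta>: "\<eta> * \<beta> < 1" using eta alpha_pos alpha_beta by (simp add: less_divide_eq)
  have \<alpha>\<eta>: "\<alpha> * \<eta> < 1"
    using mult_left_mono[OF alpha_beta, of \<eta>] \<eta>\<beta> eta(1) by (simp only: mult.commute[of \<alpha>]) linarith
  have \<alpha>\<eta>0: "0 < \<alpha> * \<eta>" using alpha_pos eta by simp
  have rho: "0 < \<rho>" "\<rho> < 1" using \<alpha>\<eta> \<alpha>\<eta>0 by (auto simp: \<rho>_def)
  have "indep_vars (\<lambda>_. borel) (\<lambda>j. case j of None \<Rightarrow> X0 | Some i \<Rightarrow> Z i) (Some ` {1..})"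
    by (rule indep_vars_subset[OF indep]) auto
  then have "indep_vars (\<lambda>i. borel) (\<lambda>i. case Some i of None \<Rightarrow> X0 | Some i \<Rightarrow> Z i) {1..}"
    by (rule indep_vars_reindex) simp
  then have Z_indep: "indep_vars (\<lambda>_. borel) Z {1..}" by simp
  interpret gaussian_chain M Z T \<rho> s
  proof unfold_locales
    show "norm (T x - T y) \<le> \<rho> * norm (x - y)" for x y
      unfolding T_def \<rho>_def
      using \<eta>\<beta> \<alpha>\<eta> eta by (intro gradient_step_contraction[OF grad_f hess_f hess_bounds]) (auto simp: mult.commute)
  qed (use rho Z_gauss Z_indep eta in \<open>auto simp: s_def\<close>)
  have "(\<lambda>h. gradf xs \<bullet> h) = (\<lambda>h. 0)"
    using argmin by (intro has_derivative_local_min[OF grad_f]) auto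
  then have "gradf xs \<bullet> gradf xs = 0" by (rule fun_cong)
  then have fixp: "T xs = xs" by (simp add: T_def)
  \<comment> \<open>The mean of \<open>X0\<close>, assembled from linear functionals, whose
    integrability is what Herbst's argument provides.\<close>
  define a where "a = (\<Sum>b\<in>Basis. expectation (\<lambda>w. b \<bullet> X0 w) *\<^sub>R b)"
  \<comment> \<open>A positive constant is needed to divide by; for \<open>\<kappa>0 = 0\<close> any value up to \<open>\<eta>\<close> is harmless.\<close>
  define \<kappa> where "\<kappa> = (if 0 < \<kappa>0 then \<kappa>0 else \<eta>)"
  have \<kappa>: "0 < \<kappa>" "\<kappa>0 \<le> \<kappa>" using eta by (auto simp: \<kappa>_def)
  note [measurable] = X0_meas
  interpret X0: prob_space "distr M borel X0" by (intro prob_space_distr) measurable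
  have X0_lin: "integrable M (\<lambda>w. u \<bullet> X0 w)" "subgaussian M (\<lambda>w. u \<bullet> X0 w - expectation (\<lambda>w. u \<bullet> X0 w)) \<kappa>0"
    if u: "norm u \<le> 1" for u
  proof -
    have sets: "sets (distr M borel X0) = sets borel" by simp
    note ls = log_sobolev_subgaussian[OF X0.prob_space_axioms sets LSI kappa0 u]
    have E: "(\<integral>x. u \<bullet> x \<partial>distr M borel X0) = expectation (\<lambda>w. u \<bullet> X0 w)"
      by (rule integral_distr) measurable
    show "integrable M (\<lambda>w. u \<bullet> X0 w)"
      by (rule integrable_distr[OF X0_meas ls(1)])
    show "subgaussian M (\<lambda>w. u \<bullet> X0 w - expectation (\<lambda>w. u \<bullet> X0 w)) \<kappa>0"
      using subgaussian_distr[OF X0_meas ls(2)] unfolding E .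
  qed
  have mean: "expectation (\<lambda>w. u \<bullet> X0 w) = u \<bullet> a" for u
  proof -
    have "u \<bullet> X0 w = (\<Sum>b\<in>Basis. (u \<bullet> b) * (b \<bullet> X0 w))" for w
      by (subst euclidean_inner) (simp add: inner_commute)
    then have "expectation (\<lambda>w. u \<bullet> X0 w) = (\<Sum>b\<in>Basis. (u \<bullet> b) * expectation (\<lambda>w. b \<bullet> X0 w))"
      using X0_lin(1) by (simp add: Bochner_Integration.integral_sum)
    then show ?thesis by (simp add: a_def inner_sum_right mult.commute)
  qed
  have X0_sub: "subgaussian M (\<lambda>w. u \<bullet> (X0 w - a)) \<kappa>" if "norm u \<le> 1" for u
    using subgaussian_mono[OF X0_lin(2)[OF that] \<kappa>(2)] by (simp add: mean inner_diff_right)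
  \<comment> \<open>Square integrability follows from the log-Sobolev inequality; thus the
    expectation in \<open>m2\<close> is not a default value.\<close>
  have X0_sq: "integrable M (\<lambda>w. (norm (X0 w - y))^2)" for y
  proof (rule integrable_pointwise_bound)
    show "integrable M (\<lambda>w. 2 * (norm (X0 w - a))^2 + 2 * (norm (a - y))^2)"
      using subgaussian_norm_sq(1)[OF X0_sub \<kappa>(1)] by simp
  qed (auto intro: norm_diff_sq_le)
  \<comment> \<open>Jensen's inequality coordinate by coordinate: \<open>m2\<close> speaks of the
    random start, the deviation lemma of its mean.\<close>
  have burn0: "(norm (a - xs))^2 \<le> expectation (\<lambda>w. (norm (X0 w - xs))^2)"
  proof -
    have i: "integrable M (\<lambda>w. ((X0 w - xs) \<bullet> b)^2)" if "b \<in> Basis" for b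
      by (rule integrable_pointwise_bound[OF X0_sq[of xs]])
         (use inner_unit_sq_le[of b] that in \<open>auto simp: inner_commute[of _ b]\<close>)
    have "expectation (\<lambda>w. (X0 w - xs) \<bullet> b) = (a - xs) \<bullet> b" if "b \<in> Basis" for b
      using X0_lin(1)[of b] mean[of b] that by (simp add: inner_diff_left inner_diff_right inner_commute prob_space)
    then have "(norm (a - xs))^2 = (\<Sum>b\<in>Basis. (expectation (\<lambda>w. (X0 w - xs) \<bullet> b))^2)"
      unfolding norm_sq_eq_sum_Basis by simp
    also have "\<dots> \<le> (\<Sum>b\<in>Basis. expectation (\<lambda>w. ((X0 w - xs) \<bullet> b)^2))"
      by (intro sum_mono square_expectation_le i) measurable
    also have "\<dots> = expectation (\<lambda>w. (norm (X0 w - xs))^2)"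
      unfolding norm_sq_eq_sum_Basis using i by (simp add: Bochner_Integration.integral_sum)
    finally show ?thesis .
  qed
  have \<kappa>_burn: "\<kappa> * \<rho> ^ (m+1) \<le> \<eta>"
  proof (cases "0 < \<kappa>0")
    case True
    have "\<kappa>0 / \<eta> * \<rho> ^ (m+1) \<le> 1"
      using m1[OF True] True eta unfolding \<rho>_def[symmetric] by (intro power_le_of_log_ratio_le rho) auto
    then show ?thesis using True eta by (simp add: \<kappa>_def pos_divide_le_eq)
  next
    case False
    then show ?thesis using rho eta unfolding \<kappa>_def by (simp add: mult_left_le power_le_one del: power_Suc)
  qed
  have burn: "4 * ((norm (a - xs))^2 + real CARD('d) / \<alpha>) * \<rho> ^ (m+1) \<le> \<eta> * real n"
  proof -
    let ?E = "expectation (\<lambda>w. (norm (X0 w - xs))^2)"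
    have pos: "0 < ?E + real CARD('d) / \<alpha>"
      using alpha_pos by (intro add_nonneg_pos) auto
    have "4 * (?E + real CARD('d) / \<alpha>) / (\<eta> * real n) * \<rho> ^ (m+1) \<le> 1"
      using m2 pos eta n_pos unfolding \<rho>_def[symmetric] by (intro power_le_of_log_ratio_le rho) auto
    then have "4 * (?E + real CARD('d) / \<alpha>) * \<rho> ^ (m+1) \<le> \<eta> * real n"
      using eta n_pos by (simp add: pos_divide_le_eq)
    moreover have "4 * ((norm (a - xs))^2 + real CARD('d) / \<alpha>) * \<rho> ^ (m+1) \<le> 4 * (?E + real CARD('d) / \<alpha>) * \<rho> ^ (m+1)"
      using burn0 rho by (intro mult_right_mono mult_left_mono add_mono) auto
    ultimately show ?thesis by linarith
  qed
  from sphere_net_exists[where 'd='d] obtain S :: "(real^'d) set"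
    where S0: "finite S \<and> S \<subseteq> sphere 0 1 \<and> card S \<le> 9 ^ CARD('d) \<and>
      (\<forall>x. norm x = 1 \<longrightarrow> (\<exists>u\<in>S. norm (x - u) \<le> 1/4))" by (rule exE)
  then have S: "finite S" "S \<subseteq> sphere 0 1" "card S \<le> 9 ^ CARD('d)"
    "\<And>x. norm x = 1 \<Longrightarrow> \<exists>u\<in>S. norm (x - u) \<le> 1/4" by simp_all
  define t where "t = (9 * real CARD('d) + 4 * ln (1 / \<delta>)) / (\<alpha> * \<eta> * real n)"
  define F where "F u w = spread (\<lambda>i. u \<bullet> X (X0 w) i w) {m+1..m+n} / sqrt (real n)" for u w
  have \<delta>1: "\<delta> \<le> 1" using False by simp
  have t0: "0 \<le> t"
  proof -
    have "0 \<le> ln (1 / \<delta>)" using delta \<delta>1 by simp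
    then show ?thesis unfolding t_def using \<alpha>\<eta>0 by (intro divide_nonneg_nonneg add_nonneg_nonneg) auto
  qed
  have s2: "s^2 = 2 * \<eta>" using eta by (simp add: s_def)
  from quadratic_form_deviation[OF alpha_pos eta(1) \<alpha>\<eta> \<rho>_def s2 fixp n_pos X0_meas X0_sub \<kappa>(1) \<kappa>_burn burn delta \<delta>1 S,
      folded t_def, folded F_def]
  obtain B where B0: "B \<in> events \<and> prob B \<le> 3 * \<delta> \<and>
     (\<forall>u\<in>S. \<forall>w\<in>space M - B. \<bar>(F u w)^2 - expectation (\<lambda>w. (F u w)^2)\<bar> \<le> 5 * t / \<alpha> + 18 * sqrt t / \<alpha>)"
    by (rule exE)
  then have B: "B \<in> events" "prob B \<le> 3 * \<delta>"
    "\<And>u w. u \<in> S \<Longrightarrow> w \<in> space M - B \<Longrightarrow>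
       \<bar>(F u w)^2 - expectation (\<lambda>w. (F u w)^2)\<bar> \<le> 5 * t / \<alpha> + 18 * sqrt t / \<alpha>"
    by simp_all
  define Y where "Y i w = ula gradf \<eta> X0 Z i w" for i w
  have Y_eq: "Y i w = X (X0 w) i w" for i w
  proof -
    have "T = (\<lambda>x. x - \<eta> *\<^sub>R gradf x)" by (rule ext) (rule T_def)
    then show ?thesis unfolding Y_def X_def ula_eq_chain by (simp only: s_def)
  qed
  have Y_meas[measurable]: "Y i \<in> borel_measurable M" for i
  proof -
    have "Y i = (\<lambda>w. X (X0 w) i w)" by (rule ext) (rule Y_eq)
    then show ?thesis using X_random_init_measurable[OF X0_meas] by (simp only:)
  qed
  have Y_sq: "integrable M (\<lambda>w. (norm (Y i w))^2)" for i
  proof (rule integrable_pointwise_bound)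
    \<comment> \<open>Coupling with the chain started at the minimizer, whose second moments are
      already bounded.\<close>
    let ?g = "\<lambda>w. 2 * (norm (X0 w - xs))^2 + 2 * (2 * (norm (X xs i w - xs))^2 + 2 * (norm xs)^2)"
    show "integrable M ?g" using X0_sq[of xs] X_second_moment(1)[OF fixp, of xs i] by simp
    fix w
    have "norm (Y i w - X xs i w) \<le> \<rho> ^ i * norm (X0 w - xs)"
      unfolding Y_eq X_def by (rule chain_diff_init)
    also have "\<dots> \<le> 1 * norm (X0 w - xs)"
      using rho by (intro mult_right_mono power_le_one) auto
    finally have "(norm (Y i w - X xs i w))^2 \<le> (norm (X0 w - xs))^2"
      by (intro power_mono) auto
    then have "(norm (Y i w))^2 \<le> ?g w"
      using norm_diff_sq_le[of "Y i w" 0 "X xs i w"] norm_diff_sq_le[of "X xs i w" 0 xs]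
      unfolding diff_0_right by argo
    then show "norm ((norm (Y i w))^2) \<le> ?g w" by simp
  qed auto
  define C where "C w = sample_cov (\<lambda>i. Y i w) m n" for w
  have C_int: "integrable M C" unfolding C_def[abs_def] by (rule integrable_sample_cov[OF Y_meas Y_sq])
  have [measurable]: "C \<in> borel_measurable M" using C_int by (rule borel_measurable_integrable)
  have C_quad: "u \<bullet> (C w *v u) = (F u w)^2" for u w
    unfolding C_def F_def inner_sample_cov[OF n_pos] Y_eq ..
  let ?b = "16 / \<alpha> * max (8 * sqrt t) t"
  have bound: "onorm (\<lambda>v. (C w - expectation C) *v v) \<le> ?b" if w: "w \<in> space M - B" for w
  proof -
    have "onorm (\<lambda>v. (C w - expectation C) *v v) \<le> 2 * (5 * t / \<alpha> + 18 * sqrt t / \<alpha>)"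
    proof (rule symmetric_matrix_net_bound[OF _ S(2,4)])
      have "transpose (C w) = C w" for w unfolding C_def by (rule transpose_sample_cov)
      moreover have "transpose (expectation C) = expectation C"
        by (rule transpose_expectation[OF C_int]) (simp add: C_def transpose_sample_cov)
      moreover have "transpose (A - A') = transpose A - transpose A'" for A A' :: "real^'d^'d"
        by (simp add: transpose_def vec_eq_iff)
      ultimately show "transpose (C w - expectation C) = C w - expectation C" by simp
      fix u assume u: "u \<in> S"
      have "u \<bullet> ((C w - expectation C) *v u) = (F u w)^2 - expectation (\<lambda>w. (F u w)^2)"
        by (simp add: matrix_vector_mult_diff_rdistrib inner_diff_right inner_expectation_matrix[OF C_int] C_quad)
      then show "\<bar>u \<bullet> ((C w - expectation C) *v u)\<bar> \<le> 5 * t / \<alpha> + 18 * sqrt t / \<alpha>"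
        using B(3)[OF u w] by simp
    qed
    also have "\<dots> \<le> ?b" by (rule deviation_bound_le_max[OF alpha_pos t0])
    finally show ?thesis .
  qed
  let ?G = "{w \<in> space M. onorm (\<lambda>v. (C w - expectation C) *v v) \<le> ?b}"
  have closed: "{A :: real^'d^'d. onorm (\<lambda>v. A *v v) \<le> ?b} \<in> sets borel"
    by (intro borel_closed closed_onorm_le)
  have "(\<lambda>w. C w - expectation C) \<in> borel_measurable M"
    using C_int by (intro borel_measurable_diff borel_measurable_const borel_measurable_integrable)
  from measurable_sets[OF this closed] have "(\<lambda>w. C w - expectation C) -` {A. onorm (\<lambda>v. A *v v) \<le> ?b} \<inter> space M \<in> events"
    .
  also have "(\<lambda>w. C w - expectation C) -` {A. onorm (\<lambda>v. A *v v) \<le> ?b} \<inter> space M = ?G" by auto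
  finally have G_events: "?G \<in> events" .
  \<comment> \<open>The three kinds of bad events cost \<open>3 * \<delta>\<close>; the stated
    \<open>4 * \<delta>\<close> leaves one \<open>\<delta>\<close> to spare.\<close>
  have "1 - 4 * \<delta> \<le> 1 - prob B" using B(2) delta by simp
  also have "\<dots> = prob (space M - B)" using B(1) by (simp add: prob_compl)
  also have "\<dots> \<le> prob ?G" using bound by (intro finite_measure_mono G_events) auto
  finally show ?thesis unfolding C_def[abs_def] Y_def[abs_def] t_def .
qed

end
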